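(* Let $T\in\mathcal{T}_{\mathrm{BV}}$ have no regular invariant graph (i.e. no $p,q$-invariant open tube for any $p,q\in\mathbb{N}$), and suppose $T$ is not minimal. Let $M\subseteq\mathbb{T}^2$ be a minimal set of $T$. Then each connected component of $M$ is contained in a single fibre $\pi_1^{-1}(\theta)=\{\theta\}\times\mathbb{T}^1$.
   Context: $\mathbb{T}^1=\mathbb{R}/\mathbb{Z}$, $\mathbb{T}^2=\mathbb{T}^1\times\mathbb{T}^1$, $\pi_1$ the projection to the first coordinate, $\omega\in[0,1)$ irrational. $\mathcal{T}_{\mathrm{BV}}$: maps $T(\theta,x)=(\theta+\omega,T_\theta(x))$ on $\mathbb{T}^2$, homotopic to the identity, with fibre maps orientation-preserving $C^1$ circle diffeomorphisms, $DT_\theta(x)$ continuous in $(\theta,x)$, and $V(T):=\int_{\mathbb{T}^1}V_\theta\,d\theta<\infty$, $V_\theta$ the total variation of $\log DT_\theta$ over the circle. A minimal set is a nonempty closed $T$-invariant set containing no proper nonempty closed $T$-invariant subset; $T$ is minimal if $\mathbb{T}^2$ is a minimal set. An open $T$-invariant set $U$ is a $1,q$-invariant open tube if each fibre $U_\theta=\{x:(\theta,x)\in U\}$ consists of $q$ disjoint nonempty open intervals and $U$ is connected; if $U^1$ is a $1,q$-invariant open tube for $T^p$ and $U^i:=T^{i-1}(U^1)$, $i=1,\dots,p$, are pairwise disjoint, $\bigcup_iU^i$ is a $p,q$-invariant open tube. A regular invariant graph is the boundary line of such a tube, so having no regular invariant graph means there is no $p,q$-invariant open tube. (Such $T$ is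 topologically transitive.) *)

theory Defs
  imports "HOL-Analysis.Analysis"
begin

definition circle :: "complex set" where
  "circle = sphere 0 1"

definition torus :: "(complex \<times> complex) set" where
  "torus = circle \<times> circle"

definition tproj :: "real \<times> real \<Rightarrow> complex \<times> complex" where
  "tproj = (\<lambda>(\<theta>, x). (cis (2 * pi * \<theta>), cis (2 * pi * x)))"

text \<open>The skew product T(theta,x) = (theta + omega, T_theta(x)) on the torus, given by a lift
  f : R^2 -> R of the fibre maps (f(theta,.) lifts T_theta).\<close>

definition skew_map :: "real \<Rightarrow> (real \<times> real \<Rightarrow> real) \<Rightarrow> complex \<times> complex \<Rightarrow> complex \<times> complex" where
  "skew_map \<omega> f z = (SOME w. \<exists>\<theta> x. z = tproj (\<theta>, x) \<and> w = tproj (\<theta> + \<omega>, f (\<theta>, x)))"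

definition total_variation :: "(real \<Rightarrow> real) \<Rightarrow> real \<Rightarrow> real \<Rightarrow> ennreal" where
  "total_variation g a b =
     (SUP xs \<in> {xs. sorted xs \<and> set xs \<subseteq> {a..b}}.
        ennreal (\<Sum>i < length xs - 1. \<bar>g (xs ! Suc i) - g (xs ! i)\<bar>))"

text \<open>Membership of the skew product with fibre lift f in the class T_BV:
  continuous, homotopic to the identity (lift 1-periodic in theta, degree one in x),
  fibre maps orientation preserving C^1 diffeomorphisms (positive derivative Df),
  Df jointly continuous, and V(T) = integral over theta of the total variation of
  log DT_theta over the circle is finite.\<close>

definition in_T_BV :: "(real \<times> real \<Rightarrow> real) \<Rightarrow> bool" where
  "in_T_BV f \<longleftrightarrow> (\<exists>Df :: real \<times> real \<Rightarrow> real.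
      continuous_on UNIV f
    \<and> (\<forall>\<theta> x. f (\<theta> + 1, x) = f (\<theta>, x))
    \<and> (\<forall>\<theta> x. f (\<theta>, x + 1) = f (\<theta>, x) + 1)
    \<and> (\<forall>\<theta> x. ((\<lambda>y. f (\<theta>, y)) has_real_derivative Df (\<theta>, x)) (at x))
    \<and> (\<forall>\<theta> x. Df (\<theta>, x) > 0)
    \<and> continuous_on UNIV Df
    \<and> set_nn_integral lborel {0..1} (\<lambda>\<theta>. total_variation (\<lambda>x. ln (Df (\<theta>, x))) 0 1) < \<infinity>)"

definition minimal_set :: "(complex \<times> complex \<Rightarrow> complex \<times> complex) \<Rightarrow> (complex \<times> complex) set \<Rightarrow> bool" where
  "minimal_set S M \<longleftrightarrow> M \<noteq> {} \<and> M \<subseteq> torus \<and> closed M \<and> S ` M = M \<and>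
     (\<forall>A. A \<subseteq> M \<and> A \<noteq> {} \<and> closed A \<and> S ` A = A \<longrightarrow> A = M)"

definition fibre :: "(complex \<times> complex) set \<Rightarrow> complex \<Rightarrow> complex set" where
  "fibre U \<theta> = {x. (\<theta>, x) \<in> U}"

text \<open>1,q-invariant open tube: open in the torus, invariant, connected, and each fibre is the
  disjoint union of q nonempty open arcs (i.e. a proper open subset of the circle with exactly
  q connected components).\<close>

definition open_tube_1 :: "(complex \<times> complex \<Rightarrow> complex \<times> complex) \<Rightarrow> nat \<Rightarrow> (complex \<times> complex) set \<Rightarrow> bool" where
  "open_tube_1 S q U \<longleftrightarrow> openin (top_of_set torus) U \<and> S ` U = U \<and> connected U \<and>
     (\<forall>\<theta>\<in>circle. fibre U \<theta> \<noteq> circle \<and> finite (components (fibre U \<theta>)) \<and>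
                  card (components (fibre U \<theta>)) = q)"

definition has_pq_tube :: "(complex \<times> complex \<Rightarrow> complex \<times> complex) \<Rightarrow> bool" where
  "has_pq_tube S \<longleftrightarrow> (\<exists>p q U1. p \<ge> 1 \<and> q \<ge> 1 \<and> open_tube_1 (S ^^ p) q U1 \<and>
     (\<forall>i<p. \<forall>j<p. i \<noteq> j \<longrightarrow> (S ^^ i) ` U1 \<inter> (S ^^ j) ` U1 = {}))"

end

(*
  Lift to the plane: M is closed and minimal under the abelian group H generated by the lift F and
  the unit translations S, X in base and fibre; let W be a component of its complement.

  If no element of H with small horizontal displacement returns W to itself, then a box in W has
  pairwise disjoint images, and images over a common base interval are linearly ordered.  As the
  endpoints of the gaps of M are recurrent, there are infinitely many closest returns F^n; between a
  box and its closest return the first n iterates are disjoint in every fibre, so the classical Denjoy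
  argument, integrated over the base, bounds the integral of the log-lengths of the n-th images from
  below by the integrated variation, although these lengths are summable: a contradiction.

  Hence W is stabilised by two elements with independent horizontal displacements, or by a vertical
  translation.  In the first case a winding number on a cylinder shows that W has bounded height, and
  counting the translates of W below a point of M (a lower semicontinuous count that differs by an
  invariant from an upper semicontinuous one, hence is locally constant by minimality) gives an index
  on M that is monotone in the fibres; the gap between two of its levels projects to a p,q-tube.  In the
  second case W contains a vertical loop, which cuts off a clopen piece of M bounded to one side; by
  minimality such pieces can be chosen arbitrarily thin around every point of M, so that components of
  M lie in fibres.
*)

theory Submission
  imports Defs "HOL-Complex_Analysis.Winding_Numbers"
begin

section \<open>Lifts of forced circle maps and the group of deck transformations and iterates\<close>

text \<open>The obstacle is that the variation is only integrable over the base: single fibres may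
  have arbitrarily large variation, so distortion cannot be controlled fibre by fibre. Every
  estimate is therefore made for a box over a base interval \<open>J\<close> and integrated. The
  i-th image of the box lies over \<open>J\<close> shifted by i \<omega>, so two images can be
  compared only where their base intervals overlap; this is why the case distinction speaks of
  returns with small horizontal displacement. Having such returns at every scale is strong: one
  whose displacement is small enough compared with another cannot be proportional to it, which
  yields the two independent stabilising elements. By irrationality the only group elements without
  displacement are the vertical translations, and these form the remaining case. The plane is used
  instead of the torus because there the fibres are linearly ordered, and because the way in which a
  complementary region winds around the torus becomes readable from the stabiliser of its
  lift.\<close>

lemma add_int_of_add_1:
  fixes g :: "real \<Rightarrow> real"
  assumes "\<And>x. g (x + 1) = g x + c"
  shows "g (x + of_int k) = g x + of_int k * c"
proof (induction k rule: int_induct[where k = 0])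
  case (step1 k)
  then show ?case using assms[of "x + of_int k"] by (simp add: algebra_simps)
next
  case (step2 k)
  then show ?case using assms[of "x + of_int (k - 1)"] by (simp add: algebra_simps)
qed simp

text \<open>Vertical periodicity lets the fibre coordinate be taken in the compact interval [0, 1],
  and projecting along a compact factor preserves closedness.\<close>

lemma closed_fst_image:
  fixes A :: "(real \<times> real) set"
  assumes "closed A" and "\<And>\<theta> x l. (\<theta>, x) \<in> A \<Longrightarrow> (\<theta>, x + of_int l) \<in> A"
  shows "closed (fst ` A)"
proof -
  have "fst ` A = {\<theta>. \<exists>x. x \<in> {0..1} \<and> (x, \<theta>) \<in> prod.swap ` A}"
  proof (intro set_eqI iffI)
    fix \<theta> assume "\<theta> \<in> fst ` A"
    then obtain x where x: "(\<theta>, x) \<in> A" by auto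
    have "(\<theta>, x + of_int (- \<lfloor>x\<rfloor>)) \<in> A" by (rule assms(2)[OF x])
    then have "(frac x, \<theta>) \<in> prod.swap ` A"
      by (force simp: frac_def image_iff)
    moreover have "frac x \<in> {0..1}"
      using frac_lt_1[of x] by auto
    ultimately show "\<theta> \<in> {\<theta>. \<exists>x. x \<in> {0..1} \<and> (x, \<theta>) \<in> prod.swap ` A}" by blast
  qed force
  moreover have "prod.swap ` A = prod.swap -` A"
    by (auto simp: image_iff) (metis swap_simp)
  moreover have "closed (prod.swap -` A)"
    by (rule continuous_closed_vimage[OF assms(1)]) (auto intro!: continuous_intros simp: prod.swap_def)
  ultimately show ?thesis
    using closed_compact_projection[of "{0..1::real}" "prod.swap ` A"] by auto
qed

text \<open>The numbers i \<omega> + k are dense in the line. The scale \<open>a\<close> serves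
  \<open>gap_eq_if_meet\<close>, where the residue of an index is kept only by displacements scaled
  by \<open>Q\<close>.\<close>

lemma irrational_translation_invariant_UNIV:
  fixes \<omega> :: real and B :: "real set"
  assumes irr: "\<omega> \<notin> \<rat>" and "closed B" "B \<noteq> {}" "a > 0"
    and inv: "\<And>\<theta> i k. \<theta> \<in> B \<Longrightarrow> \<theta> + a * (of_int i * \<omega> + of_int k) \<in> B"
  shows "B = UNIV"
proof -
  obtain b where b: "b \<in> B" using assms by auto
  have "t \<in> B" for t
  proof -
    have "t \<in> closure B"
      unfolding closure_approachable
    proof (intro allI impI)
      fix e :: real assume "e > 0"
      then have "e / a > 0" using assms by auto
      then obtain h k where hk: "\<bar>of_int k * \<omega> - of_int h - (t - b) / a\<bar> < e / a"
        using sequence_of_fractional_parts_is_dense[OF irr] by metis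
      have "b + a * (of_int k * \<omega> + of_int (- h)) - t
          = a * (of_int k * \<omega> - of_int h - (t - b) / a)"
        using assms by (simp add: field_simps)
      then have "\<bar>b + a * (of_int k * \<omega> + of_int (- h)) - t\<bar> = a * \<bar>of_int k * \<omega> - of_int h - (t - b) / a\<bar>"
        using assms by (simp add: abs_mult)
      also have "\<dots> < e"
        using hk assms by (simp add: field_simps)
      finally show "\<exists>y\<in>B. dist y t < e"
        using inv[OF b, of k "- h"] by (auto simp: dist_real_def)
    qed
    then show ?thesis using assms by (simp add: closure_closed)
  qed
  then show ?thesis by auto
qed

text \<open>A cocycle indexed by all integers, so that inverse iterates need no separate treatment.
  Only the topology is recorded; smoothness enters with \<open>bv_minimal_lift\<close>.\<close>

locale skew_lift =
  fixes \<omega> :: real and \<phi> :: "int \<Rightarrow> real \<Rightarrow> real \<Rightarrow> real"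
  assumes irr: "\<omega> \<notin> \<rat>"
    and phi_0: "\<phi> 0 \<theta> x = x"
    and phi_add: "\<phi> (i + j) \<theta> x = \<phi> i (\<theta> + of_int j * \<omega>) (\<phi> j \<theta> x)"
    and phi_cont: "continuous_on UNIV (\<lambda>z. \<phi> i (fst z) (snd z))"
    and phi_mono: "x < y \<Longrightarrow> \<phi> i \<theta> x < \<phi> i \<theta> y"
    and phi_base: "\<phi> i (\<theta> + 1) x = \<phi> i \<theta> x"
    and phi_deg: "\<phi> i \<theta> (x + 1) = \<phi> i \<theta> x + 1"
begin

lemma phi_mono_iff [simp]: "\<phi> i \<theta> x < \<phi> i \<theta> y \<longleftrightarrow> x < y"
  by (metis linorder_cases order_less_imp_not_less phi_mono)

lemma phi_le_iff [simp]: "\<phi> i \<theta> x \<le> \<phi> i \<theta> y \<longleftrightarrow> x \<le> y"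
  by (meson linorder_not_less phi_mono_iff)

lemma phi_base_int [simp]: "\<phi> i (\<theta> + of_int k) x = \<phi> i \<theta> x"
  using add_int_of_add_1[of "\<lambda>\<theta>. \<phi> i \<theta> x" 0] phi_base by simp

lemma phi_deg_int [simp]: "\<phi> i \<theta> (x + of_int l) = \<phi> i \<theta> x + of_int l"
  using add_int_of_add_1[of "\<phi> i \<theta>" 1] phi_deg by simp

lemma continuous_on_phi_compose [continuous_intros]:
  "continuous_on S u \<Longrightarrow> continuous_on S v \<Longrightarrow> continuous_on S (\<lambda>t. \<phi> i (u t) (v t))"
  using continuous_on_compose2[OF phi_cont, of S "\<lambda>t. (u t, v t)" i] by (simp add: continuous_on_Pair)

text \<open>The iterate and the two unit translations commute, because the lift is 1-periodic in the
  base and of degree one in the fibre; so composition adds the index triples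
  (\<open>act_act\<close>).\<close>

definition act :: "int \<Rightarrow> int \<Rightarrow> int \<Rightarrow> real \<times> real \<Rightarrow> real \<times> real" where
  "act i k l z = (fst z + of_int i * \<omega> + of_int k, \<phi> i (fst z) (snd z) + of_int l)"

lemma act_0 [simp]: "act 0 0 0 z = z"
  by (simp add: act_def phi_0)

lemma act_translate: "act 0 k l z = (fst z + of_int k, snd z + of_int l)"
  by (simp add: act_def phi_0)

lemma act_act [simp]: "act i k l (act i' k' l' z) = act (i + i') (k + k') (l + l') z"
proof -
  have "\<phi> i (fst z + of_int i' * \<omega> + of_int k') (\<phi> i' (fst z) (snd z) + of_int l')
      = \<phi> (i + i') (fst z) (snd z) + of_int l'"
    by (simp add: phi_add)
  then show ?thesis by (simp add: act_def algebra_simps)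
qed

lemma act_inv [simp]: "act (- i) (- k) (- l) (act i k l z) = z" "act i k l (act (- i) (- k) (- l) z) = z"
  by simp_all

lemma fst_act [simp]: "fst (act i k l z) = fst z + of_int i * \<omega> + of_int k"
  by (simp add: act_def)

lemma inj_act: "inj (act i k l)"
  by (metis act_inv(1) injI)

lemma image_act: "act i k l ` A = act (- i) (- k) (- l) -` A"
proof (intro set_eqI iffI)
  fix z assume "z \<in> act (- i) (- k) (- l) -` A"
  then have "act i k l (act (- i) (- k) (- l) z) \<in> act i k l ` A" by blast
  then show "z \<in> act i k l ` A" by simp
qed auto

lemma continuous_on_act [continuous_intros]: "continuous_on S (act i k l)"
  unfolding act_def by (intro continuous_intros)

lemma open_act: "open A \<Longrightarrow> open (act i k l ` A)"
  unfolding image_act by (metis continuous_on_act continuous_on_open_vimage inf_top.right_neutral open_UNIV)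

lemma closed_act: "closed A \<Longrightarrow> closed (act i k l ` A)"
  unfolding image_act by (metis continuous_on_act continuous_on_closed_vimage inf_top.right_neutral closed_UNIV)

lemma connected_act: "connected A \<Longrightarrow> connected (act i k l ` A)"
  by (simp add: connected_continuous_image continuous_on_act)

lemma act_less:
  assumes "fst z = fst w"
  shows "snd (act i k l z) < snd (act i k l w) \<longleftrightarrow> snd z < snd w"
  using assms by (simp add: act_def)

text \<open>Irrationality makes (i, k) recoverable from the displacement, so the group elements that
  keep every fibre are exactly the vertical translations.\<close>

lemma displacement_eq_0_iff: "of_int i * \<omega> + of_int k = 0 \<longleftrightarrow> i = 0 \<and> k = (0::int)"
proof
  assume h: "of_int i * \<omega> + of_int k = 0"
  have "i = 0"
  proof (rule ccontr)
    assume "i \<noteq> 0"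
    then have "\<omega> = - of_int k / of_int i" using h by (simp add: field_simps)
    then have "\<omega> \<in> \<rat>" by (simp add: Rats_divide)
    then show False using irr by simp
  qed
  then show "i = 0 \<and> k = 0" using h by auto
qed auto

end

text \<open>Minimality refers to the whole group: the lifted map alone drifts off in the base and
  has no recurrence.\<close>

locale minimal_lift = skew_lift +
  fixes M :: "(real \<times> real) set"
  assumes closed_M: "closed M" and M_nonempty: "M \<noteq> {}" and M_proper: "M \<noteq> UNIV"
    and M_act: "z \<in> M \<Longrightarrow> act i k l z \<in> M"
    and M_minimal: "closed A \<Longrightarrow> A \<subseteq> M \<Longrightarrow> A \<noteq> {} \<Longrightarrow> (\<And>i k l z. z \<in> A \<Longrightarrow> act i k l z \<in> A) \<Longrightarrow> A = M"
begin

lemma M_act_iff [simp]: "act i k l z \<in> M \<longleftrightarrow> z \<in> M"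
  by (metis M_act act_inv(1))

lemma M_translate_iff [simp]: "(\<theta> + of_int k, x + of_int l) \<in> M \<longleftrightarrow> (\<theta>, x) \<in> M"
  using M_act_iff[of 0 k l "(\<theta>, x)"] by (simp add: act_translate)

lemma M_shift_iff [simp]: "(\<theta>, x + of_int l) \<in> M \<longleftrightarrow> (\<theta>, x) \<in> M"
  using M_translate_iff[of \<theta> 0 x l] by simp

lemma M_fibre_nonempty: "\<exists>x. (\<theta>, x) \<in> M"
proof -
  have "fst ` M = UNIV"
  proof (rule irrational_translation_invariant_UNIV[OF irr, where a = 1])
    show "closed (fst ` M)"
      by (rule closed_fst_image[OF closed_M]) simp
    show "fst ` M \<noteq> {}" using M_nonempty by auto
    fix \<theta> i k assume "\<theta> \<in> fst ` M"
    then obtain z where "z \<in> M" "\<theta> = fst z" by auto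
    then show "\<theta> + 1 * (of_int i * \<omega> + of_int k) \<in> fst ` M"
      using imageI[OF M_act[of z i k 0], of fst] by (simp add: add.assoc)
  qed auto
  then show ?thesis by (metis UNIV_I fst_conv imageE prod.collapse)
qed

lemma M_fibre_near: "\<exists>x. (\<theta>, x) \<in> M \<and> c \<le> x \<and> x < c + 1"
proof -
  obtain x where "(\<theta>, x) \<in> M" using M_fibre_nonempty by blast
  then have "(\<theta>, x + of_int (- \<lfloor>x - c\<rfloor>)) \<in> M" by (simp only: M_shift_iff)
  moreover have "c \<le> x + of_int (- \<lfloor>x - c\<rfloor>)" "x + of_int (- \<lfloor>x - c\<rfloor>) < c + 1"
    by simp_all linarith+
  ultimately show ?thesis by blast
qed

lemma closed_subset_M:
  assumes "A \<subseteq> M" and "\<And>z. z \<in> M \<Longrightarrow> z \<notin> A \<Longrightarrow> \<exists>T. open T \<and> z \<in> T \<and> T \<inter> A = {}"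
  shows "closed A"
proof -
  have "\<exists>T. open T \<and> z \<in> T \<and> T \<subseteq> - A" if "z \<in> - A" for z
  proof (cases "z \<in> M")
    case True
    then show ?thesis using assms(2)[of z] that by blast
  next
    case False
    then show ?thesis using closed_M assms(1) by (intro exI[of _ "- M"]) auto
  qed
  then show ?thesis by (simp add: closed_def open_subopen[of "- A"])
qed

text \<open>By minimality every orbit meets the ball, so finitely many preimages of the ball cover
  the part of \<open>M\<close> in a unit square. This cover is applied to a later iterate of
  \<open>z\<close> in order to make the total time positive.\<close>

lemma M_recurrent:
  assumes z: "z \<in> M" and e: "e > 0"
  obtains i k l where "i \<ge> 1" "dist (act i k l z) z < e"
proof -
  define K where "K = M \<inter> ({0..1} \<times> {0..1})"
  define Oc where "Oc h = (case h of (i, k, l) \<Rightarrow> act i k l -` ball z e)" for h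
  have "compact K" unfolding K_def
    by (simp add: closed_M compact_Times closed_Int_compact)
  moreover have "open (Oc h)" for h
  proof -
    obtain i k l where [simp]: "h = (i, k, l)" by (cases h)
    show ?thesis unfolding Oc_def
      by simp (metis continuous_on_act continuous_on_open_vimage inf_top.right_neutral open_UNIV open_ball)
  qed
  moreover have "K \<subseteq> \<Union> (range Oc)"
  proof (rule ccontr)
    assume "\<not> K \<subseteq> \<Union> (range Oc)"
    then obtain w where w: "w \<in> M" "\<And>i k l. act i k l w \<notin> ball z e"
      unfolding K_def Oc_def by force
    define A where "A = {w \<in> M. \<forall>i k l. act i k l w \<notin> ball z e}"
    have "A = M \<inter> (\<Inter>i. \<Inter>k. \<Inter>l. act i k l -` (- ball z e))"
      unfolding A_def by auto
    moreover have "closed (act i k l -` (- ball z e))" for i k l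
      by (metis continuous_on_act continuous_on_closed_vimage inf_top.right_neutral closed_UNIV open_ball open_closed)
    ultimately have "closed A" using closed_M by (auto intro!: closed_INT simp del: ball_simps vimage_Compl)
    moreover have "w \<in> A" using w unfolding A_def by blast
    moreover have "act i k l v \<in> A" if "v \<in> A" for i k l v
      using that by (simp add: A_def)
    moreover have "A \<subseteq> M" by (auto simp: A_def)
    ultimately have "A = M"
      using M_minimal[of A] by (metis empty_iff)
    then have "act 0 0 0 z \<notin> ball z e" using z unfolding A_def by blast
    then show False using e by simp
  qed
  ultimately obtain F where F: "finite F" "K \<subseteq> (\<Union>h\<in>F. Oc h)"
    by (metis compactE_image[of K UNIV Oc] subset_UNIV)
  define N where "N = Max (insert 0 ((\<lambda>h. \<bar>fst h\<bar>) ` F))"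
  have N: "\<bar>fst h\<bar> \<le> N" if "h \<in> F" for h
    unfolding N_def using F(1) that by (intro Max_ge) auto
  \<comment> \<open>All times in the finite cover are at least -\<open>N\<close>, so starting
    \<open>N + 1\<close> iterations ahead leaves a total time of at least 1.\<close>
  define w where "w = act (N + 1) 0 0 z"
  have "w \<in> M" using z unfolding w_def by (simp only: M_act_iff)
  define w' where "w' = act 0 (- \<lfloor>fst w\<rfloor>) (- \<lfloor>snd w\<rfloor>) w"
  have "w' \<in> M" using \<open>w \<in> M\<close> unfolding w'_def by (simp only: M_act_iff)
  have "w' \<in> {0..1} \<times> {0..1}"
    unfolding w'_def act_translate mem_Times_iff by auto linarith+
  then obtain h where h: "h \<in> F" "w' \<in> Oc h" using F(2) \<open>w' \<in> M\<close> unfolding K_def by blast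
  obtain i k l where [simp]: "h = (i, k, l)" by (cases h)
  have "act i k l w' \<in> ball z e" using h(2) unfolding Oc_def by simp
  then have "dist (act (i + (N + 1)) (k + (- \<lfloor>fst w\<rfloor>)) (l + (- \<lfloor>snd w\<rfloor>)) z) z < e"
    unfolding w'_def by (simp add: dist_commute) (simp add: w_def)
  moreover have "i + (N + 1) \<ge> 1" using N[OF h(1)] by simp
  ultimately show thesis using that by blast
qed

section \<open>Complementary components and their stabilisers\<close>

lemma stabiliser_mem_iff:
  assumes "act i k l ` W = W"
  shows "act i k l z \<in> W \<longleftrightarrow> z \<in> W"
  using assms inj_act inj_image_mem_iff by metis

lemma stabiliser_add:
  assumes "act i k l ` W = W" "act i' k' l' ` W = W"
  shows "act (i + i') (k + k') (l + l') ` W = W"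
proof -
  have "act (i + i') (k + k') (l + l') ` W = act i k l ` act i' k' l' ` W" by (simp add: image_image)
  then show ?thesis using assms by simp
qed

lemma stabiliser_minus:
  assumes "act i k l ` W = W"
  shows "act (- i) (- k) (- l) ` W = W"
proof -
  have "act (- i) (- k) (- l) ` act i k l ` W = W" by (simp add: image_image)
  then show ?thesis using assms by simp
qed

lemma stabiliser_mult:
  assumes "act i k l ` W = W"
  shows "act (n * i) (n * k) (n * l) ` W = W"
proof (induction n rule: int_induct[where k = 0])
  case base
  then show ?case by simp
next
  case (step1 n)
  then show ?case using stabiliser_add[OF step1(2) assms] by (simp add: algebra_simps)
next
  case (step2 n)
  then show ?case using stabiliser_add[OF step2(2) stabiliser_minus[OF assms]] by (simp add: algebra_simps)
qed

text \<open>A group element is a homeomorphism preserving \<open>M\<close>, hence permutes the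
  complementary components; maximality is pulled back by the inverse element.\<close>

lemma components_act:
  assumes "W \<in> components (- M)"
  shows "act i k l ` W \<in> components (- M)"
proof -
  have sub: "act i k l ` A \<subseteq> - M" if "A \<subseteq> - M" for A i k l
    using that by auto
  have W: "W \<noteq> {}" "connected W" "W \<subseteq> - M" "\<And>C. C \<noteq> {} \<Longrightarrow> C \<subseteq> - M \<Longrightarrow> connected C \<Longrightarrow> W \<subseteq> C \<Longrightarrow> C = W"
    using assms in_components_maximal[of W "- M"] by blast+
  show ?thesis
    unfolding in_components_maximal[of _ "- M"]
  proof (intro conjI allI impI)
    fix C assume C: "C \<noteq> {} \<and> act i k l ` W \<subseteq> C \<and> C \<subseteq> - M \<and> connected C"
    have "act (- i) (- k) (- l) ` C = W"
    proof (rule W(4))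
      show "W \<subseteq> act (- i) (- k) (- l) ` C"
      proof
        fix w assume "w \<in> W"
        then have "act i k l w \<in> C" using C by auto
        then have "act (- i) (- k) (- l) (act i k l w) \<in> act (- i) (- k) (- l) ` C" by blast
        then show "w \<in> act (- i) (- k) (- l) ` C" by simp
      qed
    qed (use C sub connected_act in auto)
    then have "act i k l ` act (- i) (- k) (- l) ` C = act i k l ` W" by simp
    then show "C = act i k l ` W" by (simp add: image_image)
  qed (use W sub connected_act in auto)
qed

lemma act_component_cases:
  assumes "W \<in> components (- M)"
  shows "act i k l ` W = W \<or> act i k l ` W \<inter> W = {}"
  using components_nonoverlap[OF components_act[OF assms] assms] by blast

end

section \<open>Variation along disjoint arcs\<close>

text \<open>Induction in the order of left endpoints: once the rightmost interval is removed, the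
  others end before its left endpoint, which becomes the new right bound.\<close>

lemma sum_disjoint_increments_le:
  fixes \<Phi> :: "real \<Rightarrow> real" and u w :: "'i \<Rightarrow> real"
  assumes mono: "mono \<Phi>" and fin: "finite I" and ab: "a \<le> b"
    and uw: "\<And>i. i \<in> I \<Longrightarrow> a \<le> u i \<and> u i \<le> w i \<and> w i \<le> b"
    and disj: "\<And>i j. i \<in> I \<Longrightarrow> j \<in> I \<Longrightarrow> i \<noteq> j \<Longrightarrow> u i \<le> u j \<Longrightarrow> w i \<le> u j"
  shows "(\<Sum>i\<in>I. \<Phi> (w i) - \<Phi> (u i)) \<le> \<Phi> b - \<Phi> a"
  using fin ab uw disj
proof (induction I arbitrary: b rule: finite_ranking_induct[where f = u])
  case empty
  then show ?case using monoD[OF mono] by simp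
next
  case (insert x S)
  show ?case
  proof (cases "x \<in> S")
    case True
    then show ?thesis using insert by (simp add: insert_absorb)
  next
    case False
    have "(\<Sum>i\<in>S. \<Phi> (w i) - \<Phi> (u i)) \<le> \<Phi> (u x) - \<Phi> a"
    proof (rule insert.IH)
      fix i assume i: "i \<in> S"
      then have "w i \<le> u x" using insert.prems(3)[of i x] insert.hyps(2)[of i] False by auto
      then show "a \<le> u i \<and> u i \<le> w i \<and> w i \<le> u x" using insert.prems(2)[of i] i by auto
    qed (use insert.prems in auto)
    moreover have "\<Phi> (w x) \<le> \<Phi> b" using insert.prems(2)[of x] monoD[OF mono] by simp
    ultimately show ?thesis using insert.hyps(1) False by simp
  qed
qed

text \<open>Disjointness from all integer translates means that the arcs are disjoint on the circle.
  Cutting the circle at a left endpoint leaves disjoint intervals in one period, over which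
  \<open>\<Phi>\<close> grows by \<open>V\<close>.\<close>

lemma sum_disjoint_arc_increments_le:
  fixes \<Phi> :: "real \<Rightarrow> real" and u w :: "'i \<Rightarrow> real"
  assumes mono: "mono \<Phi>" and per: "\<And>x. \<Phi> (x + 1) = \<Phi> x + V" and fin: "finite I"
    and uw: "\<And>i. i \<in> I \<Longrightarrow> u i \<le> w i"
    and disj: "\<And>i j l. i \<in> I \<Longrightarrow> j \<in> I \<Longrightarrow> i \<noteq> j \<or> l \<noteq> 0 \<Longrightarrow> u i \<le> u j + of_int l \<Longrightarrow> w i \<le> u j + of_int l"
  shows "(\<Sum>i\<in>I. \<Phi> (w i) - \<Phi> (u i)) \<le> V"
proof (cases "I = {}")
  case True
  then show ?thesis using monoD[OF mono, of 0 1] per[of 0] by simp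
next
  case False
  have per_int: "\<Phi> (x + of_int l) = \<Phi> x + of_int l * V" for x l
    by (rule add_int_of_add_1[of \<Phi> V, OF per])
  define u' where "u' i = u i - of_int \<lfloor>u i\<rfloor>" for i
  define w' where "w' i = w i - of_int \<lfloor>u i\<rfloor>" for i
  obtain m where m: "m \<in> I" "\<And>i. i \<in> I \<Longrightarrow> u' m \<le> u' i"
    using arg_min_if_finite(1)[OF fin False, of u'] arg_min_least[OF fin False, of _ u'] by metis
  have u': "0 \<le> u' i" "u' i < 1" for i unfolding u'_def by linarith+
  have "\<Phi> (w i) - \<Phi> (u i) = \<Phi> (w' i) - \<Phi> (u' i)" for i
    using per_int[of "w' i" "\<lfloor>u i\<rfloor>"] per_int[of "u' i" "\<lfloor>u i\<rfloor>"] by (simp add: u'_def w'_def)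
  then have "(\<Sum>i\<in>I. \<Phi> (w i) - \<Phi> (u i)) = (\<Sum>i\<in>I. \<Phi> (w' i) - \<Phi> (u' i))" by simp
  also have "\<dots> \<le> \<Phi> (u' m + 1) - \<Phi> (u' m)"
  proof (rule sum_disjoint_increments_le[OF mono fin])
    fix i assume i: "i \<in> I"
    \<comment> \<open>Measured from the unit cell of \<open>u i\<close>, this translate of
      \<open>u m\<close> is the end of the period that starts at \<open>u' m\<close>. For
      \<open>i = m\<close> it is a shift by exactly 1, so the disjointness hypothesis still
      applies.\<close>
    define l where "l = 1 + \<lfloor>u i\<rfloor> - \<lfloor>u m\<rfloor>"
    have im: "i \<noteq> m \<or> l \<noteq> 0" by (auto simp: l_def)
    have e: "u m + of_int l = u' m + 1 + of_int \<lfloor>u i\<rfloor>" by (simp add: l_def u'_def)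
    have "u i \<le> u' m + 1 + of_int \<lfloor>u i\<rfloor>" using u'[of i] u'[of m] unfolding u'_def by linarith
    then have "w i \<le> u m + of_int l" using disj[OF i m(1) im] unfolding e by blast
    then show "u' m \<le> u' i \<and> u' i \<le> w' i \<and> w' i \<le> u' m + 1"
      using m(2)[OF i] uw[OF i] e by (simp add: u'_def w'_def)
  next
    fix i j assume ij: "i \<in> I" "j \<in> I" "i \<noteq> j" "u' i \<le> u' j"
    have "w i \<le> u j + of_int (\<lfloor>u i\<rfloor> - \<lfloor>u j\<rfloor>)"
      using ij by (intro disj) (auto simp: u'_def)
    then show "w' i \<le> u' j" by (simp add: u'_def w'_def)
  qed auto
  also have "\<dots> = V" using per by simp
  finally show ?thesis .
qed

section \<open>Total variation as the increment of a monotone function\<close>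

abbreviation jumps :: "(real \<Rightarrow> real) \<Rightarrow> real list \<Rightarrow> real" where
  "jumps g xs \<equiv> \<Sum>i < length xs - 1. \<bar>g (xs ! Suc i) - g (xs ! i)\<bar>"

text \<open>A sorted list in [0, x] is prolonged by the points \<open>x\<close> and
  \<open>y\<close>. This superadditivity is what lets the cumulative variation absorb the increments
  of \<open>g\<close>.\<close>

lemma total_variation_append:
  assumes "0 \<le> x" "x \<le> y"
  shows "total_variation g 0 x + ennreal \<bar>g y - g x\<bar> \<le> total_variation g 0 y"
proof -
  have "jumps g xs + \<bar>g y - g x\<bar>
      \<le> jumps g (xs @ [x, y])" for xs
  proof -
    have eq: "length (xs @ [x, y]) - 1 = Suc (length xs)" by simp
    have "jumps g xs
        = (\<Sum>i < length xs - 1. \<bar>g ((xs @ [x, y]) ! Suc i) - g ((xs @ [x, y]) ! i)\<bar>)"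
      by (intro sum.cong) (auto simp: nth_append)
    also have "\<dots> \<le> (\<Sum>i < length xs. \<bar>g ((xs @ [x, y]) ! Suc i) - g ((xs @ [x, y]) ! i)\<bar>)"
      by (intro sum_mono2) auto
    finally show ?thesis unfolding eq by (simp add: nth_append)
  qed
  then have le: "ennreal (jumps g xs) + ennreal \<bar>g y - g x\<bar>
      \<le> total_variation g 0 y" if "sorted xs" "set xs \<subseteq> {0..x}" for xs
    unfolding total_variation_def
    using that assms
    by (intro SUP_upper2[of "xs @ [x, y]"]) (auto simp: sorted_append simp flip: ennreal_plus intro!: ennreal_leI sum_nonneg)
  have ne: "{xs::real list. sorted xs \<and> set xs \<subseteq> {0..x}} \<noteq> {}" by (auto intro!: exI[of _ "[]"])
  have "total_variation g 0 x + ennreal \<bar>g y - g x\<bar>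
      = (SUP xs \<in> {xs. sorted xs \<and> set xs \<subseteq> {0..x}}.
        ennreal (jumps g xs) + ennreal \<bar>g y - g x\<bar>)"
    unfolding total_variation_def using ne by (subst ennreal_SUP_add_left) auto
  also have "\<dots> \<le> total_variation g 0 y"
    using le by (intro SUP_least) auto
  finally show ?thesis .
qed

text \<open>\<open>\<Phi>\<close> is the cumulative variation on [0, 1], continued so that each
  period adds the total variation. It reduces variation along arcs to increments of a monotone
  function.\<close>

lemma periodic_variation_function:
  fixes g :: "real \<Rightarrow> real"
  assumes per: "\<And>x. g (x + 1) = g x" and fin: "total_variation g 0 1 < \<infinity>"
  obtains \<Phi> where "mono \<Phi>" "\<And>x. \<Phi> (x + 1) = \<Phi> x + enn2real (total_variation g 0 1)"
    "\<And>x y. x \<le> y \<Longrightarrow> \<bar>g y - g x\<bar> \<le> \<Phi> y - \<Phi> x"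
proof -
  define v where "v x = enn2real (total_variation g 0 x)" for x
  have v: "v x + \<bar>g y - g x\<bar> \<le> v y" if "0 \<le> x" "x \<le> y" "y \<le> 1" for x y
  proof -
    have "total_variation g 0 y \<le> total_variation g 0 1"
    proof -
      have "total_variation g 0 y \<le> total_variation g 0 y + ennreal \<bar>g 1 - g y\<bar>" by simp
      also have "\<dots> \<le> total_variation g 0 1" using that by (intro total_variation_append) auto
      finally show ?thesis .
    qed
    then have fy: "total_variation g 0 y < \<infinity>" using fin by (rule le_less_trans)
    have le: "total_variation g 0 x + ennreal \<bar>g y - g x\<bar> \<le> total_variation g 0 y"
      by (rule total_variation_append[OF that(1,2)])
    then have fx: "total_variation g 0 x < \<infinity>" using fy
      by (simp add: ennreal_add_eq_top less_top[symmetric] top_unique) (auto simp: top_unique)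
    have "enn2real (total_variation g 0 x + ennreal \<bar>g y - g x\<bar>) \<le> enn2real (total_variation g 0 y)"
      using le fy by (intro enn2real_mono) auto
    then show ?thesis using fx by (simp add: v_def enn2real_plus)
  qed
  have g_int: "g (x + of_int l) = g x" for x l
    using add_int_of_add_1[of g 0] per by simp
  have g_frac: "g (frac x) = g x" for x
    using g_int[of x "- \<lfloor>x\<rfloor>"] by (simp add: frac_def)
  define V where "V = v 1"
  define \<Phi> where "\<Phi> x = of_int \<lfloor>x\<rfloor> * V + v (frac x)" for x
  have 2: "\<Phi> (x + 1) = \<Phi> x + V" for x
    by (simp add: \<Phi>_def frac_def algebra_simps)
  have 3: "\<bar>g y - g x\<bar> \<le> \<Phi> y - \<Phi> x" if "x \<le> y" for x y
  proof (cases "\<lfloor>x\<rfloor> = \<lfloor>y\<rfloor>")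
    case True
    then have "frac x \<le> frac y" using that by (simp add: frac_def)
    then have "v (frac x) + \<bar>g (frac y) - g (frac x)\<bar> \<le> v (frac y)"
      using frac_ge_0[of x] frac_lt_1[of y] by (intro v) auto
    then show ?thesis using True by (simp add: \<Phi>_def g_frac)
  next
    \<comment> \<open>Between different unit cells the increment is split at the integers, where
      \<open>g\<close> always takes the same value.\<close>
    case False
    then have f: "\<lfloor>x\<rfloor> + 1 \<le> \<lfloor>y\<rfloor>" using floor_mono[OF that] by simp
    have "V \<ge> 0" by (simp add: V_def v_def)
    then have "of_int (\<lfloor>x\<rfloor> + 1) * V \<le> of_int \<lfloor>y\<rfloor> * V"
      using f by (intro mult_right_mono) auto
    moreover have "v (frac x) + \<bar>g 1 - g (frac x)\<bar> \<le> V" unfolding V_def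
      using frac_lt_1[of x] frac_ge_0[of x] by (intro v) auto
    moreover have "v 0 + \<bar>g (frac y) - g 0\<bar> \<le> v (frac y)"
      using frac_lt_1[of y] frac_ge_0[of y] by (intro v) auto
    moreover have "v 0 \<ge> 0" by (simp add: v_def)
    moreover have "g 1 = g 0" using per[of 0] by simp
    ultimately show ?thesis by (simp add: \<Phi>_def g_frac algebra_simps)
  qed
  have 1: "mono \<Phi>"
  proof (rule monoI)
    fix x y :: real assume "x \<le> y"
    then show "\<Phi> x \<le> \<Phi> y" using 3[of x y] abs_ge_zero[of "g y - g x"] by linarith
  qed
  show thesis using that[OF 1 _ 3] 2 by (simp add: V_def v_def)
qed

lemma sum_disjoint_arc_variation_le:
  fixes g :: "real \<Rightarrow> real" and u w :: "'i \<Rightarrow> real"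
  assumes per: "\<And>x. g (x + 1) = g x" and fin: "finite I"
    and uw: "\<And>i. i \<in> I \<Longrightarrow> u i \<le> w i"
    and disj: "\<And>i j l. i \<in> I \<Longrightarrow> j \<in> I \<Longrightarrow> i \<noteq> j \<or> l \<noteq> 0 \<Longrightarrow> u i \<le> u j + of_int l \<Longrightarrow> w i \<le> u j + of_int l"
  shows "(\<Sum>i\<in>I. ennreal \<bar>g (w i) - g (u i)\<bar>) \<le> total_variation g 0 1"
proof (cases "total_variation g 0 1 < \<infinity>")
  case False
  then show ?thesis by (simp add: less_top[symmetric])
next
  case True
  obtain \<Phi> where \<Phi>: "mono \<Phi>" "\<And>x. \<Phi> (x + 1) = \<Phi> x + enn2real (total_variation g 0 1)"
    "\<And>x y. x \<le> y \<Longrightarrow> \<bar>g y - g x\<bar> \<le> \<Phi> y - \<Phi> x"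
    using periodic_variation_function[OF per True] by metis
  have "(\<Sum>i\<in>I. \<bar>g (w i) - g (u i)\<bar>) \<le> (\<Sum>i\<in>I. \<Phi> (w i) - \<Phi> (u i))"
    by (intro sum_mono \<Phi>(3) uw)
  also have "\<dots> \<le> enn2real (total_variation g 0 1)"
    by (rule sum_disjoint_arc_increments_le[OF \<Phi>(1,2) fin uw disj])
  finally have "ennreal (\<Sum>i\<in>I. \<bar>g (w i) - g (u i)\<bar>) \<le> ennreal (enn2real (total_variation g 0 1))"
    by (rule ennreal_leI)
  also have "\<dots> = total_variation g 0 1" using True by (simp add: less_top)
  finally show ?thesis by (simp add: sum_ennreal)
qed

text \<open>An integral over the line is a sum of integrals over unit intervals; after the shift by
  i \<omega> each piece lives on the base circle. A bound for the sum over everything lying above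
  one point of that circle can then be integrated.\<close>

lemma nn_integral_shift_orbit_le:
  fixes \<psi> :: "int \<Rightarrow> real \<Rightarrow> ennreal"
  assumes fin: "finite I" and meas: "\<And>i. i \<in> I \<Longrightarrow> \<psi> i \<in> borel_measurable borel"
    and supp: "\<And>i s. i \<in> I \<Longrightarrow> s \<notin> {a..b} \<Longrightarrow> \<psi> i s = 0"
    and le: "\<And>K t. finite K \<Longrightarrow> 0 \<le> t \<Longrightarrow> t \<le> 1 \<Longrightarrow>
      (\<Sum>(i, k)\<in>I \<times> K. \<psi> i (t + of_int k - of_int i * \<omega>)) \<le> B t"
  shows "(\<Sum>i\<in>I. \<integral>\<^sup>+s. \<psi> i s \<partial>lborel) \<le> set_nn_integral lborel {0..1} B"
proof -
  let ?I = "\<lambda>i k. \<integral>\<^sup>+t. \<psi> i (t + of_int k - of_int i * \<omega>) * indicator {0..1} t \<partial>lborel"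
  let ?I' = "\<lambda>i k. \<integral>\<^sup>+s. \<psi> i (s - of_int i * \<omega>) * indicator {0..1} (s - of_int k) \<partial>lborel"
  \<comment> \<open>Large enough that every function, shifted by i \<omega>, is supported in
    [-c, c]; then the finitely many unit cells in \<open>K\<close> suffice.\<close>
  define c where "c = (\<Sum>i\<in>I. \<bar>of_int i * \<omega>\<bar>) + \<bar>a\<bar> + \<bar>b\<bar>"
  define K where "K = {\<lfloor>- c\<rfloor>..\<lfloor>c\<rfloor>}"
  have ic: "\<bar>of_int i * \<omega>\<bar> + \<bar>a\<bar> + \<bar>b\<bar> \<le> c" if "i \<in> I" for i
    unfolding c_def using that member_le_sum[OF that, of "\<lambda>i. \<bar>of_int i * \<omega>\<bar>"] fin by simp
  have 1: "(\<integral>\<^sup>+s. \<psi> i s \<partial>lborel) \<le> (\<Sum>k\<in>K. ?I i k)"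
    if i: "i \<in> I" for i
  proof -
    note [measurable] = meas[OF i]
    have "(\<integral>\<^sup>+s. \<psi> i s \<partial>lborel) = (\<integral>\<^sup>+s. \<psi> i (- (of_int i * \<omega>) + 1 * s) \<partial>lborel)"
      by (subst nn_integral_real_affine[of "\<psi> i" 1 "- (of_int i * \<omega>)"]) auto
    also have "\<dots> = (\<integral>\<^sup>+s. \<psi> i (s - of_int i * \<omega>) \<partial>lborel)" by simp
    also have "\<dots> \<le> (\<integral>\<^sup>+s. (\<Sum>k\<in>K. \<psi> i (s - of_int i * \<omega>) * indicator {0..1} (s - of_int k)) \<partial>lborel)"
    proof (rule nn_integral_mono)
      fix s
      show "\<psi> i (s - of_int i * \<omega>) \<le> (\<Sum>k\<in>K. \<psi> i (s - of_int i * \<omega>) * indicator {0..1} (s - of_int k))"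
      proof (cases "s - of_int i * \<omega> \<in> {a..b}")
        case False
        then show ?thesis using supp[OF i] by simp
      next
        case True
        then have "- c \<le> s" "s \<le> c" using ic[OF i] by auto
        then have k: "\<lfloor>s\<rfloor> \<in> K" unfolding K_def by (auto intro: floor_mono)
        have "s - of_int \<lfloor>s\<rfloor> \<in> {0..1}" by auto linarith
        then have "\<psi> i (s - of_int i * \<omega>) = \<psi> i (s - of_int i * \<omega>) * indicator {0..1} (s - of_int \<lfloor>s\<rfloor>)"
          by simp
        also have "\<dots> \<le> (\<Sum>k\<in>K. \<psi> i (s - of_int i * \<omega>) * indicator {0..1} (s - of_int k))"
          by (rule member_le_sum[OF k]) (auto simp: K_def)
        finally show ?thesis .
      qed
    qed
    also have "\<dots> = (\<Sum>k\<in>K. ?I' i k)"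
      by (rule nn_integral_sum) measurable
    also have "\<dots> = (\<Sum>k\<in>K. ?I i k)"
    proof (rule sum.cong)
      fix k
      show "?I' i k
        = ?I i k"
      proof -
        have m: "(\<lambda>s. \<psi> i (s - of_int i * \<omega>) * indicator {0..1} (s - of_int k)) \<in> borel_measurable borel"
          by measurable
        show ?thesis
          using nn_integral_real_affine[OF m, of 1 "of_int k"] by (simp add: add.commute)
      qed
    qed simp
    finally show ?thesis .
  qed
  have "(\<Sum>i\<in>I. \<integral>\<^sup>+s. \<psi> i s \<partial>lborel)
      \<le> (\<Sum>i\<in>I. \<Sum>k\<in>K. ?I i k)"
    by (intro sum_mono 1)
  also have "\<dots> = (\<Sum>p\<in>I \<times> K. \<integral>\<^sup>+t. \<psi> (fst p) (t + of_int (snd p) - of_int (fst p) * \<omega>) * indicator {0..1} t \<partial>lborel)"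
    by (simp add: sum.cartesian_product case_prod_unfold)
  also have "\<dots> = (\<integral>\<^sup>+t. (\<Sum>p\<in>I \<times> K. \<psi> (fst p) (t + of_int (snd p) - of_int (fst p) * \<omega>) * indicator {0..1} t) \<partial>lborel)"
  proof (rule nn_integral_sum[symmetric])
    fix p assume "p \<in> I \<times> K"
    then have [measurable]: "\<psi> (fst p) \<in> borel_measurable borel" using meas by auto
    show "(\<lambda>t. \<psi> (fst p) (t + of_int (snd p) - of_int (fst p) * \<omega>) * indicator {0..1} t) \<in> borel_measurable lborel"
      by measurable
  qed
  also have "\<dots> \<le> set_nn_integral lborel {0..1} B"
  proof (rule nn_integral_mono)
    fix t :: real
    show "(\<Sum>p\<in>I \<times> K. \<psi> (fst p) (t + of_int (snd p) - of_int (fst p) * \<omega>) * indicator {0..1} t) \<le> B t * indicator {0..1} t"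
    proof (cases "t \<in> {0..1}")
      case True
      have "finite K" by (simp add: K_def)
      from le[OF this, of t] True show ?thesis by (simp add: case_prod_unfold)
    qed simp
  qed
  finally show ?thesis .
qed

section \<open>Boxes without close returns\<close>

lemma connected_disjoint_less:
  fixes A B :: "real set"
  assumes "connected A" "connected B" "A \<inter> B = {}" "a \<in> A" "b \<in> B" "a \<le> b" "a' \<in> A" "b' \<in> B"
  shows "a' < b'"
proof (rule ccontr)
  assume n: "\<not> a' < b'"
  show False
  proof (cases "b' \<le> a")
    case True
    then have "a \<in> B" using connectedD_interval[OF assms(2,8,5)] assms(6) by auto
    then show False using assms by auto
  next
    case False
    then have "b' \<in> A" using connectedD_interval[OF assms(1,4,7)] n by auto
    then show False using assms by auto
  qed
qed

text \<open>The constants fit together as follows: \<open>J\<close> has half-width \<rho>; a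
  displacement after which \<open>J\<close> still meets itself is at most 2 \<rho>; preimages of
  points of \<open>J\<close> then stay within 3 \<rho> of \<open>t0\<close>; and two such
  displacements differ by at most 4 \<rho>.\<close>

locale wandering_box = minimal_lift +
  fixes W :: "(real \<times> real) set" and t0 \<rho> x1 x2 :: real
  assumes W_component: "W \<in> components (- M)" and \<rho>_pos: "\<rho> > 0" and x12: "x1 < x2"
    and box: "\<And>\<theta> x. \<bar>\<theta> - t0\<bar> \<le> 3 * \<rho> \<Longrightarrow> x \<in> {x1..x2} \<Longrightarrow> (\<theta>, x) \<in> W"
    and wander: "\<And>m k l. (m, k, l) \<noteq> (0, 0, 0) \<Longrightarrow> \<bar>of_int m * \<omega> + of_int k\<bar> \<le> 4 * \<rho> \<Longrightarrow>
      act m k l ` W \<inter> W = {}"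
begin

definition near :: "int \<Rightarrow> int \<Rightarrow> bool" where
  "near m k \<longleftrightarrow> \<bar>of_int m * \<omega> + of_int k\<bar> \<le> 2 * \<rho>"

abbreviation pre :: "int \<Rightarrow> int \<Rightarrow> real \<Rightarrow> real" where
  "pre m k \<theta> \<equiv> \<theta> - of_int m * \<omega> - of_int k"

text \<open>The point over \<open>\<theta>\<close> of the image of the curve \<open>x = \<xi>\<close> under \<open>act m k l\<close>.\<close>

definition pt :: "int \<Rightarrow> int \<Rightarrow> int \<Rightarrow> real \<Rightarrow> real \<Rightarrow> real" where
  "pt m k l \<xi> \<theta> = \<phi> m (pre m k \<theta>) \<xi> + of_int l"

abbreviation J :: "real set" where "J \<equiv> {t0 - \<rho>..t0 + \<rho>}"

lemma near_0 [simp]: "near 0 0" using \<rho>_pos by (simp add: near_def)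

lemma pt_0 [simp]: "pt 0 0 0 \<xi> \<theta> = \<xi>" by (simp add: pt_def phi_0)

lemma pt_act: "(\<theta>, pt m k l \<xi> \<theta>) = act m k l (pre m k \<theta>, \<xi>)"
  by (simp add: pt_def act_def)

lemma pt_less_iff [simp]: "pt m k l \<xi> \<theta> < pt m k l \<xi>' \<theta> \<longleftrightarrow> \<xi> < \<xi>'"
  by (simp add: pt_def)

lemma pt_le_iff [simp]: "pt m k l \<xi> \<theta> \<le> pt m k l \<xi>' \<theta> \<longleftrightarrow> \<xi> \<le> \<xi>'"
  by (simp add: pt_def)

lemma pt_shift: "pt m k l \<xi> \<theta> = pt m k 0 \<xi> \<theta> + of_int l"
  by (simp add: pt_def)

lemma continuous_pt_x: "continuous_on S (\<lambda>\<xi>. pt m k l \<xi> \<theta>)"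
  unfolding pt_def by (intro continuous_intros)

lemma continuous_pt_base: "continuous_on S (\<lambda>\<theta>. pt m k l \<xi> \<theta>)"
  unfolding pt_def by (intro continuous_intros)

lemma pt_in_act_W:
  assumes "near m k" "\<theta> \<in> J" "\<xi> \<in> {x1..x2}"
  shows "(\<theta>, pt m k l \<xi> \<theta>) \<in> act m k l ` W"
proof -
  have "\<bar>(pre m k \<theta>) - t0\<bar> \<le> 3 * \<rho>"
    using assms unfolding near_def by auto
  then show ?thesis unfolding pt_act using box assms(3) by blast
qed

lemma act_W_disjoint:
  assumes "near m k" "near m' k'" "(m, k, l) \<noteq> (m', k', l')"
  shows "act m k l ` W \<inter> act m' k' l' ` W = {}"
proof -
  have "\<bar>of_int (m - m') * \<omega> + of_int (k - k')\<bar> \<le> 4 * \<rho>"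
    using assms(1,2) unfolding near_def by (simp add: algebra_simps)
  then have d: "act (m - m') (k - k') (l - l') ` W \<inter> W = {}"
    using assms(3) by (intro wander) auto
  show ?thesis
  proof (rule ccontr)
    assume "act m k l ` W \<inter> act m' k' l' ` W \<noteq> {}"
    then obtain w w' where w: "w \<in> W" "w' \<in> W" "act m k l w = act m' k' l' w'" by blast
    then have "act (- m') (- k') (- l') (act m k l w) = w'" by simp
    then have "act (m - m') (k - k') (l - l') w = w'" by simp
    then show False using d w by blast
  qed
qed

text \<open>Over one base point the images of the box are disjoint connected subsets of a line, so a
  single comparison decides all others.\<close>

lemma pt_separated:
  assumes n: "near m k" "near m' k'" and ne: "(m, k, l) \<noteq> (m', k', l')" and \<theta>: "\<theta> \<in> J"
    and \<xi>: "\<xi> \<in> {x1..x2}" "\<xi>' \<in> {x1..x2}" and le: "pt m k l \<xi> \<theta> \<le> pt m' k' l' \<xi>' \<theta>"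
    and \<zeta>: "\<zeta> \<in> {x1..x2}" "\<zeta>' \<in> {x1..x2}"
  shows "pt m k l \<zeta> \<theta> < pt m' k' l' \<zeta>' \<theta>"
proof -
  let ?A = "(\<lambda>\<xi>. pt m k l \<xi> \<theta>) ` {x1..x2}" and ?B = "(\<lambda>\<xi>. pt m' k' l' \<xi> \<theta>) ` {x1..x2}"
  have "connected ?A" "connected ?B"
    by (auto intro!: connected_continuous_image continuous_pt_x)
  moreover have "?A \<inter> ?B = {}"
    using pt_in_act_W[OF n(1) \<theta>, of _ l] pt_in_act_W[OF n(2) \<theta>, of _ l'] act_W_disjoint[OF n ne]
    by fastforce
  ultimately show ?thesis
    using connected_disjoint_less[of ?A ?B "pt m k l \<xi> \<theta>" "pt m' k' l' \<xi>' \<theta>"] \<xi> \<zeta> le by blast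
qed

text \<open>Curves from different images never meet over \<open>J\<close>, so by the intermediate
  value theorem they cannot exchange their order.\<close>

lemma pt_order_const:
  assumes n: "near m k" "near m' k'" and ne: "(m, k, l) \<noteq> (m', k', l')" and \<theta>: "\<theta> \<in> J" "\<theta>' \<in> J"
    and less: "pt m k l x1 \<theta> < pt m' k' l' x1 \<theta>"
  shows "pt m k l x1 \<theta>' < pt m' k' l' x1 \<theta>'"
proof (rule ccontr)
  assume neg: "\<not> ?thesis"
  define d where "d t = pt m' k' l' x1 t - pt m k l x1 t" for t
  have "connected (d ` J)" unfolding d_def
    by (intro connected_continuous_image continuous_intros continuous_pt_base) auto
  moreover have "d \<theta>' \<in> d ` J" "d \<theta> \<in> d ` J" using \<theta> by auto
  ultimately have "0 \<in> d ` J"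
    using connectedD_interval[of "d ` J" "d \<theta>'" "d \<theta>" 0] less neg by (simp add: d_def)
  then obtain t where t: "t \<in> J" "pt m k l x1 t = pt m' k' l' x1 t" by (auto simp: d_def)
  have "pt m k l x1 t < pt m' k' l' x1 t"
    by (rule pt_separated[OF n ne t(1), of x1 x1]) (use t x12 in auto)
  then show False using t by simp
qed

lemma t0_J [simp]: "t0 \<in> J" using \<rho>_pos by simp

text \<open>The point of \<open>M\<close> closing the gap above the box is recurrent. A return that
  brings it close to itself carries the segment of \<open>W\<close> below it to a segment disjoint
  from \<open>W\<close>. This squeezes the image of the bottom curve between that curve and the
  returned point, hence below the return already given.\<close>

lemma pt_accumulate:
  assumes n': "near m' k'" and above: "x1 < pt m' k' l' x1 t0"
  obtains m k l where "near m k" "x1 < pt m k l x1 t0" "pt m k l x1 t0 < pt m' k' l' x1 t0"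
proof -
  define S where "S = {y. (t0, y) \<in> M \<and> x1 \<le> y}"
  have "S = Pair t0 -` M \<inter> {x1..}" by (auto simp: S_def)
  moreover have "closed (Pair t0 -` M)" by (rule continuous_closed_vimage[OF closed_M]) (auto intro!: continuous_intros)
  ultimately have "closed S" by auto
  have "S \<noteq> {}" using M_fibre_near[of t0 x1] by (auto simp: S_def)
  have "bdd_below S" by (auto simp: S_def bdd_below_def)
  define r where "r = Inf S"
  have rS: "r \<in> S" unfolding r_def using \<open>closed S\<close> \<open>S \<noteq> {}\<close> \<open>bdd_below S\<close> by (simp add: closed_contains_Inf)
  have W: "(t0, x1) \<in> W" using box[of t0 x1] \<rho>_pos x12 by simp
  have WM: "W \<subseteq> - M" using W_component by (rule in_components_subset)
  have "x1 < r" using rS W WM by (auto simp: S_def intro: order.not_eq_order_implies_strict)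
  have seg: "(t0, y) \<in> W" if "y \<in> {x1..<r}" for y
  proof -
    have "connected (Pair t0 ` {x1..<r})"
      by (intro connected_continuous_image continuous_intros) auto
    moreover have "Pair t0 ` {x1..<r} \<subseteq> - M"
    proof -
      have "(t0, y) \<notin> M" if "y \<in> {x1..<r}" for y
        using cInf_lower[OF _ \<open>bdd_below S\<close>, of y] that unfolding r_def S_def by force
      then show ?thesis by auto
    qed
    moreover have "W \<inter> Pair t0 ` {x1..<r} \<noteq> {}" using W \<open>x1 < r\<close> by auto
    ultimately have "Pair t0 ` {x1..<r} \<subseteq> W"
      using components_maximal[OF W_component] by blast
    then show ?thesis using that by auto
  qed
  have ne': "(m', k', l') \<noteq> (0, 0, 0)" using above by auto
  have p': "(t0, pt m' k' l' x1 t0) \<in> act m' k' l' ` W"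
    using pt_in_act_W[OF n' t0_J, of x1 l'] x12 by simp
  have dis: "act m' k' l' ` W \<inter> W = {}"
    using act_W_disjoint[OF n' near_0 ne'] by simp
  have "r < pt m' k' l' x1 t0"
  proof (rule ccontr)
    assume "\<not> r < pt m' k' l' x1 t0"
    moreover have "pt m' k' l' x1 t0 \<noteq> r"
    proof
      assume "pt m' k' l' x1 t0 = r"
      then have "(t0, r) \<in> act m' k' l' ` W" using p' by simp
      then have "(t0, r) \<notin> M" using in_components_subset[OF components_act[OF W_component, of m' k' l']] by blast
      then show False using rS by (simp add: S_def)
    qed
    ultimately have "(t0, pt m' k' l' x1 t0) \<in> W" using above by (intro seg) auto
    then show False using p' dis by blast
  qed
  define e where "e = (pt m' k' l' x1 t0 - r) / 2"
  have "e > 0" using \<open>r < pt m' k' l' x1 t0\<close> by (simp add: e_def)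
  have "continuous_on UNIV (\<lambda>\<theta>. pt m' k' l' x1 \<theta>)" by (rule continuous_pt_base)
  then obtain d where d: "d > 0" "\<And>\<theta>. dist \<theta> t0 < d \<Longrightarrow> dist (pt m' k' l' x1 \<theta>) (pt m' k' l' x1 t0) < e"
    using \<open>e > 0\<close> unfolding continuous_on_iff by (metis UNIV_I)
  \<comment> \<open>\<open>e\<close> and \<open>d\<close> keep the returned point below the given
    curve, \<rho> keeps it over \<open>J\<close>, and \<open>r - x1\<close> keeps it above the
    bottom of the box.\<close>
  define \<epsilon> where "\<epsilon> = Min {e, d, \<rho>, r - x1}"
  have \<epsilon>: "\<epsilon> > 0" "\<epsilon> \<le> e" "\<epsilon> \<le> d" "\<epsilon> \<le> \<rho>" "\<epsilon> \<le> r - x1"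
    using \<open>e > 0\<close> d(1) \<rho>_pos \<open>x1 < r\<close> by (auto simp: \<epsilon>_def)
  have "(t0, r) \<in> M" using rS by (simp add: S_def)
  then obtain m k l where mkl: "m \<ge> 1" "dist (act m k l (t0, r)) (t0, r) < \<epsilon>"
    using M_recurrent[OF _ \<epsilon>(1)] by metis
  define \<theta>1 where "\<theta>1 = t0 + of_int m * \<omega> + of_int k"
  define y where "y = pt m k l r \<theta>1"
  have ay: "act m k l (t0, r) = (\<theta>1, y)" by (simp add: y_def pt_act \<theta>1_def)
  have d1: "\<bar>\<theta>1 - t0\<bar> < \<epsilon>" "\<bar>y - r\<bar> < \<epsilon>"
    using mkl(2) dist_fst_le[of "(\<theta>1, y)" "(t0, r)"] dist_snd_le[of "(\<theta>1, y)" "(t0, r)"] unfolding ay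
    by (auto simp: dist_real_def)
  have near: "near m k" using d1 \<epsilon> \<rho>_pos by (simp add: near_def \<theta>1_def)
  have \<theta>1: "\<theta>1 \<in> J" using d1 \<epsilon> by auto
  have ne: "(m, k, l) \<noteq> (0, 0, 0)" using mkl by auto
  have below: "pt m k l x1 \<theta>1 < y" unfolding y_def using \<open>x1 < r\<close> by simp
  \<comment> \<open>Otherwise the image of the segment up to \<open>r\<close> would cross the height
    \<open>x1\<close>, at a point common to \<open>W\<close> and its image.\<close>
  have gt: "x1 < pt m k l x1 \<theta>1"
  proof (rule ccontr)
    assume "\<not> x1 < pt m k l x1 \<theta>1"
    moreover have "x1 < y" using d1 \<epsilon> by auto
    moreover have "connected ((\<lambda>\<xi>. pt m k l \<xi> \<theta>1) ` {x1..r})"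
      by (intro connected_continuous_image continuous_pt_x) auto
    ultimately have "x1 \<in> (\<lambda>\<xi>. pt m k l \<xi> \<theta>1) ` {x1..r}"
      using connectedD_interval[of "(\<lambda>\<xi>. pt m k l \<xi> \<theta>1) ` {x1..r}" "pt m k l x1 \<theta>1" y x1] \<open>x1 < r\<close>
      by (simp add: y_def)
    then obtain \<xi> where \<xi>: "\<xi> \<in> {x1..r}" "pt m k l \<xi> \<theta>1 = x1" by auto
    then have "\<xi> \<noteq> r" using \<open>x1 < y\<close> by (auto simp: y_def)
    then have "(t0, \<xi>) \<in> W" using \<xi> by (intro seg) auto
    then have "(\<theta>1, x1) \<in> act m k l ` W"
      using pt_act[of \<theta>1 m k l \<xi>] \<xi>(2) by (force simp: \<theta>1_def)
    moreover have "(\<theta>1, x1) \<in> W" using \<theta>1 x12 \<rho>_pos by (intro box) auto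
    ultimately show False using act_W_disjoint[OF near near_0 ne] by auto
  qed
  have lt: "pt m k l x1 \<theta>1 < pt m' k' l' x1 \<theta>1"
  proof -
    have "\<bar>pt m' k' l' x1 \<theta>1 - pt m' k' l' x1 t0\<bar> < e"
      using d(2)[of \<theta>1] d1 \<epsilon> by (simp add: dist_real_def)
    then show ?thesis using below d1 \<epsilon> unfolding e_def by (simp add: abs_less_iff) argo
  qed
  have neq: "(m, k, l) \<noteq> (m', k', l')" using lt by auto
  have "x1 < pt m k l x1 t0"
    using pt_order_const[OF near_0 near _ \<theta>1 t0_J, of 0 l] gt ne by auto
  moreover have "pt m k l x1 t0 < pt m' k' l' x1 t0"
    by (rule pt_order_const[OF near n' neq \<theta>1 t0_J lt])
  ultimately show thesis by (rule that[OF near])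
qed

lemma finite_int_between: "finite {l::int. a < c + real_of_int l \<and> c + real_of_int l < b}"
proof (rule finite_subset)
  show "{l::int. a < c + real_of_int l \<and> c + real_of_int l < b} \<subseteq> {\<lfloor>a - c\<rfloor>..\<lceil>b - c\<rceil>}"
    by auto linarith+
qed auto

text \<open>Only finitely many returns of time below \<open>N\<close> lie within height 1. The unit
  translation is added to make the list nonempty, and its lowest member is undercut by other
  returns. One of least absolute time among these is closest, since a still lower one of smaller
  time would undercut as well; as it is not on the list, its time is at least
  \<open>N\<close>.\<close>

lemma closest_return:
  obtains m k l where "near m k" "x1 < pt m k l x1 t0" "\<bar>m\<bar> \<ge> N"
    "\<And>m' k' l'. near m' k' \<Longrightarrow> \<bar>m'\<bar> < \<bar>m\<bar> \<Longrightarrow> x1 < pt m' k' l' x1 t0 \<Longrightarrow> \<not> pt m' k' l' x1 t0 < pt m k l x1 t0"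
proof -
  define D where "D = {(m, k, l). near m k \<and> \<bar>m\<bar> < N \<and> x1 < pt m k l x1 t0 \<and> pt m k l x1 t0 < x1 + 1}"
  have "finite D"
  proof -
    define K where "K = \<lceil>2 * \<rho> + of_int N * \<bar>\<omega>\<bar>\<rceil>"
    have "D \<subseteq> (\<Union>(m, k)\<in>{- N..N} \<times> {- K..K}. (\<lambda>l. (m, k, l)) ` {l. x1 < pt m k 0 x1 t0 + of_int l \<and> pt m k 0 x1 t0 + of_int l < x1 + 1})"
    proof
      fix x assume "x \<in> D"
      then obtain m k l where x: "x = (m, k, l)" and h: "near m k" "\<bar>m\<bar> < N" "x1 < pt m k l x1 t0" "pt m k l x1 t0 < x1 + 1"
        unfolding D_def by blast
      have "\<bar>of_int m * \<omega>\<bar> \<le> of_int N * \<bar>\<omega>\<bar>"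
        using h(2) unfolding abs_mult by (intro mult_right_mono) auto
      then have "\<bar>real_of_int k\<bar> \<le> 2 * \<rho> + of_int N * \<bar>\<omega>\<bar>" using h(1) unfolding near_def by linarith
      then have "\<bar>k\<bar> \<le> K" unfolding K_def by (metis ceiling_mono ceiling_of_int of_int_abs)
      then show "x \<in> (\<Union>(m, k)\<in>{- N..N} \<times> {- K..K}. (\<lambda>l. (m, k, l)) ` {l. x1 < pt m k 0 x1 t0 + of_int l \<and> pt m k 0 x1 t0 + of_int l < x1 + 1})"
        using h pt_shift[of m k l x1 t0] unfolding x by (intro UN_I[of "(m, k)"]) auto
    qed
    then show ?thesis by (rule finite_subset) (auto intro!: finite_int_between)
  qed
  define c where "c h = (case h of (m, k, l) \<Rightarrow> pt m k l x1 t0)" for h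
  define h where "h = arg_min_on c (insert (0, 0, 1) D)"
  have hD: "h \<in> insert (0, 0, 1) D" "\<And>h'. h' \<in> insert (0, 0, 1) D \<Longrightarrow> c h \<le> c h'"
    unfolding h_def using \<open>finite D\<close> arg_min_if_finite(1)[of "insert (0, 0, 1) D" c] arg_min_least[of "insert (0, 0, 1) D" _ c] by auto
  obtain mh kh lh where h: "h = (mh, kh, lh)" by (cases h)
  have c1: "c (0, 0, 1) = x1 + 1" by (simp add: c_def pt_shift[of 0 0 1])
  have nh: "near mh kh" using hD(1) h by (auto simp: D_def)
  have ch: "x1 < pt mh kh lh x1 t0" "pt mh kh lh x1 t0 \<le> x1 + 1"
    using hD(1) h c1 hD(2)[of "(0, 0, 1)"] by (auto simp: D_def c_def)
  define P where "P q \<longleftrightarrow> (\<exists>m k l. q = nat \<bar>m\<bar> \<and> near m k \<and> x1 < pt m k l x1 t0 \<and> pt m k l x1 t0 < pt mh kh lh x1 t0)" for q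
  have "\<exists>q. P q" using pt_accumulate[OF nh ch(1)] unfolding P_def by metis
  then have "P (LEAST q. P q)" by (metis LeastI)
  then obtain m k l where mkl: "(LEAST q. P q) = nat \<bar>m\<bar>" "near m k" "x1 < pt m k l x1 t0" "pt m k l x1 t0 < pt mh kh lh x1 t0"
    unfolding P_def by blast
  show thesis
  proof (rule that[of m k l, OF mkl(2,3)])
    show "N \<le> \<bar>m\<bar>"
    proof (rule ccontr)
      assume "\<not> \<bar>m\<bar> \<ge> N"
      then have "(m, k, l) \<in> D" using mkl ch by (auto simp: D_def)
      then have "c h \<le> c (m, k, l)" using hD(2) by blast
      then show False using mkl(4) h by (simp add: c_def)
    qed
    fix m' k' l' assume h': "near m' k'" "\<bar>m'\<bar> < \<bar>m\<bar>" "x1 < pt m' k' l' x1 t0"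
    show "\<not> pt m' k' l' x1 t0 < pt m k l x1 t0"
    proof
      assume "pt m' k' l' x1 t0 < pt m k l x1 t0"
      then have "P (nat \<bar>m'\<bar>)" unfolding P_def using h' mkl(4) order.strict_trans by blast
      then have "nat \<bar>m\<bar> \<le> nat \<bar>m'\<bar>" using mkl(1) Least_le[of P] by metis
      then show False using h'(2) by simp
    qed
  qed
qed

end

section \<open>The Denjoy estimate\<close>

text \<open>\<open>G\<close> is the logarithm of the fibre derivative, kept only through the mean
  value theorem: the logarithm of a chord slope is a value of \<open>G\<close> in between.\<close>

locale bv_minimal_lift = minimal_lift +
  fixes G :: "real \<Rightarrow> real \<Rightarrow> real"
  assumes log_slope: "\<And>\<theta> x y. x < y \<Longrightarrow>
      \<exists>\<xi>\<in>{x..y}. ln ((\<phi> 1 \<theta> y - \<phi> 1 \<theta> x) / (y - x)) = G \<theta> \<xi>"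
    and G_base: "\<And>\<theta> x. G (\<theta> + 1) x = G \<theta> x"
    and G_fibre: "\<And>\<theta> x. G \<theta> (x + 1) = G \<theta> x"
    and G_variation: "set_nn_integral lborel {0..1} (\<lambda>\<theta>. total_variation (G \<theta>) 0 1) < \<infinity>"

locale bv_wandering_box = bv_minimal_lift + wandering_box
begin

definition len :: "int \<Rightarrow> real \<Rightarrow> real" where
  "len j s = \<phi> j s x2 - \<phi> j s x1"

abbreviation area :: "int \<Rightarrow> ennreal" where
  "area j \<equiv> \<integral>\<^sup>+s. ennreal (len j s) * indicator J s \<partial>lborel"

lemma len_pos [simp]: "len j s > 0"
  using x12 by (simp add: len_def)

lemma len_nonzero [simp]: "len j s \<noteq> 0"
  using len_pos[of j s] by linarith

lemma len_0 [simp]: "len 0 s = x2 - x1" by (simp add: len_def phi_0)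

lemma continuous_len [continuous_intros]: "continuous_on S (len j)"
  unfolding len_def by (intro continuous_intros)

lemma G_base_int: "G (s + of_int k) x = G s x"
  using add_int_of_add_1[of "\<lambda>s. G s x" 0] G_base by simp

lemma G_fibre_int: "G s (x + of_int l) = G s x"
  using add_int_of_add_1[of "G s" 0] G_fibre by simp

text \<open>The mean value point is written as the image of a point \<open>\<xi>\<close> of the box,
  so that the order of the images applies to it.\<close>

lemma len_ratio:
  obtains \<xi> where "\<xi> \<in> {x1..x2}" "ln (len (j + 1) s) - ln (len j s) = G (s + of_int j * \<omega>) (\<phi> j s \<xi>)"
proof -
  have "\<phi> j s x1 < \<phi> j s x2" using x12 by simp
  then obtain \<eta> where \<eta>: "\<eta> \<in> {\<phi> j s x1..\<phi> j s x2}"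
    "ln ((\<phi> 1 (s + of_int j * \<omega>) (\<phi> j s x2) - \<phi> 1 (s + of_int j * \<omega>) (\<phi> j s x1)) / len j s) = G (s + of_int j * \<omega>) \<eta>"
    using log_slope unfolding len_def by blast
  have "continuous_on {x1..x2} (\<phi> j s)"
    by (intro continuous_intros)
  then obtain \<xi> where \<xi>: "\<xi> \<in> {x1..x2}" "\<phi> j s \<xi> = \<eta>"
    using IVT'[of "\<phi> j s" x1 \<eta> x2] \<eta>(1) x12 by force
  have "\<phi> 1 (s + of_int j * \<omega>) (\<phi> j s x) = \<phi> (j + 1) s x" for x
    using phi_add[of 1 j s x] by (simp add: add.commute)
  then have "ln (len (j + 1) s / len j s) = G (s + of_int j * \<omega>) \<eta>"
    using \<eta>(2) by (simp add: len_def)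
  moreover have "ln (len (j + 1) s / len j s) = ln (len (j + 1) s) - ln (len j s)"
    by (simp add: ln_div)
  ultimately show thesis using that[OF \<xi>(1)] \<xi>(2) by simp
qed

text \<open>Pulled back by \<open>F\<^sup>-\<^sup>i\<close>, the comparison of two image points in a common fibre becomes a
  comparison of a point of the box with a point of its image under the return \<open>(i' - i, k - k', l)\<close>.\<close>

lemma phi_pull_back:
  assumes "s + of_int i * \<omega> = t + of_int k" "s' + of_int i' * \<omega> = t + of_int k'"
  shows "\<phi> i' s' \<xi> + of_int l = \<phi> i s (pt (i' - i) (k - k') l \<xi> s)"
proof -
  have s': "s - of_int (i' - i) * \<omega> - of_int (k - k') = s'"
    using assms by (simp add: algebra_simps)
  have "\<phi> i s (pt (i' - i) (k - k') l \<xi> s) = \<phi> i s (\<phi> (i' - i) s' \<xi>) + of_int l"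
    unfolding pt_def s' by simp
  also have "\<phi> i s (\<phi> (i' - i) s' \<xi>) = \<phi> i (s' + of_int (i' - i) * \<omega>) (\<phi> (i' - i) s' \<xi>)"
  proof -
    have "s = s' + of_int (i' - i) * \<omega> + of_int (k - k')" using s' by (simp add: algebra_simps)
    then show ?thesis by (metis phi_base_int)
  qed
  also have "\<dots> = \<phi> i' s' \<xi>" using phi_add[of i "i' - i" s' \<xi>] by simp
  finally show ?thesis by simp
qed

lemma near_pull_back:
  assumes "s + of_int i * \<omega> = t + of_int k" "s' + of_int i' * \<omega> = t + of_int k'" "s \<in> J" "s' \<in> J"
  shows "near (i' - i) (k - k')"
proof -
  have "of_int (i' - i) * \<omega> + of_int (k - k') = s - s'" using assms(1,2) by (simp add: algebra_simps)
  then show ?thesis unfolding near_def using assms(3,4) by auto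
qed

text \<open>In each fibre of the torus the arcs cut out by the images of the box are disjoint, so
  their lengths add up to at most 1; \<open>\<Phi>\<close> is the identity here.\<close>

lemma sum_len_le_1:
  assumes "finite I"
  shows "(\<Sum>i\<in>I. area i) \<le> 1"
proof -
  have "(\<Sum>i\<in>I. area i) \<le> set_nn_integral lborel {0..1::real} (\<lambda>_. 1)"
  proof (rule nn_integral_shift_orbit_le[OF assms, where \<omega> = \<omega>])
    fix i
    have [measurable]: "len i \<in> borel_measurable borel"
      by (intro borel_measurable_continuous_onI continuous_len)
    show "(\<lambda>s. ennreal (len i s) * indicator J s) \<in> borel_measurable borel" by measurable
  next
    fix K :: "int set" and t :: real assume K: "finite K"
    \<comment> \<open>The pair (i, k) stands for the i-th image over the lift t + k of the base
      point, and is kept if that lift comes from \<open>J\<close>.\<close>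
    define Q where "Q = {p \<in> I \<times> K. t + of_int (snd p) - of_int (fst p) * \<omega> \<in> J}"
    define b where "b p = t + of_int (snd p) - of_int (fst p) * \<omega>" for p :: "int \<times> int"
    have Q: "finite Q" unfolding Q_def using assms K by auto
    have "(\<Sum>p\<in>Q. \<phi> (fst p) (b p) x2 - \<phi> (fst p) (b p) x1) \<le> 1"
    proof (rule sum_disjoint_arc_increments_le[where \<Phi> = "\<lambda>x. x", OF _ _ Q])
      fix p assume "p \<in> Q" show "\<phi> (fst p) (b p) x1 \<le> \<phi> (fst p) (b p) x2" using x12 by simp
    next
      fix p p' :: "int \<times> int" and l :: int
      assume p: "p \<in> Q" "p' \<in> Q" "p \<noteq> p' \<or> l \<noteq> 0"
        and le: "\<phi> (fst p) (b p) x1 \<le> \<phi> (fst p') (b p') x1 + of_int l"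
      obtain i k i' k' where [simp]: "p = (i, k)" "p' = (i', k')" by (cases p, cases p')
      have s: "b p \<in> J" "b p' \<in> J" "b p + of_int i * \<omega> = t + of_int k" "b p' + of_int i' * \<omega> = t + of_int k'"
        using p unfolding Q_def b_def by auto
      note pb = phi_pull_back[OF s(3,4), of x1 l]
      have n: "near (i' - i) (k - k')" by (rule near_pull_back[OF s(3,4,1,2)])
      have ne: "(0, 0, 0) \<noteq> (i' - i, k - k', l)" using p by auto
      show "\<phi> (fst p) (b p) x2 \<le> \<phi> (fst p') (b p') x1 + of_int l"
      proof -
        have "x1 \<le> pt (i' - i) (k - k') l x1 (b p)" using le pb by simp
        then have "pt 0 0 0 x2 (b p) < pt (i' - i) (k - k') l x1 (b p)"
          using x12 by (intro pt_separated[OF near_0 n ne s(1), of x1 x1]) auto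
        then show ?thesis using pb by simp
      qed
    qed (auto simp: mono_def)
    then have "ennreal (\<Sum>p\<in>Q. len (fst p) (b p)) \<le> 1"
      unfolding len_def by (simp flip: ennreal_1 add: ennreal_le_iff del: ennreal_1)
    then have "(\<Sum>p\<in>Q. ennreal (len (fst p) (b p))) \<le> 1"
      by (simp add: sum_ennreal less_imp_le)
    also have "(\<Sum>p\<in>Q. ennreal (len (fst p) (b p))) = (\<Sum>p\<in>I \<times> K. ennreal (len (fst p) (b p)) * indicator J (b p))"
      using assms K unfolding Q_def b_def by (intro sum.mono_neutral_cong_left) auto
    finally show "(\<Sum>(i, k)\<in>I \<times> K. ennreal (len i (t + of_int k - of_int i * \<omega>)) * indicator J (t + of_int k - of_int i * \<omega>)) \<le> 1"
      by (simp add: b_def case_prod_unfold)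
  qed (auto simp: indicator_def)
  then show ?thesis by simp
qed

section \<open>Distortion up to a closest return\<close>

definition total_V :: ennreal where
  "total_V = set_nn_integral lborel {0..1} (\<lambda>s. total_variation (G s) 0 1)"

definition log_gain :: "int \<Rightarrow> real \<Rightarrow> real" where
  "log_gain j s = ln (len (j + 1) s) - ln (len j s)"

lemma continuous_log_gain [continuous_intros]: "continuous_on S (log_gain j)"
  unfolding log_gain_def by (intro continuous_intros) (auto simp: less_imp_neq[OF len_pos, symmetric])

text \<open>Over one base point, join a mean value point of the i-th image of the box to one of the
  i-th image of its return. These arcs are disjoint on the circle: the start of another arc inside
  one of them would pull back to a return of time less than |m| below the closest one. So the
  differences of the log slopes add up to at most the variation in that fibre.\<close>

lemma distortion:
  assumes n: "near m k" and above: "x1 < pt m k l x1 t0"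
    and closest: "\<And>m' k' l'. near m' k' \<Longrightarrow> \<bar>m'\<bar> < \<bar>m\<bar> \<Longrightarrow> x1 < pt m' k' l' x1 t0 \<Longrightarrow> \<not> pt m' k' l' x1 t0 < pt m k l x1 t0"
    and I: "finite I" "\<And>i i'. i \<in> I \<Longrightarrow> i' \<in> I \<Longrightarrow> \<bar>i' - i\<bar> < \<bar>m\<bar>"
  shows "(\<Sum>i\<in>I. \<integral>\<^sup>+s. ennreal \<bar>log_gain (i + m) (pre m k s) - log_gain i s\<bar> * indicator J s \<partial>lborel) \<le> total_V"
  unfolding total_V_def
proof (rule nn_integral_shift_orbit_le[OF I(1), where \<omega> = \<omega>])
  fix i
  have [measurable]: "log_gain i \<in> borel_measurable borel" for i
    by (intro borel_measurable_continuous_onI continuous_log_gain)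
  show "(\<lambda>s. ennreal \<bar>log_gain (i + m) (pre m k s) - log_gain i s\<bar> * indicator J s) \<in> borel_measurable borel"
    by measurable
next
  fix K :: "int set" and t :: real assume K: "finite K"
  define Q where "Q = {p \<in> I \<times> K. t + of_int (snd p) - of_int (fst p) * \<omega> \<in> J}"
  define b where "b p = t + of_int (snd p) - of_int (fst p) * \<omega>" for p :: "int \<times> int"
  have Q: "finite Q" unfolding Q_def using I(1) K by auto
  have m0: "(0, 0, 0) \<noteq> (m, k, l)" using above by auto
  \<comment> \<open>\<open>u\<close> and \<open>w\<close> locate the mean value points of the box
    and of its return; the second is written through \<open>pt\<close> so that both lie in the same
    fibre.\<close>
  have "\<exists>u w. u \<in> {x1..x2} \<and> w \<in> {x1..x2} \<and> log_gain (fst p) (b p) = G t (\<phi> (fst p) (b p) u)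
      \<and> log_gain (fst p + m) (pre m k (b p)) = G t (\<phi> (fst p) (b p) (pt m k l w (b p)))" for p
  proof -
    obtain i k1 where [simp]: "p = (i, k1)" by (cases p)
    have th: "b p + of_int i * \<omega> = t + of_int k1" unfolding b_def by auto
    obtain u where u: "u \<in> {x1..x2}" "log_gain i (b p) = G (b p + of_int i * \<omega>) (\<phi> i (b p) u)"
      using len_ratio[of i "b p"] unfolding log_gain_def by blast
    let ?s' = "pre m k (b p)"
    obtain w where w: "w \<in> {x1..x2}" "log_gain (i + m) ?s' = G (?s' + of_int (i + m) * \<omega>) (\<phi> (i + m) ?s' w)"
      using len_ratio[of "i + m" ?s'] unfolding log_gain_def by blast
    have e1: "?s' + of_int (i + m) * \<omega> = t + of_int (k1 - k)" using th by (simp add: algebra_simps)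
    have "\<phi> (i + m) ?s' w + of_int l = \<phi> i (b p) (pt (i + m - i) (k1 - (k1 - k)) l w (b p))"
      by (rule phi_pull_back[OF th e1])
    then have "G t (\<phi> i (b p) (pt m k l w (b p))) = G t (\<phi> (i + m) ?s' w)"
      using G_fibre_int[of t "\<phi> (i + m) ?s' w" l] by simp
    then have "log_gain (i + m) ?s' = G t (\<phi> i (b p) (pt m k l w (b p)))"
      using w(2) unfolding e1 G_base_int by simp
    then show ?thesis using u w(1) unfolding th G_base_int by auto
  qed
  then obtain u w where uw: "\<And>p. u p \<in> {x1..x2}" "\<And>p. w p \<in> {x1..x2}"
    "\<And>p. log_gain (fst p) (b p) = G t (\<phi> (fst p) (b p) (u p))"
    "\<And>p. log_gain (fst p + m) (pre m k (b p)) = G t (\<phi> (fst p) (b p) (pt m k l (w p) (b p)))"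
    by metis
  have above_J: "x1 < pt m k l x1 s" if "s \<in> J" for s
    using pt_order_const[OF near_0 n m0 t0_J that] above by simp
  have "(\<Sum>p\<in>Q. ennreal \<bar>G t (\<phi> (fst p) (b p) (pt m k l (w p) (b p))) - G t (\<phi> (fst p) (b p) (u p))\<bar>)
      \<le> total_variation (G t) 0 1"
  proof (rule sum_disjoint_arc_variation_le[where g = "G t", OF G_fibre Q])
    fix p assume "p \<in> Q"
    then have "b p \<in> J" by (simp add: Q_def b_def)
    then have "pt 0 0 0 (u p) (b p) < pt m k l (w p) (b p)"
      using above_J[of "b p"] x12 by (intro pt_separated[OF near_0 n m0, of _ x1 x1] uw) auto
    then show "\<phi> (fst p) (b p) (u p) \<le> \<phi> (fst p) (b p) (pt m k l (w p) (b p))" by simp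
  next
    fix p p' :: "int \<times> int" and l' :: int
    assume p: "p \<in> Q" "p' \<in> Q" "p \<noteq> p' \<or> l' \<noteq> 0"
      and le: "\<phi> (fst p) (b p) (u p) \<le> \<phi> (fst p') (b p') (u p') + of_int l'"
    obtain i k1 i' k1' where [simp]: "p = (i, k1)" "p' = (i', k1')" by (cases p, cases p')
    have s: "b p \<in> J" "b p' \<in> J" "b p + of_int i * \<omega> = t + of_int k1" "b p' + of_int i' * \<omega> = t + of_int k1'"
      using p unfolding Q_def b_def by auto
    have ii: "i \<in> I" "i' \<in> I" using p by (auto simp: Q_def)
    \<comment> \<open>Seen from the arc of \<open>p\<close>, the start of the arc of
      \<open>p'\<close> belongs to the return with these indices.\<close>
    define m' k' where "m' = i' - i" and "k' = k1 - k1'"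
    note pb = phi_pull_back[OF s(3,4), of "u p'" l', folded m'_def k'_def]
    have n': "near m' k'" unfolding m'_def k'_def by (rule near_pull_back[OF s(3,4,1,2)])
    have ne: "(0, 0, 0) \<noteq> (m', k', l')" using p by (auto simp: m'_def k'_def)
    have m': "\<bar>m'\<bar> < \<bar>m\<bar>" unfolding m'_def by (rule I(2)[OF ii])
    then have ne': "(m', k', l') \<noteq> (m, k, l)" by auto
    have "u p \<le> pt m' k' l' (u p') (b p)" using le pb by simp
    then have "pt 0 0 0 x1 (b p) < pt m' k' l' x1 (b p)"
      using x12 by (intro pt_separated[OF near_0 n' ne s(1), of "u p" "u p'"] uw) auto
    then have "pt 0 0 0 x1 t0 < pt m' k' l' x1 t0"
      by (rule pt_order_const[OF near_0 n' ne s(1) t0_J])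
    then have nl: "\<not> pt m' k' l' x1 t0 < pt m k l x1 t0" using closest[OF n' m'] by simp
    have "pt m k l (w p) (b p) \<le> pt m' k' l' (u p') (b p)"
    proof (rule ccontr)
      assume "\<not> ?thesis"
      then have "pt m' k' l' x1 (b p) < pt m k l x1 (b p)"
        using x12 by (intro pt_separated[OF n' n ne' s(1), of "u p'" "w p"] uw) auto
      then have "pt m' k' l' x1 t0 < pt m k l x1 t0"
        by (rule pt_order_const[OF n' n ne' s(1) t0_J])
      then show False using nl by simp
    qed
    then show "\<phi> (fst p) (b p) (pt m k l (w p) (b p)) \<le> \<phi> (fst p') (b p') (u p') + of_int l'"
      using pb by simp
  qed
  also have "(\<Sum>p\<in>Q. ennreal \<bar>G t (\<phi> (fst p) (b p) (pt m k l (w p) (b p))) - G t (\<phi> (fst p) (b p) (u p))\<bar>)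
      = (\<Sum>p\<in>I \<times> K. ennreal \<bar>log_gain (fst p + m) (pre m k (b p)) - log_gain (fst p) (b p)\<bar> * indicator J (b p))"
    using I(1) K unfolding Q_def uw(3,4) by (intro sum.mono_neutral_cong_left) (auto simp: b_def)
  finally show "(\<Sum>(i, k')\<in>I \<times> K. ennreal \<bar>log_gain (i + m) (pre m k (t + of_int k' - of_int i * \<omega>))
      - log_gain i (t + of_int k' - of_int i * \<omega>)\<bar> * indicator J (t + of_int k' - of_int i * \<omega>)) \<le> total_variation (G t) 0 1"
    by (simp add: b_def case_prod_unfold)
qed (auto simp: indicator_def)

lemma sum_log_gain:
  "(\<Sum>j\<in>{a..<a + int n}. log_gain (j + m) s) = ln (len (a + int n + m) s) - ln (len (a + m) s)"
proof (induction n)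
  case (Suc n)
  have "{a..<a + int (Suc n)} = insert (a + int n) {a..<a + int n}" by auto
  then have "(\<Sum>j\<in>{a..<a + int (Suc n)}. log_gain (j + m) s) = log_gain (a + int n + m) s + (\<Sum>j\<in>{a..<a + int n}. log_gain (j + m) s)"
    by simp
  also have "\<dots> = ln (len (a + int (Suc n) + m) s) - ln (len (a + m) s)"
    unfolding Suc.IH by (simp add: log_gain_def algebra_simps)
  finally show ?case .
qed simp

text \<open>The box is disjoint from its own unit vertical translate. Consequently all image lengths
  are at most 1 and their logarithms have a sign.\<close>

lemma box_height: "x2 < x1 + 1"
  using pt_separated[OF near_0 near_0 _ t0_J, of 0 1 x1 x1 x2 x1] x12 pt_shift[of 0 0 1 x1 t0] by simp

lemma len_le_1: "len j s \<le> 1"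
proof -
  have "\<phi> j s x2 \<le> \<phi> j s (x1 + 1)" using box_height by simp
  then show ?thesis by (simp add: len_def phi_deg)
qed

lemma ln_len_le_0: "ln (len j s) \<le> 0"
  using len_le_1[of j s] by simp

text \<open>The second summand is minus twice the log-length of the box, which enters a telescoping
  sum at both ends, times the length 2 \<rho> of \<open>J\<close>.\<close>

definition denjoy_bound :: ennreal where
  "denjoy_bound = total_V + ennreal (- 2 * ln (x2 - x1) * (2 * \<rho>))"

lemma denjoy_bound_finite: "denjoy_bound < \<infinity>"
  using G_variation unfolding denjoy_bound_def total_V_def by (simp add: less_top[symmetric])

abbreviation log_area :: "int \<Rightarrow> ennreal" where
  "log_area j \<equiv> \<integral>\<^sup>+s. ennreal (- ln (len j s)) * indicator J s \<partial>lborel"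

text \<open>Telescoping along a closest return of time m compares the log-lengths of the images of
  index m and -m with twice that of the box, with an error whose integral is at most
  \<open>total_V\<close>. The term of index m is nonpositive and is dropped, which leaves
  -m.\<close>

lemma ln_len_integral_bounded_below:
  obtains j where "\<bar>j\<bar> \<ge> N" "log_area j \<le> denjoy_bound"
proof -
  obtain m k l where mkl: "near m k" "x1 < pt m k l x1 t0" "\<bar>m\<bar> \<ge> max N 1"
    "\<And>m' k' l'. near m' k' \<Longrightarrow> \<bar>m'\<bar> < \<bar>m\<bar> \<Longrightarrow> x1 < pt m' k' l' x1 t0 \<Longrightarrow> \<not> pt m' k' l' x1 t0 < pt m k l x1 t0"
    using closest_return[of "max N 1"] by metis
  define n where "n = nat \<bar>m\<bar>"
  \<comment> \<open>The window makes \<open>i\<close> run between 0 and -m while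
    \<open>i + m\<close> runs between m and 0, so that only the indices 0, m and -m survive the
    telescoping.\<close>
  define a where "a = (if m < 0 then 0 else - m)"
  define I where "I = {a..<a + int n}"
  let ?d = "\<lambda>i s. log_gain (i + m) (pre m k s) - log_gain i s"
  have pw: "- ln (len (- m) s) \<le> (\<Sum>i\<in>I. \<bar>?d i s\<bar>) + - 2 * ln (x2 - x1)" for s
  proof -
    let ?s' = "pre m k s"
    have s1: "(\<Sum>i\<in>I. ?d i s) = (ln (len (a + int n + m) ?s') - ln (len (a + m) ?s')) - (ln (len (a + int n) s) - ln (len a s))"
      unfolding sum_subtractf I_def using sum_log_gain[of m ?s' a n] sum_log_gain[of 0 s a n] by simp
    have s2: "\<bar>\<Sum>i\<in>I. ?d i s\<bar> \<le> (\<Sum>i\<in>I. \<bar>?d i s\<bar>)" by (rule sum_abs)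
    have s3: "ln (len m ?s') \<le> 0" by (rule ln_len_le_0)
    show ?thesis
    proof (cases "m < 0")
      case True
      then have a: "a + int n + m = 0" "a + m = m" "a + int n = - m" "a = 0" by (auto simp: a_def n_def)
      show ?thesis using s1 s2 s3 abs_ge_self[of "\<Sum>i\<in>I. ?d i s"] unfolding a(1-3) left_minus add_0 unfolding a(4) len_0 by linarith
    next
      case False
      then have a: "a + int n + m = m" "a + m = 0" "a + int n = 0" "a = - m" by (auto simp: a_def n_def)
      show ?thesis using s1 s2 s3 abs_ge_minus_self[of "\<Sum>i\<in>I. ?d i s"] unfolding a(1-3) left_minus add_0 unfolding a(4) len_0 by linarith
    qed
  qed
  have [measurable]: "log_gain i \<in> borel_measurable borel" for i
    by (intro borel_measurable_continuous_onI continuous_log_gain)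
  have L: "0 \<le> - 2 * ln (x2 - x1)" using ln_len_le_0[of 0 t0] by simp
  have "log_area (- m)
      \<le> (\<integral>\<^sup>+s. (\<Sum>i\<in>I. ennreal \<bar>?d i s\<bar> * indicator J s) + ennreal (- 2 * ln (x2 - x1)) * indicator J s \<partial>lborel)"
  proof (rule nn_integral_mono)
    fix s
    have "ennreal (- ln (len (- m) s)) \<le> ennreal ((\<Sum>i\<in>I. \<bar>?d i s\<bar>) + - 2 * ln (x2 - x1))"
      by (rule ennreal_leI[OF pw])
    also have "\<dots> = (\<Sum>i\<in>I. ennreal \<bar>?d i s\<bar>) + ennreal (- 2 * ln (x2 - x1))"
      using L by (subst ennreal_plus) (auto simp: sum_ennreal intro: sum_nonneg)
    finally show "ennreal (- ln (len (- m) s)) * indicator J s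
      \<le> (\<Sum>i\<in>I. ennreal \<bar>?d i s\<bar> * indicator J s) + ennreal (- 2 * ln (x2 - x1)) * indicator J s"
      by (simp add: indicator_def split: if_splits)
  qed
  also have "\<dots> = (\<Sum>i\<in>I. \<integral>\<^sup>+s. ennreal \<bar>?d i s\<bar> * indicator J s \<partial>lborel) + (\<integral>\<^sup>+s. ennreal (- 2 * ln (x2 - x1)) * indicator J s \<partial>lborel)"
    by (subst nn_integral_add) (auto simp: nn_integral_sum)
  also have "(\<integral>\<^sup>+s. ennreal (- 2 * ln (x2 - x1)) * indicator J s \<partial>lborel) = ennreal (- 2 * ln (x2 - x1) * (2 * \<rho>))"
  proof -
    have "(\<integral>\<^sup>+s. ennreal (- 2 * ln (x2 - x1)) * indicator J s \<partial>lborel) = ennreal (- 2 * ln (x2 - x1)) * emeasure lborel J"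
      by (rule nn_integral_cmult_indicator) simp
    also have "emeasure lborel J = ennreal (2 * \<rho>)" using \<rho>_pos by simp
    also have "ennreal (- 2 * ln (x2 - x1)) * ennreal (2 * \<rho>) = ennreal (- 2 * ln (x2 - x1) * (2 * \<rho>))"
      using L \<rho>_pos by (intro ennreal_mult[symmetric]) auto
    finally show ?thesis .
  qed
  also have "(\<Sum>i\<in>I. \<integral>\<^sup>+s. ennreal \<bar>?d i s\<bar> * indicator J s \<partial>lborel) + ennreal (- 2 * ln (x2 - x1) * (2 * \<rho>)) \<le> denjoy_bound"
    unfolding denjoy_bound_def
  proof (rule add_right_mono, rule distortion[OF mkl(1,2,4)])
    fix i i' assume "i \<in> I" "i' \<in> I"
    then show "\<bar>i' - i\<bar> < \<bar>m\<bar>" by (auto simp: I_def n_def)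
  qed (auto simp: I_def)
  finally show thesis using that[of "- m"] mkl(3) by simp
qed

text \<open>The areas sum to at most 1, so at most 1 / c of them exceed \<open>c\<close>.\<close>

lemma len_integral_small:
  assumes c: "c > 0"
  obtains N where "\<And>j. \<bar>j\<bar> \<ge> N \<Longrightarrow> area j \<le> ennreal c"
proof -
  define B where "B = {j. area j > ennreal c}"
  have "finite B"
  proof (rule finite_if_finite_subsets_card_bdd[THEN conjunct1])
    fix F assume F: "F \<subseteq> B" "finite F"
    have "ennreal (of_nat (card F) * c) = (\<Sum>j\<in>F. ennreal c)" using c by (simp add: ennreal_mult' ennreal_of_nat_eq_real_of_nat)
    also have "\<dots> \<le> (\<Sum>j\<in>F. area j)"
      using F(1) by (intro sum_mono) (auto simp: B_def less_imp_le)
    also have "\<dots> \<le> 1" by (rule sum_len_le_1[OF F(2)])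
    finally have "of_nat (card F) * c \<le> 1" by (simp flip: ennreal_1 add: ennreal_le_iff)
    then have "real (card F) \<le> 1 / c" using c by (simp add: field_simps)
    then show "card F \<le> nat \<lfloor>1 / c\<rfloor>" by (simp add: le_nat_floor)
  qed
  then have fin: "finite (abs ` B)" by simp
  have "area j \<le> ennreal c" if "\<bar>j\<bar> \<ge> Max (insert 0 (abs ` B)) + 1" for j
  proof (rule ccontr)
    assume "\<not> ?thesis"
    then have "j \<in> B" by (auto simp: B_def)
    then have "\<bar>j\<bar> \<le> Max (insert 0 (abs ` B))" using fin by (intro Max_ge) auto
    then show False using that by simp
  qed
  then show thesis using that by blast
qed

text \<open>Applied to the length divided by \<open>c\<close>, the inequality ln t \<le> t - 1
  bounds -ln c by -ln len + len / c. Integrating this pointwise bound does the work of Jensen's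
  inequality.\<close>

theorem no_wandering_box: False
proof -
  define C where "C = enn2real denjoy_bound"
  have C: "denjoy_bound = ennreal C" "C \<ge> 0" using denjoy_bound_finite by (simp_all add: C_def less_top)
  \<comment> \<open>Chosen so that -ln c integrates over \<open>J\<close> to C + 2, whereas the
    estimate allows only C + 1: \<open>C\<close> from the logarithms and 1 from the areas.\<close>
  define c where "c = exp (- ((C + 2) / (2 * \<rho>)))"
  have c: "c > 0" "- ln c = (C + 2) / (2 * \<rho>)" by (simp_all add: c_def)
  obtain N where N: "\<And>j. \<bar>j\<bar> \<ge> N \<Longrightarrow> area j \<le> ennreal c"
    using len_integral_small[OF c(1)] by blast
  obtain j where j: "\<bar>j\<bar> \<ge> N" "log_area j \<le> denjoy_bound"
    using ln_len_integral_bounded_below by blast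
  have [measurable]: "len j \<in> borel_measurable borel"
    by (intro borel_measurable_continuous_onI continuous_len)
  have pw: "- ln c \<le> - ln (len j s) + len j s / c" for s
  proof -
    have "ln (len j s / c) \<le> len j s / c - 1" using c(1) by (intro ln_le_minus_one) auto
    moreover have "ln (len j s / c) = ln (len j s) - ln c" using c(1) by (simp add: ln_div)
    ultimately show ?thesis by simp
  qed
  have lnc: "- ln c \<ge> 0" using C(2) \<rho>_pos c(2) by simp
  have "ennreal (C + 2) = ennreal (- ln c) * ennreal (2 * \<rho>)"
    using lnc \<rho>_pos c(2) by (simp flip: ennreal_mult)
  also have "\<dots> = (\<integral>\<^sup>+s. ennreal (- ln c) * indicator J s \<partial>lborel)"
    using \<rho>_pos by (subst nn_integral_cmult_indicator) auto
  also have "\<dots> \<le> (\<integral>\<^sup>+s. ennreal (- ln (len j s)) * indicator J s + ennreal (1 / c) * (ennreal (len j s) * indicator J s) \<partial>lborel)"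
  proof (rule nn_integral_mono)
    fix s
    have "ennreal (- ln c) \<le> ennreal (- ln (len j s) + len j s / c)" by (rule ennreal_leI[OF pw])
    also have "\<dots> = ennreal (- ln (len j s)) + ennreal (1 / c) * ennreal (len j s)"
      using ln_len_le_0[of j s] c(1) less_imp_le[OF len_pos] by (subst ennreal_plus) (auto simp flip: ennreal_mult)
    finally show "ennreal (- ln c) * indicator J s \<le> ennreal (- ln (len j s)) * indicator J s + ennreal (1 / c) * (ennreal (len j s) * indicator J s)"
      by (simp add: indicator_def)
  qed
  also have "\<dots> = log_area j + ennreal (1 / c) * area j"
    by (subst nn_integral_add) (auto simp: nn_integral_cmult)
  also have "\<dots> \<le> ennreal C + ennreal (1 / c) * ennreal c"
    using j N C(1) by (intro add_mono mult_left_mono) auto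
  also have "\<dots> = ennreal (C + 1)"
  proof -
    have "ennreal (1 / c) * ennreal c = ennreal 1" using c(1) by (subst ennreal_mult[symmetric]) auto
    then show ?thesis using C(2) by (subst ennreal_plus) auto
  qed
  finally show False using C(2) by simp
qed

end

section \<open>Vertical loops in the complement of the minimal set\<close>

text \<open>The winding number on the cylinder \<open>\<complex>/\<int>v\<close>, which \<open>\<zeta> \<mapsto> exp (2\<pi>i\<zeta>/v)\<close> identifies with the
  punctured plane.\<close>

lemma cylinder_index:
  fixes g :: "real \<Rightarrow> complex" and v :: complex
  assumes g: "path g" and v: "v \<noteq> 0" and loop: "pathfinish g = pathstart g + v"
    and \<Gamma>_def: "\<Gamma> = {z. \<exists>n::int. z + of_int n * v \<in> path_image g}"
  shows "\<exists>(a :: complex \<Rightarrow> complex) R. closed \<Gamma> \<and> continuous_on (- \<Gamma>) a \<and> (\<forall>z. z \<notin> \<Gamma> \<longrightarrow> a z \<in> \<int>) \<and>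
    (\<forall>z. a (z + v) = a z) \<and> (\<forall>z. Im (z / v) > R \<longrightarrow> z \<notin> \<Gamma> \<and> a z = 1) \<and>
    (\<forall>z. Im (z / v) < - R \<longrightarrow> z \<notin> \<Gamma> \<and> a z = 0)"
proof -
  define c where "c = 2 * of_real pi * \<i> / v"
  have c: "c \<noteq> 0" using v by (simp add: c_def)
  define q where "q = exp \<circ> (\<lambda>t. c * g t)"
  have pc: "path (\<lambda>t. c * g t)" using g unfolding path_def by (intro continuous_intros)
  have pq: "path q" unfolding q_def path_def comp_def
    using pc unfolding path_def by (rule continuous_on_exp)
  have cv: "c * v = 2 * of_real pi * \<i>" using v by (simp add: c_def)
  have per: "exp (c * (z + of_int n * v)) = exp (c * z)" for z and n :: int
  proof -
    have "c * (z + of_int n * v) = c * z + of_int n * (c * v)" by (simp add: algebra_simps)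
    then have eq: "c * (z + of_int n * v) = c * z + of_int (2 * n) * of_real pi * \<i>" by (simp add: cv)
    show ?thesis unfolding exp_eq using eq by auto
  qed
  have loopq: "pathfinish q = pathstart q"
    using per[of "g 0" 1] loop by (simp add: q_def pathfinish_def pathstart_def)
  have mem: "exp (c * z) \<in> path_image q \<longleftrightarrow> z \<in> \<Gamma>" for z
  proof
    assume "exp (c * z) \<in> path_image q"
    then obtain t where t: "t \<in> {0..1}" "exp (c * z) = exp (c * g t)"
      by (auto simp: q_def path_image_def)
    then obtain n :: int where "c * z = c * g t + of_real (of_int (2 * n) * pi) * \<i>"
      unfolding exp_eq by blast
    then have "c * z = c * g t + of_int n * (c * v)" by (simp add: cv)
    then have "c * z = c * (g t + of_int n * v)" by (simp add: algebra_simps)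
    then have "z + of_int (- n) * v = g t" using c by simp
    then show "z \<in> \<Gamma>" unfolding \<Gamma>_def path_image_def using t(1) by blast
  next
    assume "z \<in> \<Gamma>"
    then obtain n :: int and t where t: "t \<in> {0..1}" "z + of_int n * v = g t"
      by (auto simp: \<Gamma>_def path_image_def)
    have "exp (c * z) = q t" using per[of z n] t(2) by (simp add: q_def)
    then show "exp (c * z) \<in> path_image q" using t(1) by (auto simp: path_image_def)
  qed
  define a where "a z = winding_number q (exp (c * z))" for z
  have 1: "closed \<Gamma>"
  proof -
    have "\<Gamma> = (\<lambda>z. exp (c * z)) -` path_image q" using mem by auto
    moreover have "closed ((\<lambda>z. exp (c * z)) -` path_image q)"
      using pq by (intro continuous_closed_vimage closed_path_image) (auto intro!: continuous_intros)
    ultimately show ?thesis by simp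
  qed
  have 2: "continuous_on (- \<Gamma>) a"
    unfolding a_def
    by (rule continuous_on_compose2[OF continuous_on_winding_number[OF pq]])
      (auto intro!: continuous_intros simp: mem)
  have 3: "a z \<in> \<int>" if "z \<notin> \<Gamma>" for z
    unfolding a_def using that mem by (intro integer_winding_number[OF pq loopq]) auto
  have 4: "a (z + v) = a z" for z
    using per[of z 1] by (simp add: a_def)
  obtain B where B: "\<And>z. B \<le> norm z \<Longrightarrow> winding_number q z = 0"
    using winding_number_zero_at_infinity[OF pq loopq] by blast
  have "bounded (path_image q)" using pq by (rule bounded_path_image)
  then obtain B' where B': "\<And>z. z \<in> path_image q \<Longrightarrow> norm z \<le> B'" by (auto simp: bounded_iff)
  have q0: "0 \<notin> path_image q" by (auto simp: q_def path_image_def)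
  \<comment> \<open>Along \<open>g\<close> the exponent grows by c v, which is 2 pi i, so the image
    loop winds once around 0. The upper end of the cylinder is mapped near 0 and the lower end near
    infinity, whence the values 1 and 0.\<close>
  have "winding_number q 0 = (pathfinish (\<lambda>t. c * g t) - pathstart (\<lambda>t. c * g t)) / (2 * of_real pi * \<i>)"
    unfolding q_def by (rule winding_number_compose_exp[OF pc])
  also have "\<dots> = 1"
    using loop cv by (simp add: pathfinish_def pathstart_def algebra_simps)
  finally have w0: "winding_number q 0 = 1" .
  have "open (- path_image q)" using closed_path_image[OF pq] by (simp add: open_Compl)
  then obtain e where e: "e > 0" "ball 0 e \<subseteq> - path_image q"
    using q0 openE[of "- path_image q" 0] by auto
  have w1: "winding_number q z = 1" if "norm z < e" for z
  proof -
    have "winding_number q constant_on ball 0 e"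
      by (rule winding_number_constant[OF pq loopq]) (use e in auto)
    then show ?thesis using w0 e that unfolding constant_on_def by (metis centre_in_ball mem_ball_0)
  qed
  have nrm: "norm (exp (c * z)) = exp (- 2 * pi * Im (z / v))" for z
  proof -
    define w where "w = z / v"
    have "c * z = 2 * of_real pi * \<i> * w" by (simp add: c_def w_def)
    then show ?thesis unfolding w_def[symmetric] by (simp add: norm_exp_eq_Re)
  qed
  define D where "D = max 1 (max B (B' + 1))"
  define R where "R = max (- ln e) (ln D) / (2 * pi)"
  have D: "D \<ge> 1" "D \<ge> B" "D > B'" by (auto simp: D_def)
  have R: "R * (2 * pi) \<ge> - ln e" "R * (2 * pi) \<ge> ln D" by (simp_all add: R_def)
  have 5: "z \<notin> \<Gamma> \<and> a z = 1" if "Im (z / v) > R" for z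
  proof -
    have "R * (2 * pi) < Im (z / v) * (2 * pi)" using that by simp
    then have "- (Im (z / v) * (2 * pi)) < ln e" using R by linarith
    then have "- 2 * pi * Im (z / v) < ln e" by (simp add: mult_ac)
    then have n: "norm (exp (c * z)) < e" unfolding nrm using e(1) by (metis exp_less_cancel_iff exp_ln)
    then have "exp (c * z) \<in> ball 0 e" by (simp only: mem_ball_0)
    then have "exp (c * z) \<in> - path_image q" using e(2) by blast
    then show ?thesis using w1[OF n] mem by (auto simp: a_def)
  qed
  have 6: "z \<notin> \<Gamma> \<and> a z = 0" if "Im (z / v) < - R" for z
  proof -
    have "R * (2 * pi) < - Im (z / v) * (2 * pi)" using that by (intro mult_strict_right_mono) auto
    then have "ln D < - (Im (z / v) * (2 * pi))" using R(2) by linarith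
    then have "ln D < - 2 * pi * Im (z / v)" by (simp add: mult_ac)
    then have n: "norm (exp (c * z)) > D" unfolding nrm using D(1)
      by (metis exp_less_cancel_iff exp_ln less_le_trans zero_less_one)
    then have "exp (c * z) \<notin> path_image q" using B' D by force
    then show ?thesis using B n D mem by (auto simp: a_def)
  qed
  show ?thesis using 1 2 3 4 5 6 by blast
qed

section \<open>Clopen pieces of the minimal set cut off by a vertical loop\<close>

context minimal_lift
begin

text \<open>The sign \<sigma> selects the side: 1 for a piece bounded on the right, -1 for one
  bounded on the left.\<close>

definition clopen_cut :: "real \<Rightarrow> (real \<times> real) set \<Rightarrow> bool" where
  "clopen_cut \<sigma> D \<longleftrightarrow> D \<subseteq> M \<and> closed D \<and> closed (M - D) \<and>
     (\<forall>w\<in>D. \<forall>l. act 0 0 l w \<in> D) \<and> (\<exists>c. \<forall>w\<in>D. \<sigma> * fst w \<le> c)"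

text \<open>Winds a loop of class \<open>(q, r)\<close> inside the component around the cylinder.\<close>

lemma component_index:
  fixes q r :: int
  assumes W: "W \<in> components (- M)" and stab: "act 0 q r ` W = W" and qr: "q \<noteq> 0 \<or> r \<noteq> 0"
  obtains a :: "real \<times> real \<Rightarrow> complex" and R where "continuous_on (- W) a" "\<And>z. z \<notin> W \<Longrightarrow> a z \<in> \<int>"
    "\<And>\<theta> x. a (\<theta> + of_int q, x + of_int r) = a (\<theta>, x)"
    "\<And>\<theta> x. x * of_int q - of_int r * \<theta> > R \<Longrightarrow> a (\<theta>, x) = 1"
    "\<And>\<theta> x. x * of_int q - of_int r * \<theta> < - R \<Longrightarrow> a (\<theta>, x) = 0"
proof -
  have stab_n: "(\<theta> + of_int n * of_int q, x + of_int n * of_int r) \<in> W \<longleftrightarrow> (\<theta>, x) \<in> W" for \<theta> x n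
    using stabiliser_mem_iff[OF stabiliser_mult[OF stab, of n], of "(\<theta>, x)"] by (simp add: act_translate)
  have "open W" using open_components[OF _ W] closed_M by (simp add: open_Compl)
  then have "path_connected W"
    using in_components_connected[OF W] by (simp add: connected_open_path_connected)
  moreover obtain \<theta>0 x0 where w0: "(\<theta>0, x0) \<in> W" using in_components_nonempty[OF W] by auto
  moreover have "(\<theta>0 + of_int q, x0 + of_int r) \<in> W" using w0 stab_n[of \<theta>0 1 x0] by simp
  ultimately obtain g where g: "path g" "path_image g \<subseteq> W" "pathstart g = (\<theta>0, x0)" "pathfinish g = (\<theta>0 + of_int q, x0 + of_int r)"
    unfolding path_connected_def by blast
  define h where "h t = Complex (fst (g t)) (snd (g t))" for t
  define v where "v = Complex (of_int q) (of_int r)"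
  have v: "v \<noteq> 0" using qr by (simp add: v_def complex_eq_iff)
  have ph: "path h" unfolding h_def path_def Complex_eq
    using g(1) unfolding path_def by (intro continuous_intros)
  have lh: "pathfinish h = pathstart h + v"
    using g(3,4) by (simp add: h_def v_def pathfinish_def pathstart_def complex_eq_iff)
  define \<Gamma> where "\<Gamma> = {z. \<exists>n::int. z + of_int n * v \<in> path_image h}"
  obtain a :: "complex \<Rightarrow> complex" and R where "closed \<Gamma> \<and> continuous_on (- \<Gamma>) a \<and> (\<forall>z. z \<notin> \<Gamma> \<longrightarrow> a z \<in> \<int>) \<and>
    (\<forall>z. a (z + v) = a z) \<and> (\<forall>z. Im (z / v) > R \<longrightarrow> z \<notin> \<Gamma> \<and> a z = 1) \<and>
    (\<forall>z. Im (z / v) < - R \<longrightarrow> z \<notin> \<Gamma> \<and> a z = 0)"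
    using cylinder_index[OF ph v lh \<Gamma>_def] by (elim exE)
  then have a: "continuous_on (- \<Gamma>) a" "\<And>z. z \<notin> \<Gamma> \<Longrightarrow> a z \<in> \<int>" "\<And>z. a (z + v) = a z"
    "\<And>z. Im (z / v) > R \<Longrightarrow> a z = 1" "\<And>z. Im (z / v) < - R \<Longrightarrow> a z = 0"
    by (elim conjE, blast)+
  have \<Gamma>W: "z \<in> W" if z\<Gamma>: "Complex (fst z) (snd z) \<in> \<Gamma>" for z
  proof -
    obtain n :: int and t where t: "t \<in> {0..1}" "Complex (fst z) (snd z) + of_int n * v = h t"
      using z\<Gamma> by (auto simp: path_image_def \<Gamma>_def)
    then have "g t = (fst z + of_int n * of_int q, snd z + of_int n * of_int r)"
      by (auto simp: h_def v_def complex_eq_iff prod_eq_iff)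
    moreover have "g t \<in> W" using g(2) t(1) by (force simp: path_image_def)
    ultimately show ?thesis using stab_n[of "fst z" n "snd z"] by simp
  qed
  \<comment> \<open>The squared modulus of \<open>v\<close>, the factor between Im (z / v) and the
    height measured relative to the direction (q, r).\<close>
  define V where "V = (of_int q)\<^sup>2 + (of_int r :: real)\<^sup>2"
  have V: "V > 0" using qr by (auto simp: V_def add_pos_nonneg add_nonneg_pos)
  have imv: "Im (Complex \<theta> x / v) = (x * of_int q - of_int r * \<theta>) / V" for \<theta> x
    by (simp add: v_def Im_divide V_def mult.commute)
  show thesis
  proof (rule that[of "\<lambda>z. a (Complex (fst z) (snd z))" "R * V"])
    show "continuous_on (- W) (\<lambda>z. a (Complex (fst z) (snd z)))"
      unfolding Complex_eq
      by (intro continuous_on_compose2[OF a(1)] continuous_intros) (use \<Gamma>W in \<open>auto simp: Complex_eq\<close>)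
    show "a (Complex (fst z) (snd z)) \<in> \<int>" if "z \<notin> W" for z
      using a(2) \<Gamma>W that by blast
    show "a (Complex (fst (\<theta> + of_int q, x + of_int r)) (snd (\<theta> + of_int q, x + of_int r))) = a (Complex (fst (\<theta>, x)) (snd (\<theta>, x)))" for \<theta> x
      using a(3)[of "Complex \<theta> x"] by (simp add: v_def complex_add)
    show "a (Complex (fst (\<theta>, x)) (snd (\<theta>, x))) = 1" if "x * of_int q - of_int r * \<theta> > R * V" for \<theta> x
      using a(4)[of "Complex \<theta> x"] that V by (simp add: imv pos_less_divide_eq)
    show "a (Complex (fst (\<theta>, x)) (snd (\<theta>, x))) = 0" if "x * of_int q - of_int r * \<theta> < - (R * V)" for \<theta> x
      using a(5)[of "Complex \<theta> x"] that V by (simp add: imv pos_divide_less_eq)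
  qed
qed

text \<open>For a vertical loop the two ends of the cylinder are left and right: the index is 1 far
  to the left and 0 far to the right. Being continuous with integer values off \<open>W\<close>, it
  has a clopen nonzero part on \<open>M\<close>. It is periodic only under \<open>L\<close>, and a
  union over the residues modulo \<open>L\<close> restores all vertical translations.\<close>

lemma vertical_stabiliser_cut:
  assumes W: "W \<in> components (- M)" and l: "l \<noteq> 0" "act 0 0 l ` W = W"
  obtains A c where "A \<subseteq> M" "closed A" "closed (M - A)" "\<And>w l. w \<in> A \<Longrightarrow> act 0 0 l w \<in> A"
    "\<And>w. w \<in> A \<Longrightarrow> fst w \<le> c" "\<And>w. w \<in> M \<Longrightarrow> fst w < - c \<Longrightarrow> w \<in> A"
proof -
  define L where "L = \<bar>l\<bar>"
  have L: "L > 0" using l by (simp add: L_def)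
  have "act 0 0 L ` W = W" using l(2) stabiliser_minus[OF l(2)] by (simp add: L_def abs_if)
  then obtain a R where a: "continuous_on (- W) a" "\<And>z. z \<notin> W \<Longrightarrow> a z \<in> (\<int> :: complex set)"
    "\<And>\<theta> x. a (\<theta> + of_int 0, x + of_int L) = a (\<theta>, x)"
    "\<And>\<theta> x. x * of_int 0 - of_int L * \<theta> > R \<Longrightarrow> a (\<theta>, x) = 1"
    "\<And>\<theta> x. x * of_int 0 - of_int L * \<theta> < - R \<Longrightarrow> a (\<theta>, x) = 0"
    using component_index[OF W, of 0 L] L by (metis less_irrefl)
  have subW: "M \<subseteq> - W" using in_components_subset[OF W] by blast
  define b where "b z = norm (a z)" for z
  have b: "continuous_on M b"
    unfolding b_def by (intro continuous_on_norm continuous_on_subset[OF a(1) subW])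
  have b01: "b z \<ge> 1 \<or> b z \<le> 0" if "z \<in> M" for z
  proof -
    have "a z \<in> \<int>" using a(2) subW that by blast
    then show ?thesis unfolding b_def by (auto elim!: Ints_cases)
  qed
  have bper: "b (\<theta>, x + of_int n * of_int L) = b (\<theta>, x)" for \<theta> x and n :: int
    using add_int_of_add_1[of "\<lambda>s. b (\<theta>, x + s * of_int L)" 0 0 n] a(3)[of \<theta>]
    by (simp add: b_def distrib_right flip: add.assoc)
  define A0 where "A0 = {z \<in> M. b z \<ge> 1}"
  have A0: "closed A0" "closed (M - A0)"
  proof -
    show "closed A0" unfolding A0_def
      using continuous_on_closed_Collect_le[OF continuous_on_const b closed_M] by simp
    have "M - A0 = {z \<in> M. b z \<le> 0}" using b01 unfolding A0_def by force
    then show "closed (M - A0)"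
      using continuous_on_closed_Collect_le[OF b continuous_on_const closed_M] by simp
  qed
  have A0per: "(\<theta>, x + of_int n * of_int L) \<in> A0 \<longleftrightarrow> (\<theta>, x) \<in> A0" for \<theta> x n
    using bper[of \<theta> x n] M_shift_iff[of \<theta> x "n * L"] by (simp add: A0_def)
  define A where "A = {z \<in> M. \<exists>j. act 0 0 j z \<in> A0}"
  have red: "\<exists>j'\<in>{0..<L}. act 0 0 j' z \<in> A0" if "act 0 0 j z \<in> A0" for j z
  proof -
    have e: "of_int j = of_int (j mod L) + of_int (j div L) * (of_int L :: real)"
      by (metis (no_types) add.commute div_mult_mod_eq of_int_add of_int_mult)
    have "(fst z, (snd z + of_int (j mod L)) + of_int (j div L) * of_int L) \<in> A0"
      using that unfolding act_translate by (simp add: e add.assoc)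
    then have "act 0 0 (j mod L) z \<in> A0" unfolding A0per by (simp add: act_translate)
    then show ?thesis using L by (metis atLeastLessThan_iff pos_mod_bound pos_mod_sign)
  qed
  have Aeq: "A = (\<Union>j\<in>{0..<L}. act 0 0 (- j) ` A0)"
  proof (intro set_eqI iffI)
    fix z assume "z \<in> A"
    then obtain j' where "j' \<in> {0..<L}" "act 0 0 j' z \<in> A0" unfolding A_def using red by blast
    then show "z \<in> (\<Union>j\<in>{0..<L}. act 0 0 (- j) ` A0)" unfolding image_act by auto
  qed (auto simp: A_def A0_def image_act)
  have MAeq: "M - A = M \<inter> (\<Inter>j\<in>{0..<L}. act 0 0 (- j) ` (M - A0))"
  proof (intro set_eqI iffI)
    fix z assume "z \<in> M \<inter> (\<Inter>j\<in>{0..<L}. act 0 0 (- j) ` (M - A0))"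
    then have z: "z \<in> M" "\<And>j. j \<in> {0..<L} \<Longrightarrow> act 0 0 j z \<notin> A0" unfolding image_act by auto
    then have "z \<notin> A" unfolding A_def using red by blast
    then show "z \<in> M - A" using z by simp
  qed (auto simp: A_def image_act)
  define c where "c = \<bar>R\<bar> / of_int L"
  have "fst w \<le> c" if "w \<in> A" for w
  proof (rule ccontr)
    assume n: "\<not> fst w \<le> c"
    obtain j where j: "act 0 0 j w \<in> A0" using \<open>w \<in> A\<close> unfolding A_def by blast
    have "\<bar>R\<bar> < of_int L * fst w" using n L by (simp add: c_def field_simps)
    then have "b (act 0 0 j w) = 0"
      using a(5)[of "snd w + of_int j" "fst w"] by (simp add: b_def act_translate)
    then show False using j by (simp add: A0_def)
  qed
  moreover have "w \<in> A" if "w \<in> M" "fst w < - c" for w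
  proof -
    have "\<bar>R\<bar> < - (of_int L * fst w)" using that L by (simp add: c_def field_simps)
    then have "b w = 1"
      using a(4)[of "snd w" "fst w"] by (simp add: b_def)
    then have "act 0 0 0 w \<in> A0" using that by (simp add: A0_def)
    then show ?thesis using that unfolding A_def by blast
  qed
  moreover have "closed A" unfolding Aeq
    by (intro closed_UN ballI closed_act A0) auto
  moreover have "closed (M - A)" unfolding MAeq
    by (intro closed_Int closed_M closed_INT ballI closed_act A0)
  moreover have "act 0 0 n w \<in> A" if wA: "w \<in> A" for n w
  proof -
    obtain j where "act 0 0 j w \<in> A0" using wA unfolding A_def by blast
    then have "act 0 0 (j - n) (act 0 0 n w) \<in> A0" by simp
    moreover have "act 0 0 n w \<in> M" using wA M_act unfolding A_def by simp
    ultimately show ?thesis unfolding A_def by blast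
  qed
  moreover have "A \<subseteq> M" by (auto simp: A_def)
  ultimately show thesis using that by blast
qed

lemma clopen_cut_act:
  assumes "clopen_cut \<sigma> D"
  shows "clopen_cut \<sigma> (act i k l ` D)"
proof -
  have D: "D \<subseteq> M" "closed D" "closed (M - D)" "\<And>w l. w \<in> D \<Longrightarrow> act 0 0 l w \<in> D"
    using assms unfolding clopen_cut_def by auto
  obtain c where c: "\<forall>w\<in>D. \<sigma> * fst w \<le> c" using assms unfolding clopen_cut_def by (elim conjE exE) (rule that)
  have "M - act i k l ` D = act i k l ` (M - D)"
  proof -
    have "act (- i) (- k) (- l) -` M = M" by (simp add: vimage_def del: split_paired_All)
    then show ?thesis unfolding image_act vimage_Diff by simp
  qed
  then have "closed (M - act i k l ` D)" using closed_act D by metis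
  moreover have "act 0 0 n w \<in> act i k l ` D" if "w \<in> act i k l ` D" for n w
  proof -
    obtain u where u: "u \<in> D" "w = act i k l u" using \<open>w \<in> act i k l ` D\<close> by auto
    have "act 0 0 n w = act i k l (act 0 0 n u)" using u by (simp add: add.commute)
    then show ?thesis using D(4)[OF u(1)] by blast
  qed
  moreover have "\<sigma> * fst w \<le> c + \<sigma> * (of_int i * \<omega> + of_int k)" if "w \<in> act i k l ` D" for w
    using that c by (auto simp: algebra_simps)
  moreover have "act i k l ` D \<subseteq> M" using D(1) by (metis M_act image_subset_iff subset_iff)
  ultimately show ?thesis
    unfolding clopen_cut_def using D closed_act
    by (intro conjI ballI allI exI[of _ "c + \<sigma> * (of_int i * \<omega> + of_int k)"]) (simp_all del: split_paired_All)
qed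

text \<open>Call a point bad if every cut containing it reaches beyond it by more than each \<delta>
  < e. The bad points form a closed invariant set, and the extreme point of \<open>A\<close> is not
  bad; by minimality there are none.\<close>

lemma small_clopen_cut:
  assumes A: "clopen_cut \<sigma> A" "A \<noteq> {}" and \<sigma>: "\<sigma> = 1 \<or> \<sigma> = - 1" and z: "z \<in> M" and e: "e > 0"
  obtains D where "clopen_cut \<sigma> D" "z \<in> D" "\<And>w. w \<in> D \<Longrightarrow> \<sigma> * fst w < \<sigma> * fst z + e"
proof -
  define Z where "Z = {z \<in> M. \<forall>D \<delta>. clopen_cut \<sigma> D \<and> z \<in> D \<and> \<delta> < e \<longrightarrow> (\<exists>w\<in>D. \<sigma> * fst w > \<sigma> * fst z + \<delta>)}"
  have ZD: "\<exists>w\<in>D. \<sigma> * fst w > \<sigma> * fst z + \<delta>" if "z \<in> Z" "clopen_cut \<sigma> D" "z \<in> D" "\<delta> < e" for z D \<delta>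
    using that unfolding Z_def by simp
  have notZ: "\<exists>D \<delta>. clopen_cut \<sigma> D \<and> z \<in> D \<and> \<delta> < e \<and> (\<forall>w\<in>D. \<sigma> * fst w \<le> \<sigma> * fst z + \<delta>)"
    if "z \<in> M" "z \<notin> Z" for z
    using that unfolding Z_def by (simp add: not_less)
  have "closed Z"
  proof (rule closed_subset_M)
    fix z assume z: "z \<in> M" "z \<notin> Z"
    then obtain D \<delta> where D: "clopen_cut \<sigma> D" "z \<in> D" "\<delta> < e" "\<And>w. w \<in> D \<Longrightarrow> \<sigma> * fst w \<le> \<sigma> * fst z + \<delta>"
      using notZ[of z] by auto
    \<comment> \<open>Half of the slack e - \<delta>: moving the reference point back by less than
      this keeps the overhang of \<open>D\<close> below \<open>e\<close>.\<close>
    define T where "T = - (M - D) \<inter> {z'. \<sigma> * fst z' > \<sigma> * fst z - (e - \<delta>) / 2}"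
    have "open {z'::real \<times> real. \<sigma> * fst z' > \<sigma> * fst z - (e - \<delta>) / 2}"
      by (intro open_Collect_less continuous_intros)
    moreover have "open (- (M - D))" using D(1) unfolding clopen_cut_def by (intro open_Compl) (elim conjE)
    ultimately have "open T" unfolding T_def by (rule open_Int[rotated])
    moreover have "z \<in> T" using D by (auto simp: T_def)
    moreover have "z' \<notin> Z" if "z' \<in> T" for z'
    proof
      assume "z' \<in> Z"
      then have "z' \<in> D" using that by (auto simp: T_def Z_def)
      moreover have "(e + \<delta>) / 2 < e" using D by simp
      ultimately obtain w where w: "w \<in> D" "\<sigma> * fst w > \<sigma> * fst z' + (e + \<delta>) / 2"
        using ZD[OF \<open>z' \<in> Z\<close> D(1)] by metis
      have "\<sigma> * fst z' > \<sigma> * fst z - (e - \<delta>) / 2" using that by (simp add: T_def)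
      then show False using D(4)[OF w(1)] w(2) by (simp add: field_simps)
    qed
    ultimately show "\<exists>T. open T \<and> z \<in> T \<and> T \<inter> Z = {}" by blast
  qed (auto simp: Z_def)
  moreover have "act i k l z \<in> Z" if "z \<in> Z" for i k l z
  proof -
    have "\<exists>w\<in>D. \<sigma> * fst w > \<sigma> * fst (act i k l z) + \<delta>" if D: "clopen_cut \<sigma> D" "act i k l z \<in> D" "\<delta> < e" for D \<delta>
    proof -
      have "z \<in> act (- i) (- k) (- l) ` D" using D(2) imageI[OF D(2), of "act (- i) (- k) (- l)"] by simp
      then obtain w where "w \<in> act (- i) (- k) (- l) ` D" "\<sigma> * fst w > \<sigma> * fst z + \<delta>"
        using ZD[OF \<open>z \<in> Z\<close> clopen_cut_act[OF D(1)] _ D(3)] by metis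
      then show ?thesis by (auto simp: algebra_simps intro!: bexI)
    qed
    then show ?thesis using that unfolding Z_def by auto
  qed
  moreover have "Z \<noteq> M"
  proof -
    define B where "B = (\<lambda>\<theta>. \<sigma> * \<theta>) ` fst ` A"
    have "closed (fst ` A)"
      by (rule closed_fst_image) (use A(1) in \<open>auto simp: clopen_cut_def act_translate\<close>)
    then have "closed B" unfolding B_def
      using \<sigma> closed_scaling[of "fst ` A" \<sigma>] by auto
    moreover have "bdd_above B" using A(1) by (auto simp: B_def clopen_cut_def bdd_above_def)
    moreover have "B \<noteq> {}" using A(2) by (simp add: B_def)
    \<comment> \<open>Vertical periodicity makes the projection closed, so the extreme position is
      attained; \<open>A\<close> has no overhang at all beyond such a point.\<close>
    ultimately have "Sup B \<in> B" by (intro closed_contains_Sup)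
    then obtain z where z: "z \<in> A" "Sup B = \<sigma> * fst z" by (auto simp: B_def)
    have "\<sigma> * fst w \<le> \<sigma> * fst z + 0" if "w \<in> A" for w
      using cSup_upper[of "\<sigma> * fst w" B] that \<open>bdd_above B\<close> z by (auto simp: B_def)
    then have "z \<notin> Z" using ZD[of z A 0] z(1) A(1) e by (metis linorder_not_less)
    then show ?thesis using z A(1) by (auto simp: clopen_cut_def)
  qed
  moreover have "Z \<subseteq> M" by (auto simp: Z_def)
  ultimately have "Z = {}" using M_minimal[of Z] by metis
  then have "z \<notin> Z" by simp
  then obtain D \<delta> where D: "clopen_cut \<sigma> D" "z \<in> D" "\<delta> < e" "\<forall>w\<in>D. \<sigma> * fst w \<le> \<sigma> * fst z + \<delta>"
    using notZ[OF z] by metis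
  have "\<sigma> * fst w < \<sigma> * fst z + e" if "w \<in> D" for w using D(3) bspec[OF D(4) that] by linarith
  then show thesis by (rule that[OF D(1,2)])
qed

text \<open>A cut and its complement in \<open>M\<close> are bounded on opposite sides, so pieces
  with little overhang exist for both signs, and their intersection is thin.\<close>

lemma vertical_stabiliser_small_clopen:
  assumes W: "W \<in> components (- M)" and l: "l \<noteq> 0" "act 0 0 l ` W = W"
    and z: "z \<in> M" and e: "e > 0"
  obtains D where "D \<subseteq> M" "closed D" "closed (M - D)" "\<And>w l. w \<in> D \<Longrightarrow> act 0 0 l w \<in> D" "z \<in> D"
    "\<And>w. w \<in> D \<Longrightarrow> \<bar>fst w - fst z\<bar> < e"
proof -
  obtain A c where A: "A \<subseteq> M" "closed A" "closed (M - A)" "\<And>w l. w \<in> A \<Longrightarrow> act 0 0 l w \<in> A"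
    "\<And>w. w \<in> A \<Longrightarrow> fst w \<le> c" "\<And>w. w \<in> M \<Longrightarrow> fst w < - c \<Longrightarrow> w \<in> A"
    using vertical_stabiliser_cut[OF W l] by blast
  have "\<forall>w\<in>A. 1 * fst w \<le> c" using A(5) by simp
  then have 1: "clopen_cut 1 A" unfolding clopen_cut_def using A(1-4)
    by (intro conjI ballI allI exI[of _ c]) simp_all
  have inv: "act 0 0 l w \<in> M - A" if "w \<in> M - A" for w l
    using that A(4)[of "act 0 0 l w" "- l"] by auto
  have "\<forall>w\<in>M - A. - 1 * fst w \<le> c" using A(6) by force
  then have 2: "clopen_cut (- 1) (M - A)"
    unfolding clopen_cut_def using A inv closed_M
    by (auto simp: Diff_Diff_Int Int_absorb1)
  obtain x where "(- c - 1, x) \<in> M" using M_fibre_nonempty by blast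
  then have "(- c - 1, x) \<in> A" using A(6) by force
  then have ne1: "A \<noteq> {}" by blast
  obtain y where "(c + 1, y) \<in> M" using M_fibre_nonempty by blast
  then have "(c + 1, y) \<in> M - A" using A(5) by force
  then have ne2: "M - A \<noteq> {}" by blast
  obtain D1 where D1: "clopen_cut 1 D1" "z \<in> D1" "\<And>w. w \<in> D1 \<Longrightarrow> 1 * fst w < 1 * fst z + e"
    using small_clopen_cut[OF 1 ne1 _ z e] by blast
  obtain D2 where D2: "clopen_cut (- 1) D2" "z \<in> D2" "\<And>w. w \<in> D2 \<Longrightarrow> - 1 * fst w < - 1 * fst z + e"
    using small_clopen_cut[OF 2 ne2 _ z e] by blast
  have "M - (D1 \<inter> D2) = (M - D1) \<union> (M - D2)" by auto
  then have "closed (M - (D1 \<inter> D2))" using D1(1) D2(1) by (auto simp: clopen_cut_def)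
  moreover have "\<bar>fst w - fst z\<bar> < e" if "w \<in> D1 \<inter> D2" for w
    using D1(3)[of w] D2(3)[of w] that by auto
  ultimately show thesis
    using D1(1,2) D2(1,2) unfolding clopen_cut_def by (intro that[of "D1 \<inter> D2"]) blast+
qed

end

section \<open>Tubes from an equivariant index\<close>

lemma int_eq_if_greater_iff:
  assumes "\<And>n::int. n < a \<longleftrightarrow> n < b"
  shows "a = b"
  using assms[of a] assms[of b] by auto

text \<open>The planar model of a p,q-invariant open tube: its interval fibres project to the arcs,
  and the common period \<open>P\<close> bounds both the number of iterates and the number of arcs
  in a fibre.\<close>

definition (in minimal_lift) tube :: "int \<Rightarrow> (real \<times> real) set \<Rightarrow> bool" where
  "tube P V \<longleftrightarrow> P > 0 \<and> open V \<and> connected V \<and> (\<forall>\<theta>. \<exists>x. (\<theta>, x) \<in> V) \<and>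
     (\<forall>\<theta>. is_interval {x. (\<theta>, x) \<in> V}) \<and> V \<inter> M = {} \<and>
     (\<forall>i k l. act i k l ` V = V \<or> act i k l ` V \<inter> V = {}) \<and>
     (\<forall>l. l \<noteq> 0 \<longrightarrow> act 0 0 l ` V \<inter> V = {}) \<and>
     (\<exists>a. act P 0 a ` V = V) \<and> (\<exists>b. act 0 P b ` V = V)"

locale monotone_index = minimal_lift +
  fixes N :: "real \<times> real \<Rightarrow> int" and s1 s2 Q :: int
  assumes Q_pos: "Q > 0"
    and N_act: "N (act i k l z) = N z + i * s1 + k * s2 + l * Q"
    and N_mono: "fst z = fst w \<Longrightarrow> snd z \<le> snd w \<Longrightarrow> N z \<le> N w"
    and N_locally_const: "z \<in> M \<Longrightarrow> \<exists>T. open T \<and> z \<in> T \<and> (\<forall>w\<in>T \<inter> M. N w = N z)"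
begin

lemma closed_index: "closed {w \<in> M. P (N w)}"
proof (rule closed_subset_M)
  fix z assume z: "z \<in> M" "z \<notin> {w \<in> M. P (N w)}"
  obtain T where T: "open T" "z \<in> T" "\<And>w. w \<in> T \<inter> M \<Longrightarrow> N w = N z"
    using N_locally_const[OF z(1)] by metis
  have "w \<notin> {w \<in> M. P (N w)}" if "w \<in> T" for w
    using T(3)[of w] z that by auto
  then show "\<exists>T. open T \<and> z \<in> T \<and> T \<inter> {w \<in> M. P (N w)} = {}" using T(1,2) by blast
qed auto

text \<open>A cut between two levels of the index. As \<open>N\<close> increases along the fibres,
  the two parts of \<open>M\<close> are stacked, and the gap is one interval in each fibre.\<close>

definition gap :: "int \<Rightarrow> (real \<times> real) set" where
  "gap n = {z. \<forall>w\<in>M. fst w = fst z \<longrightarrow> (if N w \<le> n then snd w < snd z else snd z < snd w)}"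

lemma gap_above: "z \<in> gap n \<Longrightarrow> w \<in> M \<Longrightarrow> fst w = fst z \<Longrightarrow> N w \<le> n \<Longrightarrow> snd w < snd z"
  by (auto simp: gap_def)

lemma gap_below: "z \<in> gap n \<Longrightarrow> w \<in> M \<Longrightarrow> fst w = fst z \<Longrightarrow> N w > n \<Longrightarrow> snd z < snd w"
  by (force simp: gap_def)

lemma gap_not_M: "gap n \<inter> M = {}"
proof -
  have False if "z \<in> gap n" "z \<in> M" for z
    using gap_above[OF that refl] gap_below[OF that refl] by force
  then show ?thesis by blast
qed

lemma gap_act_subset:
  assumes z: "z \<in> gap n"
  shows "act i k l z \<in> gap (n + i * s1 + k * s2 + l * Q)"
  unfolding gap_def
proof (intro CollectI ballI impI)
  fix w assume w: "w \<in> M" "fst w = fst (act i k l z)"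
  define w' where "w' = act (- i) (- k) (- l) w"
  have w': "w = act i k l w'" "w' \<in> M" "fst w' = fst z" using w by (auto simp: w'_def)
  have less: "snd w < snd (act i k l z) \<longleftrightarrow> snd w' < snd z" "snd (act i k l z) < snd w \<longleftrightarrow> snd z < snd w'"
    unfolding w'(1) using w'(3) by (auto simp: act_less)
  have "N w = N w' + i * s1 + k * s2 + l * Q" unfolding w'(1) by (rule N_act)
  then show "if N w \<le> n + i * s1 + k * s2 + l * Q then snd w < snd (act i k l z) else snd (act i k l z) < snd w"
    using gap_above[OF z w'(2,3)] gap_below[OF z w'(2,3)] unfolding less by simp
qed

lemma act_gap: "act i k l ` gap n = gap (n + i * s1 + k * s2 + l * Q)"
proof
  show "act i k l ` gap n \<subseteq> gap (n + i * s1 + k * s2 + l * Q)" using gap_act_subset by blast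
  show "gap (n + i * s1 + k * s2 + l * Q) \<subseteq> act i k l ` gap n"
  proof
    fix z assume "z \<in> gap (n + i * s1 + k * s2 + l * Q)"
    from gap_act_subset[OF this, of "- i" "- k" "- l"]
    have "act (- i) (- k) (- l) z \<in> gap n" by simp
    then have "act i k l (act (- i) (- k) (- l) z) \<in> act i k l ` gap n" by blast
    then show "z \<in> act i k l ` gap n" by simp
  qed
qed

lemma N_less_imp: "N w \<le> n \<Longrightarrow> n < N w' \<Longrightarrow> fst w = fst w' \<Longrightarrow> snd w < snd w'"
  using N_mono[of w' w] by force

lemma fibre_index_between: "\<exists>w\<in>M. fst w = \<theta> \<and> n < N w \<and> N w \<le> n + Q"
proof -
  obtain x where x: "(\<theta>, x) \<in> M" using M_fibre_nonempty by blast
  define d where "d = (n - N (\<theta>, x)) div Q"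
  define l where "l = d + 1"
  have "N (act 0 0 l (\<theta>, x)) = N (\<theta>, x) + d * Q + Q" by (simp add: N_act l_def algebra_simps)
  moreover have "d * Q + (n - N (\<theta>, x)) mod Q = n - N (\<theta>, x)" unfolding d_def by simp
  moreover have "0 \<le> (n - N (\<theta>, x)) mod Q" "(n - N (\<theta>, x)) mod Q < Q" using Q_pos by auto
  ultimately have "n < N (act 0 0 l (\<theta>, x))" "N (act 0 0 l (\<theta>, x)) \<le> n + Q"
    by linarith+
  then show ?thesis using M_act[OF x, of 0 0 l] by (intro bexI[of _ "act 0 0 l (\<theta>, x)"]) auto
qed

text \<open>Local constancy makes both level sets closed, and vertical equivariance makes both occur
  in the fibre; so the maximum of the lower one lies strictly below the minimum of the upper
  one.\<close>

lemma gap_fibre_nonempty: "\<exists>x. (\<theta>, x) \<in> gap n"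
proof -
  define A where "A = {y. (\<theta>, y) \<in> {w \<in> M. N w \<le> n}}"
  define B where "B = {y. (\<theta>, y) \<in> {w \<in> M. N w > n}}"
  have closed: "closed {y. (\<theta>, y) \<in> {w \<in> M. P (N w)}}" for P
    using continuous_closed_vimage[OF closed_index[of P], of "Pair \<theta>"]
    by (simp add: vimage_def continuous_Pair)
  have "closed A" "closed B" unfolding A_def B_def by (rule closed)+
  obtain a where "(\<theta>, a) \<in> M" "N (\<theta>, a) \<le> n"
    using fibre_index_between[of \<theta> "n - Q"] by force
  then have a: "a \<in> A" by (simp add: A_def)
  obtain b where "(\<theta>, b) \<in> M" "N (\<theta>, b) > n"
    using fibre_index_between[of \<theta> n] by force
  then have b: "b \<in> B" by (simp add: B_def)
  have AB: "y < y'" if "y \<in> A" "y' \<in> B" for y y'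
    using N_less_imp[of "(\<theta>, y)" n "(\<theta>, y')"] that by (simp add: A_def B_def)
  have bA: "bdd_above A" and bB: "bdd_below B" using AB a b by (meson bdd_above.I bdd_below.I less_imp_le)+
  have "Sup A \<in> A" using \<open>closed A\<close> a bA by (intro closed_contains_Sup) auto
  moreover have "Inf B \<in> B" using \<open>closed B\<close> b bB by (intro closed_contains_Inf) auto
  ultimately have lt: "Sup A < Inf B" by (rule AB)
  define x where "x = (Sup A + Inf B) / 2"
  have x: "Sup A < x" "x < Inf B" using lt by (auto simp: x_def)
  have "y < x" if "(\<theta>, y) \<in> M" "N (\<theta>, y) \<le> n" for y
    using cSup_upper[of y A] bA that x by (simp add: A_def)
  moreover have "x < y" if "(\<theta>, y) \<in> M" "N (\<theta>, y) > n" for y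
    using cInf_lower[of y B] bB that x by (simp add: B_def)
  ultimately have "(\<theta>, x) \<in> gap n" unfolding gap_def by auto
  then show ?thesis by blast
qed

lemma gap_fibre_interval: "is_interval {x. (\<theta>, x) \<in> gap n}"
  unfolding is_interval_1 gap_def by force

text \<open>Each fibre of \<open>M\<close> has points within distance 1 above and below any height.
  By monotonicity of \<open>N\<close>, a violation of the gap condition is then witnessed within
  distance 1, so the complement arises from closed sets by projecting along compact
  intervals.\<close>

lemma open_gap: "open (gap n)"
proof -
  have cl: "closed {z. \<exists>s. s \<in> {a..b} \<and> (fst z, snd z + s) \<in> {w \<in> M. P (N w)}}" for a b :: real and P
  proof -
    have "closed ((\<lambda>(s, z). (fst z, snd z + s)) -` {w \<in> M. P (N w)})"
      by (rule continuous_closed_vimage[OF closed_index]) (auto intro!: continuous_intros simp: case_prod_unfold)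
    then have "closed {z. \<exists>s. s \<in> {a..b} \<and> (s, z) \<in> (\<lambda>(s, z). (fst z, snd z + s)) -` {w \<in> M. P (N w)}}"
      by (rule closed_compact_projection[rotated]) auto
    then show ?thesis by simp
  qed
  have "- gap n = {z. \<exists>s. s \<in> {0..1} \<and> (fst z, snd z + s) \<in> {w \<in> M. N w \<le> n}}
      \<union> {z. \<exists>s. s \<in> {- 1..0} \<and> (fst z, snd z + s) \<in> {w \<in> M. N w > n}}" (is "_ = ?L \<union> ?R")
  proof (intro set_eqI iffI)
    fix z assume "z \<in> - gap n"
    then consider w where "w \<in> M" "fst w = fst z" "N w \<le> n" "snd z \<le> snd w"
      | w where "w \<in> M" "fst w = fst z" "N w > n" "snd w \<le> snd z"
      unfolding gap_def by force
    then show "z \<in> ?L \<union> ?R"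
    proof cases
      case 1
      obtain y where y: "(fst z, y) \<in> M" "snd z \<le> y" "y < snd z + 1" using M_fibre_near by blast
      have "\<exists>s. s \<in> {0..1} \<and> (fst z, snd z + s) \<in> {w \<in> M. N w \<le> n}"
      proof (cases "y \<le> snd w")
        case True
        then have "N (fst z, y) \<le> n" using N_mono[of "(fst z, y)" w] 1 by simp
        then show ?thesis using y by (intro exI[of _ "y - snd z"]) auto
      next
        case False
        have "(fst z, snd w) = w" using 1 by (simp add: prod_eq_iff)
        then show ?thesis using 1 y False by (intro exI[of _ "snd w - snd z"]) auto
      qed
      then show ?thesis by blast
    next
      case 2
      obtain y where y: "(fst z, y) \<in> M" "snd z - 1 \<le> y" "y < snd z - 1 + 1" using M_fibre_near by blast
      have "\<exists>s. s \<in> {- 1..0} \<and> (fst z, snd z + s) \<in> {w \<in> M. N w > n}"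
      proof (cases "snd w \<le> y")
        case True
        then have "N (fst z, y) > n" using N_mono[of w "(fst z, y)"] 2 by simp
        then show ?thesis using y by (intro exI[of _ "y - snd z"]) auto
      next
        case False
        have "(fst z, snd w) = w" using 2 by (simp add: prod_eq_iff)
        then show ?thesis using 2 y False by (intro exI[of _ "snd w - snd z"]) auto
      qed
      then show ?thesis by blast
    qed
  next
    fix z assume "z \<in> ?L \<union> ?R"
    then show "z \<in> - gap n" unfolding gap_def by force
  qed
  moreover have "closed ?L" "closed ?R" by (rule cl)+
  ultimately have "closed (- gap n)" by (simp add: closed_Un)
  then show ?thesis by (simp add: closed_def)
qed

text \<open>A separation would project to two open sets covering the base line, and they are
  disjoint because every fibre of the gap is an interval.\<close>

lemma connected_gap: "connected (gap n)"
proof (rule ccontr)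
  assume "\<not> connected (gap n)"
  then obtain A B where AB: "open A" "open B" "gap n \<subseteq> A \<union> B" "A \<inter> B \<inter> gap n = {}" "A \<inter> gap n \<noteq> {}" "B \<inter> gap n \<noteq> {}"
    unfolding connected_def by blast
  have op: "open (fst ` (A \<inter> gap n))" if "open A" for A
    using open_map_fst open_Int[OF that open_gap] by (auto simp: open_image_fst)
  have "fst ` (A \<inter> gap n) \<union> fst ` (B \<inter> gap n) = UNIV"
  proof (rule equalityI[OF subset_UNIV], rule subsetI)
    fix \<theta> :: real
    obtain x where "(\<theta>, x) \<in> gap n" using gap_fibre_nonempty by blast
    then show "\<theta> \<in> fst ` (A \<inter> gap n) \<union> fst ` (B \<inter> gap n)" using AB(3) by force
  qed
  moreover have "fst ` (A \<inter> gap n) \<inter> fst ` (B \<inter> gap n) = {}"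
  proof (rule ccontr)
    assume "fst ` (A \<inter> gap n) \<inter> fst ` (B \<inter> gap n) \<noteq> {}"
    then obtain z w where zw: "z \<in> A \<inter> gap n" "w \<in> B \<inter> gap n" "fst z = fst w" by auto
    define \<theta> where "\<theta> = fst z"
    obtain x y where xy: "(\<theta>, x) \<in> A \<inter> gap n" "(\<theta>, y) \<in> B \<inter> gap n"
      using zw unfolding \<theta>_def by (metis prod.collapse)
    have "connected (Pair \<theta> ` {x. (\<theta>, x) \<in> gap n})"
      using gap_fibre_interval is_interval_connected by (intro connected_continuous_image continuous_intros) auto
    moreover have "Pair \<theta> ` {x. (\<theta>, x) \<in> gap n} \<subseteq> gap n" by auto
    ultimately have "A \<inter> Pair \<theta> ` {x. (\<theta>, x) \<in> gap n} = {} \<or> B \<inter> Pair \<theta> ` {x. (\<theta>, x) \<in> gap n} = {}"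
      using connectedD[of "Pair \<theta> ` {x. (\<theta>, x) \<in> gap n}" A B] AB by blast
    then show False using xy by auto
  qed
  ultimately show False
    using connectedD[OF connected_UNIV op[OF AB(1)] op[OF AB(2)]] AB(5,6) by auto
qed

text \<open>A common point excludes indices in (n, n'] over its own base point. The points of
  \<open>M\<close> whose index is congruent modulo \<open>Q\<close> to a value in this window have a
  closed projection invariant under a dense group, so one missing fibre means that there are
  none.\<close>

lemma gap_eq_if_meet:
  assumes "gap n \<inter> gap n' \<noteq> {}" "n \<le> n'"
  shows "gap n = gap n'"
proof -
  obtain z where z: "z \<in> gap n" "z \<in> gap n'" using assms by blast
  define P where "P = {w \<in> M. \<exists>l. n < N w + l * Q \<and> N w + l * Q \<le> n'}"
  have inv: "act (Q * i) (Q * k) l w \<in> P" if wP: "w \<in> P" for w i k l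
  proof -
    obtain l' where l': "n < N w + l' * Q" "N w + l' * Q \<le> n'" using wP unfolding P_def by blast
    have "N (act (Q * i) (Q * k) l w) + (l' - i * s1 - k * s2 - l) * Q = N w + l' * Q"
      unfolding N_act by (simp add: algebra_simps)
    then have "\<exists>l'. n < N (act (Q * i) (Q * k) l w) + l' * Q \<and> N (act (Q * i) (Q * k) l w) + l' * Q \<le> n'"
      using l' by metis
    then show ?thesis using wP unfolding P_def by simp
  qed
  have "P = {}"
  proof (rule ccontr)
    assume "P \<noteq> {}"
    have "fst ` P = UNIV"
    proof (rule irrational_translation_invariant_UNIV[OF irr, where a = "of_int Q"])
      show "closed (fst ` P)"
      proof (rule closed_fst_image)
        show "closed P" unfolding P_def by (rule closed_index)
        show "(\<theta>, x + of_int l) \<in> P" if "(\<theta>, x) \<in> P" for \<theta> x l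
          using inv[OF that, of 0 0 l] by (simp add: act_translate)
      qed
      show "fst ` P \<noteq> {}" using \<open>P \<noteq> {}\<close> by simp
      fix \<theta> i k assume "\<theta> \<in> fst ` P"
      then obtain w where "w \<in> P" "\<theta> = fst w" by auto
      then show "\<theta> + of_int Q * (of_int i * \<omega> + of_int k) \<in> fst ` P"
        using imageI[OF inv[of w i k 0], of fst] by (simp add: algebra_simps)
    qed (use Q_pos in auto)
    then have "fst z \<in> fst ` P" by simp
    then obtain w where w: "w \<in> P" "fst w = fst z" by auto
    then obtain l where l: "n < N w + l * Q" "N w + l * Q \<le> n'" unfolding P_def by blast
    define w' where "w' = act 0 0 l w"
    have w': "w' \<in> M" "fst w' = fst z" "N w' = N w + l * Q"
      using w by (auto simp: w'_def N_act P_def)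
    have "snd z < snd w'" using w' l(1) by (intro gap_below[OF z(1)]) auto
    moreover have "snd w' < snd z" using w' l(2) by (intro gap_above[OF z(2)]) auto
    ultimately show False by simp
  qed
  have "N w \<le> n \<longleftrightarrow> N w \<le> n'" if "w \<in> M" for w
  proof (rule ccontr)
    assume "\<not> ?thesis"
    then have "n < N w + 0 * Q \<and> N w + 0 * Q \<le> n'" using assms(2) by auto
    then have "w \<in> P" using \<open>w \<in> M\<close> unfolding P_def by blast
    then show False using \<open>P = {}\<close> by simp
  qed
  then show ?thesis unfolding gap_def by (auto simp: not_le[symmetric] simp del: not_le)
qed

lemma gap_cases: "gap n = gap n' \<or> gap n \<inter> gap n' = {}"
  using gap_eq_if_meet[of n n'] gap_eq_if_meet[of n' n] by (cases "n \<le> n'") auto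

text \<open>Every fibre has a point of \<open>M\<close> with index in any given block of
  \<open>Q\<close> consecutive values, and it separates gaps whose levels differ by at least
  \<open>Q\<close>.\<close>

lemma gap_shift_disjoint:
  assumes "l \<noteq> 0"
  shows "act 0 0 l ` gap n \<inter> gap n = {}"
proof -
  have less: "gap n \<inter> gap n' = {}" if "n + Q \<le> n'" for n n'
  proof (rule ccontr)
    assume "gap n \<inter> gap n' \<noteq> {}"
    then obtain z where z: "z \<in> gap n" "z \<in> gap n'" by blast
    obtain w where w: "w \<in> M" "fst w = fst z" "n < N w" "N w \<le> n + Q"
      using fibre_index_between by blast
    then have "snd z < snd w" by (intro gap_below[OF z(1)])
    moreover have "snd w < snd z" using w that by (intro gap_above[OF z(2)]) auto
    ultimately show False by simp
  qed
  have "gap (n + l * Q) \<inter> gap n = {}"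
  proof (cases "l > 0")
    case True
    then have "n + Q \<le> n + l * Q" using Q_pos by simp
    then show ?thesis using less by blast
  next
    case False
    then have "l \<le> - 1" using assms by simp
    then have "l * Q \<le> - 1 * Q" using Q_pos by (intro mult_right_mono) auto
    then have "n + l * Q + Q \<le> n" by simp
    then show ?thesis by (rule less)
  qed
  then show ?thesis unfolding act_gap by simp
qed

lemma tube_gap: "tube Q (gap 0)"
  unfolding tube_def
proof (intro conjI allI impI)
  show "act i k l ` gap 0 = gap 0 \<or> act i k l ` gap 0 \<inter> gap 0 = {}" for i k l
    unfolding act_gap by (rule gap_cases)
  show "\<exists>a. act Q 0 a ` gap 0 = gap 0"
    unfolding act_gap by (rule exI[of _ "- s1"]) (simp add: mult.commute)
  show "\<exists>b. act 0 Q b ` gap 0 = gap 0"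
    unfolding act_gap by (rule exI[of _ "- s2"]) (simp add: mult.commute)
qed (use Q_pos open_gap connected_gap gap_fibre_nonempty gap_fibre_interval gap_not_M gap_shift_disjoint in auto)

end

section \<open>The index of a doubly periodic component\<close>

lemma sum_int_shift:
  fixes h :: "int \<Rightarrow> int"
  assumes "p \<ge> 0"
  shows "(\<Sum>i\<in>{0..<p}. h (i + 1)) = (\<Sum>i\<in>{0..<p}. h i) + h p - h 0"
proof -
  have "(\<Sum>i\<in>{0..<int n}. h (i + 1)) = (\<Sum>i\<in>{0..<int n}. h i) + h (int n) - h 0" for n
  proof (induction n)
    case (Suc n)
    have "{0..<int (Suc n)} = insert (int n) {0..<int n}" by auto
    then show ?case using Suc by (simp add: add.commute)
  qed simp
  from this[of "nat p"] show ?thesis using assms by simp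
qed

context minimal_lift
begin

lemma equivariant_from_generators:
  fixes f :: "real \<times> real \<Rightarrow> int"
  assumes "\<And>z. f (act 1 0 0 z) = f z + s1" "\<And>z. f (act 0 1 0 z) = f z + s2" "\<And>z. f (act 0 0 1 z) = f z + s3"
  shows "f (act i k l z) = f z + i * s1 + k * s2 + l * s3"
proof -
  have step: "f (act (n * i) (n * k) (n * l) z) = f z + n * s" if "\<And>z. f (act i k l z) = f z + s" for i k l s n z
  proof (induction n rule: int_induct[where k = 0])
    case base
    then show ?case by simp
  next
    case (step1 n)
    then show ?case using that[of "act (n * i) (n * k) (n * l) z"] by (simp add: algebra_simps)
  next
    case (step2 n)
    then show ?case using that[of "act ((n - 1) * i) ((n - 1) * k) ((n - 1) * l) z"] by (simp add: algebra_simps)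
  qed
  have "act i k l z = act i 0 0 (act 0 k 0 (act 0 0 l z))" by simp
  then show ?thesis
    using step[OF assms(1), of i "act 0 k 0 (act 0 0 l z)"] step[OF assms(2), of k "act 0 0 l z"] step[OF assms(3), of l z]
    by simp
qed

end

locale periodic_component = minimal_lift +
  fixes W :: "(real \<times> real) set" and p q l' r :: int
  assumes W_component: "W \<in> components (- M)" and p_pos: "p > 0" and q_pos: "q > 0"
    and stab_q: "act 0 q r ` W = W" and stab_p: "act p 0 l' ` W = W"
    and vertical_free: "l \<noteq> 0 \<Longrightarrow> act 0 0 l ` W \<inter> W = {}"
begin

lemma open_W: "open W"
  using open_components[OF _ W_component] closed_M by (simp add: open_Compl)

lemma W_q_iff: "(\<theta> + of_int n * of_int q, x + of_int n * of_int r) \<in> W \<longleftrightarrow> (\<theta>, x) \<in> W"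
  using stabiliser_mem_iff[OF stabiliser_mult[OF stab_q, of n], of "(\<theta>, x)"] by (simp add: act_translate)

lemma W_shift_notin: "l \<noteq> 0 \<Longrightarrow> (\<theta>, x) \<in> W \<Longrightarrow> (\<theta>, x + of_int l) \<notin> W"
  using vertical_free[of l] by (force simp: act_translate image_iff)

text \<open>The projection of \<open>W\<close> to the base is connected and invariant under
  translation by \<open>q\<close>.\<close>

lemma W_fibre_nonempty: "\<exists>x. (\<theta>, x) \<in> W"
proof -
  obtain \<theta>0 x0 where w: "(\<theta>0, x0) \<in> W" using in_components_nonempty[OF W_component] by auto
  have c: "connected (fst ` W)"
    using in_components_connected[OF W_component] by (intro connected_continuous_image continuous_intros)
  define n where "n = \<lceil>\<bar>\<theta> - \<theta>0\<bar>\<rceil>"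
  have q1: "of_int q \<ge> (1::real)" using q_pos by linarith
  have n: "\<bar>\<theta> - \<theta>0\<bar> \<le> of_int n" "0 \<le> real_of_int n" unfolding n_def by linarith+
  then have "\<bar>\<theta> - \<theta>0\<bar> \<le> of_int n * of_int q" using mult_left_mono[OF q1 n(2)] by simp
  then have "\<theta>0 + of_int (- n) * of_int q \<le> \<theta>" "\<theta> \<le> \<theta>0 + of_int n * of_int q" by (simp_all add: abs_le_iff)
  moreover have "\<theta>0 + of_int m * of_int q \<in> fst ` W" for m
    using W_q_iff[of \<theta>0 m x0] w by force
  ultimately have "\<theta> \<in> fst ` W" using connectedD_interval[OF c] by blast
  then show ?thesis by force
qed

text \<open>A nonzero vertical translate of \<open>W\<close> avoids \<open>W\<close>, so the winding
  index of a loop in \<open>W\<close> is constant along it. If one point of the translate already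
  lies beyond one end of the cylinder, no other point can reach the opposite end.\<close>

lemma W_bounded:
  obtains R where "\<And>\<theta> x. (\<theta>, x) \<in> W \<Longrightarrow> \<bar>x * of_int q - of_int r * \<theta>\<bar> \<le> R"
proof -
  have "q \<noteq> 0 \<or> r \<noteq> 0" using q_pos by simp
  then obtain a R where a: "continuous_on (- W) a" "\<And>z. z \<notin> W \<Longrightarrow> a z \<in> (\<int> :: complex set)"
    "\<And>\<theta> x. x * of_int q - of_int r * \<theta> > R \<Longrightarrow> a (\<theta>, x) = 1"
    "\<And>\<theta> x. x * of_int q - of_int r * \<theta> < - R \<Longrightarrow> a (\<theta>, x) = 0"
    using component_index[OF W_component stab_q] by metis
  obtain \<theta>0 x0 where w0: "(\<theta>0, x0) \<in> W" using in_components_nonempty[OF W_component] by auto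
  have cW: "connected W" by (rule in_components_connected[OF W_component])
  define b where "b n z = a (fst z, snd z - of_int n)" for n :: int and z
  have const: "b n z = b n (\<theta>0, x0)" if n: "n \<noteq> 0" and z: "z \<in> W" for n z
  proof -
    have notin: "(fst z, snd z - of_int n) \<notin> W" if "z \<in> W" for z
      using W_shift_notin[of "- n" "fst z" "snd z"] n that by simp
    have "continuous_on W (b n)"
      unfolding b_def
      by (intro continuous_on_compose2[OF a(1)] continuous_intros) (use notin in auto)
    moreover have "\<exists>e>0. \<forall>y. y \<in> W \<and> b n y \<noteq> b n x \<longrightarrow> e \<le> norm (b n y - b n x)" if xW: "x \<in> W" for x
    proof (intro exI[of _ 1] conjI allI impI)
      fix y assume y: "y \<in> W \<and> b n y \<noteq> b n x"
      then have "b n y - b n x \<in> \<int>" unfolding b_def using a(2) notin xW by (intro Ints_diff) auto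
      then obtain m where m: "b n y - b n x = of_int m" by (elim Ints_cases)
      then have "m \<noteq> 0" using y by auto
      then show "1 \<le> norm (b n y - b n x)" unfolding m by simp
    qed simp
    ultimately have "b n constant_on W" by (intro continuous_discrete_range_constant[OF cW])
    then show ?thesis using z w0 unfolding constant_on_def by metis
  qed
  define y0 where "y0 = x0 * of_int q - of_int r * \<theta>0"
  \<comment> \<open>Lowering (\<theta>0, x0) by \<open>n\<close> takes its relative height below -R,
    and raising it by \<open>n\<close> takes it above R.\<close>
  define n where "n = max 1 (\<lceil>\<bar>y0\<bar> + \<bar>R\<bar>\<rceil> + 1)"
  have n: "n \<ge> 1" "\<bar>y0\<bar> + \<bar>R\<bar> < of_int n" unfolding n_def by linarith+
  have "n * 1 \<le> n * q" using n(1) q_pos by (intro mult_left_mono) auto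
  then have "of_int n \<le> of_int n * (of_int q :: real)"
    by (metis mult.right_neutral of_int_le_iff of_int_mult)
  then have y0n: "\<bar>y0\<bar> + \<bar>R\<bar> < of_int n * of_int q" using n(2) by linarith
  have up: "(x * of_int q - of_int r * \<theta>) - of_int n * of_int q \<le> R" if w: "(\<theta>, x) \<in> W" for \<theta> x
  proof (rule ccontr)
    assume "\<not> ?thesis"
    then have "b n (\<theta>, x) = 1" using a(3)[of "x - of_int n" \<theta>] by (simp add: b_def left_diff_distrib)
    moreover have "(x0 - of_int n) * of_int q - of_int r * \<theta>0 < - R"
      using y0n unfolding y0_def by (simp add: left_diff_distrib)
    then have "b n (\<theta>0, x0) = 0" using a(4)[of "x0 - of_int n" \<theta>0] by (simp add: b_def)
    ultimately show False using const[of n "(\<theta>, x)"] n(1) w by simp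
  qed
  have down: "- R \<le> (x * of_int q - of_int r * \<theta>) + of_int n * of_int q" if w: "(\<theta>, x) \<in> W" for \<theta> x
  proof (rule ccontr)
    assume "\<not> ?thesis"
    then have "b (- n) (\<theta>, x) = 0" using a(4)[of "x + of_int n" \<theta>] by (simp add: b_def distrib_right)
    moreover have "R < (x0 + of_int n) * of_int q - of_int r * \<theta>0"
      using y0n unfolding y0_def by (simp add: distrib_right)
    then have "b (- n) (\<theta>0, x0) = 1" using a(3)[of "x0 + of_int n" \<theta>0] by (simp add: b_def)
    ultimately show False using const[of "- n" "(\<theta>, x)"] n(1) w by simp
  qed
  have "\<bar>x * of_int q - of_int r * \<theta>\<bar> \<le> R + of_int n * of_int q" if "(\<theta>, x) \<in> W" for \<theta> x
    using up[OF that] down[OF that] by (simp add: abs_le_iff)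
  then show thesis by (rule that)
qed

section \<open>Counting the vertical translates of the component below a point\<close>

definition bot :: "real \<Rightarrow> real" where "bot \<theta> = Inf {x. (\<theta>, x) \<in> W}"

definition top :: "real \<Rightarrow> real" where "top \<theta> = Sup {x. (\<theta>, x) \<in> W}"

lemma W_fibre_bounded: "bdd_below {x. (\<theta>, x) \<in> W}" "bdd_above {x. (\<theta>, x) \<in> W}"
proof -
  obtain R where R: "\<And>\<theta> x. (\<theta>, x) \<in> W \<Longrightarrow> \<bar>x * of_int q - of_int r * \<theta>\<bar> \<le> R"
    using W_bounded by blast
  have "(- R + of_int r * \<theta>) / of_int q \<le> x \<and> x \<le> (R + of_int r * \<theta>) / of_int q" if "(\<theta>, x) \<in> W" for x
    using R[OF that] q_pos by (simp add: field_simps abs_le_iff)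
  then show "bdd_below {x. (\<theta>, x) \<in> W}" "bdd_above {x. (\<theta>, x) \<in> W}"
    by (auto simp: bdd_below_def bdd_above_def)
qed

text \<open>The number of vertical translates of the component reaching below a point, and the number of
  those lying entirely below it: the first is lower, the second upper semicontinuous.\<close>

definition reach :: "real \<times> real \<Rightarrow> int" where "reach z = \<lceil>snd z - bot (fst z)\<rceil>"

definition clear :: "real \<times> real \<Rightarrow> int" where "clear z = \<lfloor>snd z - top (fst z)\<rfloor>"

lemma less_reach_iff: "n < reach z \<longleftrightarrow> (\<exists>y. (fst z, y) \<in> W \<and> y + of_int n < snd z)"
proof -
  have "n < reach z \<longleftrightarrow> bot (fst z) < snd z - of_int n"
    unfolding reach_def by linarith
  also have "\<dots> \<longleftrightarrow> (\<exists>y\<in>{x. (fst z, x) \<in> W}. y < snd z - of_int n)"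
    unfolding bot_def using W_fibre_nonempty W_fibre_bounded by (intro cInf_less_iff) auto
  finally show ?thesis by (auto simp: algebra_simps)
qed

lemma clear_less_iff: "clear z < n \<longleftrightarrow> (\<exists>y. (fst z, y) \<in> W \<and> snd z < y + of_int n)"
proof -
  have "clear z < n \<longleftrightarrow> snd z - of_int n < top (fst z)"
    unfolding clear_def by linarith
  also have "\<dots> \<longleftrightarrow> (\<exists>y\<in>{x. (fst z, x) \<in> W}. snd z - of_int n < y)"
    unfolding top_def using W_fibre_nonempty W_fibre_bounded by (intro less_cSup_iff) auto
  finally show ?thesis by (auto simp: algebra_simps)
qed

lemma open_less_reach: "open {z. n < reach z}"
proof -
  have "{z. n < reach z} = (\<Union>s\<in>{of_int n<..}. (\<lambda>z. (fst z, snd z - s)) -` W)"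
    unfolding less_reach_iff
  proof (intro set_eqI iffI)
    fix z assume "z \<in> {z. \<exists>y. (fst z, y) \<in> W \<and> y + real_of_int n < snd z}"
    then obtain y where "(fst z, y) \<in> W" "y + real_of_int n < snd z" by auto
    then show "z \<in> (\<Union>s\<in>{of_int n<..}. (\<lambda>z. (fst z, snd z - s)) -` W)"
      by (intro UN_I[of "snd z - y"]) auto
  qed force
  moreover have "open ((\<lambda>z. (fst z, snd z - s)) -` W)" for s :: real
    by (rule open_vimage[OF open_W]) (intro continuous_intros)
  ultimately show ?thesis by auto
qed

lemma open_clear_less: "open {z. clear z < n}"
proof -
  have "{z. clear z < n} = (\<Union>s\<in>{..<of_int n}. (\<lambda>z. (fst z, snd z - s)) -` W)"
    unfolding clear_less_iff
  proof (intro set_eqI iffI)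
    fix z assume "z \<in> {z. \<exists>y. (fst z, y) \<in> W \<and> snd z < y + real_of_int n}"
    then obtain y where "(fst z, y) \<in> W" "snd z < y + real_of_int n" by auto
    then show "z \<in> (\<Union>s\<in>{..<of_int n}. (\<lambda>z. (fst z, snd z - s)) -` W)"
      by (intro UN_I[of "snd z - y"]) auto
  qed force
  moreover have "open ((\<lambda>z. (fst z, snd z - s)) -` W)" for s :: real
    by (rule open_vimage[OF open_W]) (intro continuous_intros)
  ultimately show ?thesis by auto
qed

text \<open>A stabilising element carries the fibres of \<open>W\<close> onto each other. The
  relation \<open>P\<close> is left open so as to serve both counts.\<close>

lemma W_over_act:
  assumes "act i k l ` W = W"
  shows "(\<exists>y. (fst (act i k l z), y) \<in> W \<and> P (y + of_int n) (snd (act i k l z)))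
    \<longleftrightarrow> (\<exists>y. (fst z, y) \<in> W \<and> P (snd (act i k l (fst z, y + of_int n))) (snd (act i k l z)))"
proof -
  have e: "snd (act i k l (fst z, y + of_int n)) = snd (act i k l (fst z, y)) + of_int n" for y
    by (simp add: act_def)
  show ?thesis
  proof
    assume "\<exists>y. (fst (act i k l z), y) \<in> W \<and> P (y + of_int n) (snd (act i k l z))"
    then obtain y where y: "(fst (act i k l z), y) \<in> W" "P (y + of_int n) (snd (act i k l z))" by blast
    define w where "w = act (- i) (- k) (- l) (fst (act i k l z), y)"
    have aw: "act i k l w = (fst (act i k l z), y)" by (simp add: w_def)
    then have "w \<in> W" using y(1) stabiliser_mem_iff[OF assms, of w] by simp
    moreover have "w = (fst z, snd w)" by (simp add: w_def prod_eq_iff)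
    ultimately show "\<exists>y. (fst z, y) \<in> W \<and> P (snd (act i k l (fst z, y + of_int n))) (snd (act i k l z))"
      using aw y(2) unfolding e by (metis snd_conv)
  next
    assume "\<exists>y. (fst z, y) \<in> W \<and> P (snd (act i k l (fst z, y + of_int n))) (snd (act i k l z))"
    then obtain y where y: "(fst z, y) \<in> W" "P (snd (act i k l (fst z, y)) + of_int n) (snd (act i k l z))"
      unfolding e by blast
    have "act i k l (fst z, y) = (fst (act i k l z), snd (act i k l (fst z, y)))" by (simp add: prod_eq_iff)
    then show "\<exists>y. (fst (act i k l z), y) \<in> W \<and> P (y + of_int n) (snd (act i k l z))"
      using y stabiliser_mem_iff[OF assms, of "(fst z, y)"] by metis
  qed
qed

lemma reach_stabiliser:
  assumes "act i k l ` W = W"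
  shows "reach (act i k l z) = reach z"
proof (rule int_eq_if_greater_iff)
  fix n
  show "n < reach (act i k l z) \<longleftrightarrow> n < reach z"
    unfolding less_reach_iff using W_over_act[OF assms, of z "(<)" n] by (simp add: act_less)
qed

lemma clear_stabiliser:
  assumes "act i k l ` W = W"
  shows "clear (act i k l z) = clear z"
proof -
  have "clear (act i k l z) < n \<longleftrightarrow> clear z < n" for n
    unfolding clear_less_iff using W_over_act[OF assms, of z "\<lambda>a b. b < a" n] by (simp add: act_less)
  then show ?thesis by (metis linorder_neq_iff)
qed

lemma reach_shift: "reach (act 0 0 l z) = reach z + l"
  unfolding reach_def act_translate by simp linarith

lemma clear_shift: "clear (act 0 0 l z) = clear z + l"
  unfolding clear_def act_translate by simp linarith

text \<open>\<open>reach\<close> and \<open>clear\<close> are invariant only under the stabiliser of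
  \<open>W\<close>. Summing over p q representatives of time and base translation makes them
  equivariant under the whole group, with vertical increment p q.\<close>

definition orbit_sum :: "(real \<times> real \<Rightarrow> int) \<Rightarrow> real \<times> real \<Rightarrow> int" where
  "orbit_sum B z = (\<Sum>i\<in>{0..<p}. \<Sum>j\<in>{0..<q}. B (act i j 0 z))"

text \<open>Advancing time or base by one replaces the first row of the double sum by the row one
  period later. A stabilising element identifies the two up to a vertical translation, which
  produces the constants.\<close>

lemma orbit_sum_act:
  assumes stab: "\<And>i k l z. act i k l ` W = W \<Longrightarrow> B (act i k l z) = B z"
    and shift: "\<And>l z. B (act 0 0 l z) = B z + l"
  shows "orbit_sum B (act i k l z) = orbit_sum B z + i * (- (q * l')) + k * (- (p * r)) + l * (p * q)"
proof (rule equivariant_from_generators)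
  fix z
  have Bl: "B (act i j l z) = B (act i j 0 z) + l" for i j l
    using shift[of l "act i j 0 z"] by simp
  have "B (act p j 0 z) = B (act 0 j 0 z) - l'" for j
    using stab[OF stab_p, of "act 0 j (- l') z"] Bl[of 0 j "- l'"] by simp
  then have 1: "(\<Sum>j\<in>{0..<q}. B (act p j 0 z)) = (\<Sum>j\<in>{0..<q}. B (act 0 j 0 z)) - q * l'"
    using q_pos by (simp add: sum_subtractf)
  have "orbit_sum B (act 1 0 0 z) = (\<Sum>i\<in>{0..<p}. \<Sum>j\<in>{0..<q}. B (act (i + 1) j 0 z))"
    by (simp add: orbit_sum_def)
  also have "\<dots> = orbit_sum B z - q * l'"
    using sum_int_shift[of p "\<lambda>i. \<Sum>j\<in>{0..<q}. B (act i j 0 z)"] p_pos 1 by (simp add: orbit_sum_def)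
  finally show "orbit_sum B (act 1 0 0 z) = orbit_sum B z + - (q * l')" by simp
  have 2: "B (act i q 0 z) = B (act i 0 0 z) - r" for i
    using stab[OF stab_q, of "act i 0 (- r) z"] Bl[of i 0 "- r"] by simp
  have "orbit_sum B (act 0 1 0 z) = (\<Sum>i\<in>{0..<p}. \<Sum>j\<in>{0..<q}. B (act i (j + 1) 0 z))"
    by (simp add: orbit_sum_def)
  also have "\<dots> = (\<Sum>i\<in>{0..<p}. (\<Sum>j\<in>{0..<q}. B (act i j 0 z)) - r)"
  proof (intro sum.cong refl)
    fix i
    show "(\<Sum>j\<in>{0..<q}. B (act i (j + 1) 0 z)) = (\<Sum>j\<in>{0..<q}. B (act i j 0 z)) - r"
      using sum_int_shift[of q "\<lambda>j. B (act i j 0 z)"] q_pos 2[of i] by simp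
  qed
  also have "\<dots> = orbit_sum B z - p * r" using p_pos by (simp add: orbit_sum_def sum_subtractf)
  finally show "orbit_sum B (act 0 1 0 z) = orbit_sum B z + - (p * r)" by simp
  show "orbit_sum B (act 0 0 1 z) = orbit_sum B z + p * q"
    using p_pos q_pos by (simp add: orbit_sum_def Bl[of _ _ 1] sum.distrib)
qed

text \<open>For integers, staying above the value minus 1 means not dropping, so the open conditions
  on the single counts give exact inequalities for the sums.\<close>

lemma orbit_sum_semicontinuous:
  "\<exists>T. open T \<and> z \<in> T \<and> (\<forall>w\<in>T. orbit_sum reach z \<le> orbit_sum reach w \<and> orbit_sum clear w \<le> orbit_sum clear z)"
proof -
  define T where "T = (\<Inter>i\<in>{0..<p}. \<Inter>j\<in>{0..<q}.
    act i j 0 -` ({w. reach (act i j 0 z) - 1 < reach w} \<inter> {w. clear w < clear (act i j 0 z) + 1}))"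
  have "open T" unfolding T_def
    by (intro open_INT ballI open_vimage open_Int open_less_reach open_clear_less continuous_on_act) auto
  moreover have "z \<in> T" by (auto simp: T_def)
  moreover have "orbit_sum reach z \<le> orbit_sum reach w \<and> orbit_sum clear w \<le> orbit_sum clear z" if wT: "w \<in> T" for w
  proof -
    have "reach (act i j 0 z) - 1 < reach (act i j 0 w) \<and> clear (act i j 0 w) < clear (act i j 0 z) + 1"
      if "i \<in> {0..<p}" "j \<in> {0..<q}" for i j
      using wT that unfolding T_def by blast
    then show ?thesis unfolding orbit_sum_def by (intro conjI sum_mono) force+
  qed
  ultimately show ?thesis by blast
qed

text \<open>The difference of the two indices is lower semicontinuous and invariant, hence constant on the
  minimal set; so both indices are locally constant there.\<close>

lemma orbit_sum_diff_const:
  assumes "z \<in> M" "w \<in> M"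
  shows "orbit_sum reach z - orbit_sum clear z = orbit_sum reach w - orbit_sum clear w"
proof -
  define d where "d z = orbit_sum reach z - orbit_sum clear z" for z
  have d_act: "d (act i k l z) = d z" for i k l z
    unfolding d_def using orbit_sum_act[of reach, OF reach_stabiliser reach_shift] orbit_sum_act[of clear, OF clear_stabiliser clear_shift] by simp
  have le: "d w \<le> d z" if zw: "z \<in> M" "w \<in> M" for z w
  proof -
    define A where "A = {w \<in> M. d w \<le> d z}"
    have "closed A"
    proof (rule closed_subset_M)
      fix u assume u: "u \<in> M" "u \<notin> A"
      obtain T where T: "open T" "u \<in> T" "\<forall>w\<in>T. orbit_sum reach u \<le> orbit_sum reach w \<and> orbit_sum clear w \<le> orbit_sum clear u"
        using orbit_sum_semicontinuous[of u] by blast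
      have "w \<notin> A" if "w \<in> T" for w
        using bspec[OF T(3) that] u unfolding A_def d_def by auto
      then show "\<exists>T. open T \<and> u \<in> T \<and> T \<inter> A = {}" using T(1,2) by blast
    qed (auto simp: A_def)
    moreover have "act i k l u \<in> A" if "u \<in> A" for i k l u
      using that by (simp add: A_def d_act)
    moreover have "A \<subseteq> M" "z \<in> A" using zw by (auto simp: A_def)
    ultimately have "A = M" using M_minimal[of A] by (metis empty_iff)
    then show ?thesis using zw(2) by (auto simp: A_def)
  qed
  show ?thesis using le[OF assms] le[OF assms(2,1)] unfolding d_def by simp
qed

lemma reach_mono:
  assumes "fst z = fst w" "snd z \<le> snd w"
  shows "reach z \<le> reach w"
  using assms unfolding reach_def by (simp add: ceiling_mono)

sublocale monotone_index \<omega> \<phi> M "orbit_sum reach" "- (q * l')" "- (p * r)" "p * q"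
proof unfold_locales
  show "p * q > 0" using p_pos q_pos by simp
  show "orbit_sum reach (act i k l z) = orbit_sum reach z + i * (- (q * l')) + k * (- (p * r)) + l * (p * q)" for i k l z
    by (rule orbit_sum_act[OF reach_stabiliser reach_shift])
  show "orbit_sum reach z \<le> orbit_sum reach w" if "fst z = fst w" "snd z \<le> snd w" for z w
    unfolding orbit_sum_def
  proof (intro sum_mono reach_mono)
    fix i j
    show "fst (act i j 0 z) = fst (act i j 0 w)" using that by simp
    show "snd (act i j 0 z) \<le> snd (act i j 0 w)" using that by (simp add: act_def)
  qed
  show "\<exists>T. open T \<and> z \<in> T \<and> (\<forall>w\<in>T \<inter> M. orbit_sum reach w = orbit_sum reach z)" if z: "z \<in> M" for z
  proof -
    obtain T where T: "open T" "z \<in> T" "\<forall>w\<in>T. orbit_sum reach z \<le> orbit_sum reach w \<and> orbit_sum clear w \<le> orbit_sum clear z"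
      using orbit_sum_semicontinuous[of z] by blast
    have "orbit_sum reach w = orbit_sum reach z" if w: "w \<in> T \<inter> M" for w
    proof -
      have "w \<in> T" "w \<in> M" using w by auto
      then show ?thesis using bspec[OF T(3), of w] orbit_sum_diff_const[OF z, of w] by linarith
    qed
    then show ?thesis using T(1,2) by blast
  qed
qed

end

section \<open>Periodicity of the complementary components\<close>

context bv_minimal_lift
begin

text \<open>Without such a return a small box in \<open>W\<close> would be a wandering box, which
  the Denjoy estimate excludes.\<close>

lemma component_returns:
  assumes W: "W \<in> components (- M)" and vf: "\<forall>l. l \<noteq> 0 \<longrightarrow> act 0 0 l ` W \<noteq> W" and e: "e > 0"
  obtains m k l where "m \<noteq> 0" "\<bar>of_int m * \<omega> + of_int k\<bar> < e" "act m k l ` W = W"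
proof (rule ccontr)
  assume "\<not> thesis"
  note ret = that
  have no: "act m k l ` W \<noteq> W" if m: "m \<noteq> 0" "\<bar>of_int m * \<omega> + of_int k\<bar> < e" for m k l
    using ret[OF m] \<open>\<not> thesis\<close> by metis
  obtain t0 x0 where w0: "(t0, x0) \<in> W" using in_components_nonempty[OF W] by auto
  have "open W" using open_components[OF _ W] closed_M by (simp add: open_Compl)
  then obtain A B where AB: "open A" "open B" "(t0, x0) \<in> A \<times> B" "A \<times> B \<subseteq> W"
    using w0 by (rule open_prod_elim)
  obtain a where a: "a > 0" "cball t0 a \<subseteq> A" using AB open_contains_cball[of A] by auto
  obtain b where b: "b > 0" "cball x0 b \<subseteq> B" using AB open_contains_cball[of B] by auto
  \<comment> \<open>a / 3 fits the base of the box into \<open>A\<close>, e / 5 makes 4 \<rho> less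
    than \<open>e\<close>, and 1 / 5 makes 4 \<rho> less than 1, so that a displacement without
    iteration must vanish.\<close>
  define \<rho> where "\<rho> = Min {a / 3, e / 5, 1 / 5}"
  have \<rho>: "\<rho> > 0" "\<rho> \<le> a / 3" "\<rho> \<le> e / 5" "\<rho> \<le> 1 / 5" using a e by (auto simp: \<rho>_def)
  interpret bv_wandering_box \<omega> \<phi> M G W t0 \<rho> x0 "x0 + b"
  proof unfold_locales
    show "W \<in> components (- M)" by (rule W)
    show "\<rho> > 0" by (rule \<rho>(1))
    show "x0 < x0 + b" using b(1) by simp
    show "(\<theta>, x) \<in> W" if "\<bar>\<theta> - t0\<bar> \<le> 3 * \<rho>" "x \<in> {x0..x0 + b}" for \<theta> x
    proof -
      have "\<theta> \<in> cball t0 a" "x \<in> cball x0 b" using that \<rho>(2) by (auto simp: dist_real_def)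
      then show ?thesis using a b AB(4) by blast
    qed
    show "act m k l ` W \<inter> W = {}" if ne: "(m, k, l) \<noteq> (0, 0, 0)" and d: "\<bar>of_int m * \<omega> + of_int k\<bar> \<le> 4 * \<rho>" for m k l
    proof (cases "m = 0")
      case True
      then have "\<bar>real_of_int k\<bar> < 1" using d \<rho> by simp
      then have "k = 0" by simp
      then show ?thesis using True ne vf act_component_cases[OF W, of 0 0 l] by auto
    next
      case False
      have "\<bar>of_int m * \<omega> + of_int k\<bar> < e" using d \<rho>(1,3) e by linarith
      then show ?thesis using no[OF False] act_component_cases[OF W] by blast
    qed
  qed
  show False by (rule no_wandering_box)
qed

text \<open>The second return has displacement less than that of the first divided by |i1|;
  proportional index pairs would make it at least that large. So the determinant \<open>d\<close> is
  nonzero, and integer combinations of the two elements eliminate the time or the base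
  translation.\<close>

lemma component_periodic:
  assumes W: "W \<in> components (- M)" and vf: "\<forall>l. l \<noteq> 0 \<longrightarrow> act 0 0 l ` W \<noteq> W"
  obtains p q l' r where "p > 0" "q > 0" "act 0 q r ` W = W" "act p 0 l' ` W = W"
proof -
  obtain i1 k1 l1 where g1: "i1 \<noteq> 0" "act i1 k1 l1 ` W = W"
    using component_returns[OF W vf zero_less_one] by metis
  define \<beta>1 where "\<beta>1 = of_int i1 * \<omega> + of_int k1"
  have \<beta>1: "\<beta>1 \<noteq> 0" unfolding \<beta>1_def using displacement_eq_0_iff g1(1) by blast
  have "\<bar>\<beta>1\<bar> / \<bar>of_int i1\<bar> > 0" using \<beta>1 g1(1) by simp
  from component_returns[OF W vf this] obtain i2 k2 l2 where g2: "i2 \<noteq> 0" "\<bar>of_int i2 * \<omega> + of_int k2\<bar> < \<bar>\<beta>1\<bar> / \<bar>of_int i1\<bar>" "act i2 k2 l2 ` W = W"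
    by metis
  define d where "d = i2 * k1 - i1 * k2"
  have "d \<noteq> 0"
  proof
    assume "d = 0"
    then have "real_of_int (i1 * k2) = real_of_int (i2 * k1)" unfolding d_def by simp
    then have "real_of_int i1 * of_int k2 = of_int i2 * of_int k1" by simp
    then have "of_int i1 * (of_int i2 * \<omega> + of_int k2) = of_int i2 * \<beta>1"
      unfolding \<beta>1_def by (simp add: algebra_simps)
    then have eq: "\<bar>of_int i1\<bar> * \<bar>of_int i2 * \<omega> + of_int k2\<bar> = \<bar>of_int i2\<bar> * \<bar>\<beta>1\<bar>"
      unfolding abs_mult[symmetric] by (rule arg_cong[where f = abs])
    have "\<bar>of_int i1\<bar> * \<bar>of_int i2 * \<omega> + of_int k2\<bar> < \<bar>\<beta>1\<bar>"
      using g2(2) g1(1) by (simp add: field_simps)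
    moreover have "1 * \<bar>\<beta>1\<bar> \<le> \<bar>real_of_int i2\<bar> * \<bar>\<beta>1\<bar>" using g2(1) by (intro mult_right_mono) auto
    ultimately show False using eq by simp
  qed
  define r0 where "r0 = i2 * l1 + (- i1) * l2"
  define l0 where "l0 = k2 * l1 + (- k1) * l2"
  have q0: "act 0 d r0 ` W = W"
    using stabiliser_add[OF stabiliser_mult[OF g1(2), of i2] stabiliser_mult[OF g2(3), of "- i1"]]
    by (simp add: d_def r0_def mult.commute)
  have "k2 * i1 + - k1 * i2 = - d" "k2 * k1 + - k1 * k2 = 0" by (simp_all add: d_def)
  then have p0: "act (- d) 0 l0 ` W = W"
    using stabiliser_add[OF stabiliser_mult[OF g1(2), of k2] stabiliser_mult[OF g2(3), of "- k1"]]
    by (simp add: l0_def)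
  show thesis
  proof (cases "d > 0")
    case True
    show thesis
      by (rule that[of d d r0 "- l0"]) (use True q0 stabiliser_minus[OF p0] in simp_all)
  next
    case False
    show thesis
      by (rule that[of "- d" "- d" "- r0" l0]) (use False \<open>d \<noteq> 0\<close> p0 stabiliser_minus[OF q0] in simp_all)
  qed
qed

lemma component_dichotomy:
  "(\<exists>W\<in>components (- M). \<exists>l. l \<noteq> 0 \<and> act 0 0 l ` W = W) \<or> (\<exists>P V. tube P V)"
proof (cases "\<exists>W\<in>components (- M). \<exists>l. l \<noteq> 0 \<and> act 0 0 l ` W = W")
  case False
  have "components (- M) \<noteq> {}" using M_proper by auto
  then obtain W where W: "W \<in> components (- M)" by blast
  then have vf: "\<forall>l. l \<noteq> 0 \<longrightarrow> act 0 0 l ` W \<noteq> W" using False by blast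
  obtain p q l' r where pq: "p > 0" "q > 0" "act 0 q r ` W = W" "act p 0 l' ` W = W"
    using component_periodic[OF W vf] .
  have free: "act 0 0 l ` W \<inter> W = {}" if "l \<noteq> 0" for l
    using vf that act_component_cases[OF W, of 0 0 l] by blast
  interpret periodic_component \<omega> \<phi> M W p q l' r
    by unfold_locales (fact W pq free)+
  show ?thesis using tube_gap by blast
qed simp

end

section \<open>From the torus to the universal cover\<close>

abbreviation circ :: "real \<Rightarrow> complex" where "circ t \<equiv> cis (2 * pi * t)"

lemma cis_eq_iff_int: "circ a = circ b \<longleftrightarrow> (\<exists>k::int. b = a + of_int k)"
proof
  assume "circ a = circ b"
  then have "exp (\<i> * of_real (2 * pi * b)) = exp (\<i> * of_real (2 * pi * a))" by (simp add: cis_conv_exp)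
  then obtain n :: int where n: "\<i> * of_real (2 * pi * b) = \<i> * of_real (2 * pi * a) + of_real (of_int (2 * n) * pi) * \<i>"
    unfolding exp_eq by blast
  have "Im (\<i> * of_real (2 * pi * b)) = Im (\<i> * of_real (2 * pi * a) + of_real (of_int (2 * n) * pi) * \<i>)"
    by (rule arg_cong[OF n])
  then have "pi * b = pi * (a + of_int n)" by (simp add: algebra_simps)
  then show "\<exists>k::int. b = a + of_int k" by (auto simp: mult_left_cancel)
next
  assume "\<exists>k::int. b = a + of_int k"
  then obtain k :: int where b: "b = a + of_int k" by blast
  have "circ b = circ a * cis (2 * pi * of_int k)"
    by (simp add: b cis_mult algebra_simps)
  also have "cis (2 * pi * of_int k) = 1" by (rule cis_multiple_2pi) simp
  finally show "circ a = circ b" by simp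
qed

lemma circle_cis: "z \<in> circle \<longleftrightarrow> (\<exists>t. z = circ t)"
proof
  assume "z \<in> circle"
  then have "norm z = 1" by (simp add: circle_def)
  moreover from this have "z \<noteq> 0" by auto
  ultimately have "z = cis (Arg z)" using cis_Arg[of z] by (simp add: sgn_div_norm)
  then have "z = circ (Arg z / (2 * pi))" by simp
  then show "\<exists>t. z = circ t" by blast
qed (auto simp: circle_def)

lemma tproj_eq_iff: "tproj z = tproj w \<longleftrightarrow> (\<exists>k l. w = (fst z + of_int k, snd z + of_int l))"
  by (cases z, cases w) (auto simp: tproj_def cis_eq_iff_int)

lemma torus_tproj: "w \<in> torus \<longleftrightarrow> (\<exists>z. w = tproj z)"
  by (cases w) (auto simp: torus_def tproj_def circle_cis)

lemma tproj_in_torus [simp]: "tproj z \<in> torus"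
  using torus_tproj by blast

lemma continuous_on_tproj [continuous_intros]: "continuous_on S tproj"
  unfolding tproj_def case_prod_unfold cis_conv_exp by (intro continuous_intros)

text \<open>The image is already that of the compact part of \<open>A\<close> over the window.
  Invariance is asked in the fibre direction only, because the clopen pieces are not periodic in the
  base.\<close>

lemma closed_tproj_image:
  assumes "closed A" and inv: "\<And>\<theta> x l. (\<theta>, x) \<in> A \<Longrightarrow> (\<theta>, x + of_int l) \<in> A"
    and win: "\<And>z. z \<in> A \<Longrightarrow> \<exists>w\<in>A. tproj w = tproj z \<and> fst w \<in> {a..b}"
  shows "closed (tproj ` A)"
proof -
  have "tproj ` A = tproj ` (A \<inter> ({a..b} \<times> {0..1}))"
  proof (intro equalityI subsetI)
    fix y assume "y \<in> tproj ` A"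
    then obtain w where w: "w \<in> A" "tproj w = y" "fst w \<in> {a..b}" using win by force
    define v where "v = (fst w, snd w + of_int (- \<lfloor>snd w\<rfloor>))"
    have "v \<in> A" unfolding v_def by (rule inv) (use w in simp)
    moreover have "snd v \<in> {0..1}" unfolding v_def by simp linarith
    moreover have "tproj v = tproj w" unfolding tproj_eq_iff v_def
      by (rule exI[of _ 0], rule exI[of _ "\<lfloor>snd w\<rfloor>"]) (simp add: prod_eq_iff)
    ultimately show "y \<in> tproj ` (A \<inter> ({a..b} \<times> {0..1}))"
      using w by (intro image_eqI[of _ _ v]) (auto simp: v_def)
  qed auto
  moreover have "compact (tproj ` (A \<inter> ({a..b} \<times> {0..1})))"
    by (intro compact_continuous_image continuous_on_tproj closed_Int_compact assms compact_Times compact_Icc)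
  ultimately show ?thesis using compact_imp_closed by metis
qed

lemma closed_tproj_invariant_image:
  assumes "closed A" and inv: "\<And>\<theta> x k l. (\<theta>, x) \<in> A \<Longrightarrow> (\<theta> + of_int k, x + of_int l) \<in> A"
  shows "closed (tproj ` A)"
proof (rule closed_tproj_image[where a = 0 and b = 1, OF assms(1)])
  show "(\<theta>, x + of_int l) \<in> A" if "(\<theta>, x) \<in> A" for \<theta> x l
    using inv[OF that, of 0 l] by simp
  show "\<exists>w\<in>A. tproj w = tproj z \<and> fst w \<in> {0..1}" if "z \<in> A" for z
  proof (intro bexI conjI)
    show "(fst z + of_int (- \<lfloor>fst z\<rfloor>), snd z + of_int 0) \<in> A"
      by (rule inv) (use that in simp)
    show "tproj (fst z + of_int (- \<lfloor>fst z\<rfloor>), snd z + of_int 0) = tproj z" unfolding tproj_eq_iff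
      by (rule exI[of _ "\<lfloor>fst z\<rfloor>"], rule exI[of _ 0]) (simp add: prod_eq_iff)
    show "fst (fst z + of_int (- \<lfloor>fst z\<rfloor>), snd z + of_int 0) \<in> {0..1}" by simp linarith
  qed
qed

section \<open>Integer iterates of the lifted map\<close>

locale forced_circle_lift =
  fixes \<omega> :: real and f Df :: "real \<times> real \<Rightarrow> real"
  assumes irrational: "\<omega> \<notin> \<rat>" and f_cont: "continuous_on UNIV f"
    and f_base: "\<And>\<theta> x. f (\<theta> + 1, x) = f (\<theta>, x)"
    and f_deg: "\<And>\<theta> x. f (\<theta>, x + 1) = f (\<theta>, x) + 1"
    and f_deriv: "\<And>\<theta> x. ((\<lambda>y. f (\<theta>, y)) has_real_derivative Df (\<theta>, x)) (at x)"
    and Df_pos: "\<And>\<theta> x. Df (\<theta>, x) > 0"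
begin

definition F :: "real \<times> real \<Rightarrow> real \<times> real" where "F z = (fst z + \<omega>, f z)"

lemma f_mono: "x < y \<Longrightarrow> f (\<theta>, x) < f (\<theta>, y)"
  using DERIV_pos_imp_increasing[of x y "\<lambda>y. f (\<theta>, y)"] f_deriv Df_pos by blast

lemma f_deg_int: "f (\<theta>, x + of_int l) = f (\<theta>, x) + of_int l"
  using add_int_of_add_1[of "\<lambda>x. f (\<theta>, x)" 1] f_deg by simp

lemma F_surj: "\<exists>z. F z = w"
proof -
  define \<theta> where "\<theta> = fst w - \<omega>"
  define l where "l = \<lfloor>snd w - f (\<theta>, 0)\<rfloor>"
  have "f (\<theta>, of_int l) \<le> snd w" "snd w \<le> f (\<theta>, of_int l + 1)"
    using f_deg_int[of \<theta> 0 l] f_deg[of \<theta> "of_int l"] unfolding l_def by (simp_all, linarith+)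
  moreover have "continuous_on {of_int l..of_int l + 1} (\<lambda>x. f (\<theta>, x))"
    by (rule continuous_on_compose2[OF f_cont]) (auto intro!: continuous_intros)
  ultimately obtain x where "f (\<theta>, x) = snd w"
    using IVT'[of "\<lambda>x. f (\<theta>, x)" "of_int l" "snd w" "of_int l + 1"] by auto
  then have "F (\<theta>, x) = w" by (simp add: F_def \<theta>_def prod_eq_iff)
  then show ?thesis by blast
qed

lemma F_inj: "F z = F w \<Longrightarrow> z = w"
  using f_mono[of "snd z" "snd w" "fst z"] f_mono[of "snd w" "snd z" "fst z"]
  by (cases z, cases w) (auto simp: F_def intro: linorder_cases)

lemma bij_F: "bij F"
  using F_inj F_surj by (metis bijI' )

lemma f_base_int: "f (\<theta> + of_int k, x) = f (\<theta>, x)"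
  using add_int_of_add_1[of "\<lambda>\<theta>. f (\<theta>, x)" 0] f_base by simp

lemma F_translate: "F (fst z + of_int k, snd z + of_int l) = (fst (F z) + of_int k, snd (F z) + of_int l)"
  unfolding F_def by (simp only: fst_conv snd_conv f_base_int f_deg_int prod.collapse) (simp only: add.commute add.left_commute)

lemma continuous_F: "continuous_on UNIV F"
  unfolding F_def by (intro continuous_intros f_cont)

lemma continuous_inv_F: "continuous_on UNIV (inv F)"
proof -
  have "continuous_on (F ` UNIV) (inv F)"
    by (rule continuous_on_inverse_open[OF open_UNIV continuous_F]) (auto simp: bij_F bij_is_inj)
  then show ?thesis using bij_F by (simp add: bij_is_surj)
qed

lemma F_inv_F [simp]: "F (inv F z) = z" "inv F (F z) = z"
  using bij_F by (simp_all add: bij_is_surj surj_f_inv_f bij_is_inj)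

definition iter :: "int \<Rightarrow> real \<times> real \<Rightarrow> real \<times> real" where
  "iter i = (if i \<ge> 0 then F ^^ nat i else inv F ^^ nat (- i))"

lemma iter_0 [simp]: "iter 0 z = z" by (simp add: iter_def)

lemma iter_nat: "iter (int n) = F ^^ n" by (simp add: iter_def)

lemma iter_Suc: "iter (i + 1) z = F (iter i z)"
proof (cases "i \<ge> 0")
  case True
  then have "nat (i + 1) = Suc (nat i)" by simp
  then show ?thesis using True by (simp add: iter_def)
next
  case False
  then have "nat (- i) = Suc (nat (- (i + 1)))" by simp
  then have "iter i z = inv F (iter (i + 1) z)" using False
    by (cases "i = - 1") (simp_all add: iter_def)
  then show ?thesis by simp
qed

lemma iter_pred: "iter (i - 1) z = inv F (iter i z)"
  using iter_Suc[of "i - 1" z] by simp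

lemma iter_add: "iter (i + j) z = iter i (iter j z)"
proof (induction i rule: int_induct[where k = 0])
  case (step1 i)
  have "iter (i + 1 + j) z = F (iter (i + j) z)" using iter_Suc[of "i + j" z] by (simp add: algebra_simps)
  then show ?case using step1 by (simp add: iter_Suc)
next
  case (step2 i)
  have "iter (i - 1 + j) z = inv F (iter (i + j) z)" using iter_pred[of "i + j" z] by (simp add: algebra_simps)
  then show ?case using step2 by (simp add: iter_pred)
qed simp

lemma fst_F: "fst (F z) = fst z + \<omega>" by (simp add: F_def)

lemma fst_iter: "fst (iter i z) = fst z + of_int i * \<omega>"
proof (induction i rule: int_induct[where k = 0])
  case (step1 i) then show ?case unfolding iter_Suc fst_F by (simp add: algebra_simps)
next
  case (step2 i) then show ?case using fst_F[of "inv F (iter i z)"] by (simp add: iter_pred algebra_simps)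
qed simp

lemma inv_F_translate: "inv F (fst z + of_int k, snd z + of_int l) = (fst (inv F z) + of_int k, snd (inv F z) + of_int l)"
  using F_translate[of "inv F z" k l] by (metis F_inv_F)

lemma iter_translate: "iter i (fst z + of_int k, snd z + of_int l) = (fst (iter i z) + of_int k, snd (iter i z) + of_int l)"
proof (induction i rule: int_induct[where k = 0])
  case (step1 i) then show ?case by (simp add: iter_Suc F_translate)
next
  case (step2 i) then show ?case by (simp add: iter_pred inv_F_translate)
qed simp

lemma continuous_iter: "continuous_on UNIV (iter i)"
proof (induction i rule: int_induct[where k = 0])
  case base
  have "iter 0 = (\<lambda>z. z)" by auto
  then show ?case by simp
next
  case (step1 i)
  have "iter (i + 1) = (\<lambda>z. F (iter i z))" by (auto simp: iter_Suc)
  then show ?case using continuous_on_compose2[OF continuous_F step1(2)] by simp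
next
  case (step2 i)
  have "iter (i - 1) = (\<lambda>z. inv F (iter i z))" by (auto simp: iter_pred)
  then show ?case using continuous_on_compose2[OF continuous_inv_F step2(2)] by simp
qed

lemma F_mono: "fst z = fst w \<Longrightarrow> snd z < snd w \<Longrightarrow> snd (F z) < snd (F w)"
  by (cases z, cases w) (simp add: F_def f_mono)

lemma inv_F_mono:
  assumes "fst z = fst w" "snd z < snd w"
  shows "snd (inv F z) < snd (inv F w)"
proof (rule ccontr)
  have f: "fst (inv F z) = fst (inv F w)"
    using fst_F[of "inv F z"] fst_F[of "inv F w"] assms(1) by simp
  assume "\<not> snd (inv F z) < snd (inv F w)"
  then consider "snd (inv F w) < snd (inv F z)" | "inv F z = inv F w" using f by (metis linorder_less_linear prod_eqI)
  then show False
  proof cases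
    case 1
    then show False using F_mono[OF f[symmetric] 1] assms(2) by simp
  next
    case 2
    then have "z = w" by (metis F_inv_F(1))
    then show False using assms(2) by simp
  qed
qed

lemma iter_mono: "fst z = fst w \<Longrightarrow> snd z < snd w \<Longrightarrow> snd (iter i z) < snd (iter i w)"
proof (induction i rule: int_induct[where k = 0])
  case (step1 i)
  then show ?case unfolding iter_Suc by (intro F_mono) (simp_all add: fst_iter)
next
  case (step2 i)
  then show ?case unfolding iter_pred by (intro inv_F_mono) (simp_all add: fst_iter)
qed simp

definition \<phi> :: "int \<Rightarrow> real \<Rightarrow> real \<Rightarrow> real" where "\<phi> i \<theta> x = snd (iter i (\<theta>, x))"

lemma iter_\<phi>: "iter i (\<theta>, x) = (\<theta> + of_int i * \<omega>, \<phi> i \<theta> x)"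
  by (simp add: \<phi>_def prod_eq_iff fst_iter)

lemma \<phi>_1: "\<phi> 1 \<theta> x = f (\<theta>, x)"
  using iter_Suc[of 0 "(\<theta>, x)"] by (simp add: \<phi>_def F_def)

sublocale skew_lift \<omega> \<phi>
proof unfold_locales
  show "\<omega> \<notin> \<rat>" by (rule irrational)
  show "\<phi> 0 \<theta> x = x" for \<theta> x by (simp add: \<phi>_def)
  show "\<phi> (i + j) \<theta> x = \<phi> i (\<theta> + of_int j * \<omega>) (\<phi> j \<theta> x)" for i j \<theta> x
  proof -
    have "\<phi> (i + j) \<theta> x = snd (iter i (iter j (\<theta>, x)))" by (simp only: \<phi>_def iter_add)
    then show ?thesis unfolding iter_\<phi> snd_conv .
  qed
  show "continuous_on UNIV (\<lambda>z. \<phi> i (fst z) (snd z))" for i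
    unfolding \<phi>_def by (simp add: continuous_on_snd continuous_iter)
  show "\<phi> i \<theta> x < \<phi> i \<theta> y" if "x < y" for i \<theta> x y
    unfolding \<phi>_def using iter_mono[of "(\<theta>, x)" "(\<theta>, y)"] that by simp
  show "\<phi> i (\<theta> + 1) x = \<phi> i \<theta> x" for i \<theta> x
    using iter_translate[of i "(\<theta>, x)" 1 0] by (simp add: \<phi>_def)
  show "\<phi> i \<theta> (x + 1) = \<phi> i \<theta> x + 1" for i \<theta> x
    using iter_translate[of i "(\<theta>, x)" 0 1] by (simp add: \<phi>_def)
qed

lemma act_iter: "act i k l z = (fst (iter i z) + of_int k, snd (iter i z) + of_int l)"
  by (simp add: act_def \<phi>_def fst_iter)

lemma tproj_act: "tproj (act i k l z) = tproj (iter i z)"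
proof -
  have "tproj (iter i z) = tproj (act i k l z)" unfolding tproj_eq_iff act_iter by blast
  then show ?thesis by simp
qed

text \<open>The choice in \<open>skew_map\<close> ranges over all lifts of the point. They differ by
  unit translations, with which \<open>F\<close> commutes, so all lead to the same image.\<close>

lemma skew_map_tproj: "skew_map \<omega> f (tproj z) = tproj (F z)"
proof -
  have "\<exists>\<theta> x. tproj z = tproj (\<theta>, x) \<and> tproj (F z) = tproj (\<theta> + \<omega>, f (\<theta>, x))"
    by (rule exI[of _ "fst z"], rule exI[of _ "snd z"]) (simp add: F_def)
  then have "\<exists>\<theta> x. tproj z = tproj (\<theta>, x) \<and> skew_map \<omega> f (tproj z) = tproj (\<theta> + \<omega>, f (\<theta>, x))"
    unfolding skew_map_def
    by (rule someI[of "\<lambda>w. \<exists>\<theta> x. tproj z = tproj (\<theta>, x) \<and> w = tproj (\<theta> + \<omega>, f (\<theta>, x))" "tproj (F z)"])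
  then obtain w where w: "tproj z = tproj w" "skew_map \<omega> f (tproj z) = tproj (F w)"
    unfolding F_def by (metis fst_conv)
  then obtain k l where "w = (fst z + of_int k, snd z + of_int l)" unfolding tproj_eq_iff by blast
  then have "F w = (fst (F z) + of_int k, snd (F z) + of_int l)" by (simp add: F_translate)
  then have "tproj (F z) = tproj (F w)" unfolding tproj_eq_iff by blast
  then show ?thesis using w(2) by simp
qed

lemma skew_map_funpow_tproj: "(skew_map \<omega> f ^^ n) (tproj z) = tproj (iter (int n) z)"
  unfolding iter_nat by (induction n) (simp_all add: skew_map_tproj)

lemma skew_map_funpow_image: "(skew_map \<omega> f ^^ n) ` tproj ` A = tproj ` act (int n) 0 0 ` A"
  by (simp add: image_image skew_map_funpow_tproj tproj_act)

lemma tproj_eq_act: "tproj z = tproj w \<longleftrightarrow> (\<exists>k l. w = act 0 k l z)"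
  unfolding tproj_eq_iff act_translate ..

end

text \<open>Each member is also relatively closed, as the others have an open union, so no connected
  subset of \<open>S\<close> containing it is larger.\<close>

lemma components_eq_disjoint_openin:
  assumes un: "\<Union>\<A> = S" and disj: "\<And>A B. A \<in> \<A> \<Longrightarrow> B \<in> \<A> \<Longrightarrow> A = B \<or> A \<inter> B = {}"
    and op: "\<And>A. A \<in> \<A> \<Longrightarrow> openin (top_of_set S) A"
    and con: "\<And>A. A \<in> \<A> \<Longrightarrow> connected A" and ne: "{} \<notin> \<A>"
  shows "components S = \<A>"
proof -
  have sub: "\<A> \<subseteq> components S"
  proof
    fix A assume A: "A \<in> \<A>"
    have clopen: "openin (top_of_set S) (S - A)"
    proof -
      have "S - A = \<Union>(\<A> - {A})" using un disj[OF A] A by blast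
      moreover have "openin (top_of_set S) (\<Union>(\<A> - {A}))" using op by (intro openin_Union) auto
      ultimately show ?thesis by simp
    qed
    show "A \<in> components S"
      unfolding in_components_maximal
    proof (intro conjI allI impI)
      show "A \<noteq> {}" "A \<subseteq> S" "connected A" using A ne un con by auto
      fix C assume C: "C \<noteq> {} \<and> A \<subseteq> C \<and> C \<subseteq> S \<and> connected C"
      obtain T where T: "open T" "A = S \<inter> T" using op[OF A] openin_open by metis
      obtain T' where T': "open T'" "S - A = S \<inter> T'" using clopen openin_open by metis
      have "T \<inter> C = {} \<or> T' \<inter> C = {}"
      proof (rule connectedD[OF _ T(1) T'(1)])
        show "connected C" using C by blast
        show "T \<inter> T' \<inter> C = {}" "C \<subseteq> T \<union> T'" using C T(2) T'(2) by blast+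
      qed
      moreover have "T \<inter> C \<noteq> {}" using C T(2) \<open>A \<noteq> {}\<close> by blast
      ultimately have "C \<inter> (S - A) = {}" using T'(2) by blast
      then show "C = A" using C by blast
    qed
  qed
  moreover have "components S \<subseteq> \<A>"
  proof
    fix C assume C: "C \<in> components S"
    then obtain x where "x \<in> C" "x \<in> S" using in_components_nonempty in_components_subset by blast
    then obtain A where A: "A \<in> \<A>" "x \<in> A" using un by blast
    then have "A = C" using components_eq[OF C, of A] sub \<open>x \<in> C\<close> by blast
    then show "C \<in> \<A>" using A by simp
  qed
  ultimately show ?thesis by blast
qed

text \<open>Serves to show that the number of arcs of a tube is the same in all fibres, since their
  coincidences are.\<close>

lemma card_range_eq:
  assumes "\<And>x y. f x = f y \<longleftrightarrow> g x = g y"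
  shows "card (range f) = card (range g)"
proof (rule bij_betw_same_card)
  show "bij_betw (\<lambda>y. g (SOME x. f x = y)) (range f) (range g)"
  proof -
    have "g (SOME x. f x = f a) = g a" for a
      using someI[of "\<lambda>x. f x = f a" a] assms by blast
    then show ?thesis unfolding bij_betw_def inj_on_def using assms by (auto simp: image_iff)
  qed
qed

section \<open>The minimal set on the torus and its lift\<close>

locale torus_minimal = forced_circle_lift +
  fixes Mt :: "(complex \<times> complex) set"
  assumes minimal: "minimal_set (skew_map \<omega> f) Mt" and not_torus: "Mt \<noteq> torus"
    and variation: "set_nn_integral lborel {0..1} (\<lambda>\<theta>. total_variation (\<lambda>x. ln (Df (\<theta>, x))) 0 1) < \<infinity>"
    and Df_base: "\<And>\<theta> x. Df (\<theta> + 1, x) = Df (\<theta>, x)" and Df_fibre: "\<And>\<theta> x. Df (\<theta>, x + 1) = Df (\<theta>, x)"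
begin

definition M :: "(real \<times> real) set" where "M = tproj -` Mt"

lemma Mt: "Mt \<noteq> {}" "Mt \<subseteq> torus" "closed Mt" "skew_map \<omega> f ` Mt = Mt"
  "\<And>A. A \<subseteq> Mt \<Longrightarrow> A \<noteq> {} \<Longrightarrow> closed A \<Longrightarrow> skew_map \<omega> f ` A = A \<Longrightarrow> A = Mt"
  using minimal unfolding minimal_set_def by blast+

lemma tproj_M: "tproj ` M = Mt"
  unfolding M_def using Mt(2) torus_tproj by (force simp: image_iff)

lemma F_in_M_iff: "F z \<in> M \<longleftrightarrow> z \<in> M"
proof
  assume "z \<in> M"
  then have "skew_map \<omega> f (tproj z) \<in> skew_map \<omega> f ` Mt" by (simp add: M_def)
  then show "F z \<in> M" using Mt(4) by (simp add: M_def skew_map_tproj)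
next
  assume "F z \<in> M"
  then have "tproj (F z) \<in> skew_map \<omega> f ` Mt" using Mt(4) by (simp add: M_def)
  then obtain m where m: "m \<in> Mt" "tproj (F z) = skew_map \<omega> f m" by blast
  then obtain w where w: "w \<in> M" "m = tproj w" using tproj_M by blast
  then have "tproj (F z) = tproj (F w)" using m by (simp add: skew_map_tproj)
  then obtain k l where "F w = (fst (F z) + of_int k, snd (F z) + of_int l)" unfolding tproj_eq_iff by blast
  then have "F w = F (fst z + of_int k, snd z + of_int l)" by (simp only: F_translate)
  then have "w = (fst z + of_int k, snd z + of_int l)" by (rule F_inj)
  then have "tproj z = tproj w" unfolding tproj_eq_iff by blast
  then show "z \<in> M" using w m by (simp add: M_def)
qed

lemma iter_in_M_iff: "iter i z \<in> M \<longleftrightarrow> z \<in> M"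
proof (induction i rule: int_induct[where k = 0])
  case (step1 i) then show ?case by (simp add: iter_Suc F_in_M_iff)
next
  case (step2 i) then show ?case using F_in_M_iff[of "iter (i - 1) z"] by (simp add: iter_pred)
qed simp

lemma act_in_M: "z \<in> M \<Longrightarrow> act i k l z \<in> M"
  using iter_in_M_iff[of i z] by (simp add: M_def tproj_act)

text \<open>A closed subset of \<open>M\<close> invariant under the group projects to a closed
  invariant subset of \<open>Mt\<close>, and by periodicity it is recovered from its
  projection.\<close>

sublocale minimal_lift \<omega> \<phi> M
proof unfold_locales
  show "closed M" unfolding M_def
    by (rule closed_vimage[OF Mt(3) continuous_on_tproj])
  show "M \<noteq> {}" using tproj_M Mt(1) by auto
  show "M \<noteq> UNIV"
  proof
    assume "M = UNIV"
    then have "torus \<subseteq> Mt" using tproj_M torus_tproj by force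
    then show False using Mt(2) not_torus by simp
  qed
  show "act i k l z \<in> M" if "z \<in> M" for i k l z by (rule act_in_M[OF that])
  fix A assume A: "closed A" "A \<subseteq> M" "A \<noteq> {}" "\<And>i k l z. z \<in> A \<Longrightarrow> act i k l z \<in> A"
  have "tproj ` A = Mt"
  proof (rule Mt(5))
    show "tproj ` A \<subseteq> Mt" using A(2) tproj_M by blast
    show "tproj ` A \<noteq> {}" using A(3) by simp
    show "closed (tproj ` A)"
    proof (rule closed_tproj_invariant_image[OF A(1)])
      show "(\<theta> + of_int k, x + of_int l) \<in> A" if "(\<theta>, x) \<in> A" for \<theta> x k l
        using A(4)[OF that, of 0 k l] by (simp add: act_translate)
    qed
    have "act 1 0 0 ` A = A"
    proof
      show "act 1 0 0 ` A \<subseteq> A" using A(4) by blast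
      show "A \<subseteq> act 1 0 0 ` A"
      proof
        fix z assume "z \<in> A"
        then have "act 1 0 0 (act (- 1) 0 0 z) \<in> act 1 0 0 ` A" using A(4) by blast
        then show "z \<in> act 1 0 0 ` A" by simp
      qed
    qed
    then show "skew_map \<omega> f ` tproj ` A = tproj ` A"
      using skew_map_funpow_image[of 1 A] by simp
  qed
  then have "M \<subseteq> A"
  proof -
    assume e: "tproj ` A = Mt"
    show "M \<subseteq> A"
    proof
      fix z assume "z \<in> M"
      then have "tproj z \<in> tproj ` A" using e by (simp add: M_def)
      then obtain a where a: "a \<in> A" "tproj a = tproj z" by force
      then obtain k l where "z = act 0 k l a" unfolding tproj_eq_act by blast
      then show "z \<in> A" using A(4)[OF a(1)] by simp
    qed
  qed
  then show "A = M" using A(2) by blast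
qed

sublocale bv_minimal_lift \<omega> \<phi> M "\<lambda>\<theta> x. ln (Df (\<theta>, x))"
proof unfold_locales
  show "\<exists>\<xi>\<in>{x..y}. ln ((\<phi> 1 \<theta> y - \<phi> 1 \<theta> x) / (y - x)) = ln (Df (\<theta>, \<xi>))" if xy: "x < y" for \<theta> x y
  proof -
    obtain \<xi> where \<xi>: "x < \<xi>" "\<xi> < y" "f (\<theta>, y) - f (\<theta>, x) = (y - x) * Df (\<theta>, \<xi>)"
      using MVT2[OF xy, of "\<lambda>y. f (\<theta>, y)" "\<lambda>\<xi>. Df (\<theta>, \<xi>)"] f_deriv by blast
    then show ?thesis using xy by (intro bexI[of _ \<xi>]) (auto simp: \<phi>_1)
  qed
qed (simp_all only: variation Df_base Df_fibre)

text \<open>A thin clopen piece \<open>D\<close> around a lift of \<open>z0\<close>, and the rest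
  \<open>E\<close> of \<open>M\<close> over one turn of the base, project to disjoint closed sets
  covering \<open>Mt\<close>. The component must stay in the projection of \<open>D\<close>, which
  is as thin as desired.\<close>

lemma connected_component_fst:
  assumes W: "W \<in> components (- M)" "l \<noteq> 0" "act 0 0 l ` W = W"
    and z0: "z0 \<in> Mt" and w0: "w0 \<in> connected_component_set Mt z0"
  shows "fst w0 = fst z0"
proof -
  obtain z where z: "z \<in> M" "z0 = tproj z" using z0 tproj_M by blast
  define C where "C = connected_component_set Mt z0"
  have C: "connected C" "C \<subseteq> Mt" "z0 \<in> C" "w0 \<in> C"
    using z0 w0 by (auto simp: C_def connected_component_subset)
  have cont: "continuous_on UNIV (\<lambda>t. circ t)"
    unfolding cis_conv_exp by (intro continuous_intros)
  have "dist (fst w0) (fst z0) < e" if "e > 0" for e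
  proof -
    obtain d where d: "d > 0" "\<And>t. dist t (fst z) < d \<Longrightarrow> dist (circ t) (circ (fst z)) < e"
      using cont \<open>e > 0\<close> unfolding continuous_on_iff by (metis UNIV_I)
    \<comment> \<open>With 1 / 4 for \<open>D\<close> and 1 / 2 for \<open>E\<close>, points
      identified on the torus differ in the base by an integer of absolute value less than
      1.\<close>
    define d' where "d' = min d (1 / 4)"
    have d': "d' > 0" "d' \<le> d" "d' \<le> 1 / 4" using d(1) by (auto simp: d'_def)
    obtain D where D: "D \<subseteq> M" "closed D" "closed (M - D)" "\<And>w l. w \<in> D \<Longrightarrow> act 0 0 l w \<in> D" "z \<in> D"
      "\<And>w. w \<in> D \<Longrightarrow> \<bar>fst w - fst z\<bar> < d'"
      using vertical_stabiliser_small_clopen[OF W z(1) d'(1)] by metis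
    define E where "E = (M - D) \<inter> fst -` {fst z - 1 / 2..fst z + 1 / 2}"
    have clE: "closed E" unfolding E_def
      by (intro closed_Int D(3) continuous_closed_vimage) (auto intro!: continuous_intros)
    have invD: "(\<theta>, x + of_int l) \<in> D" if "(\<theta>, x) \<in> D" for \<theta> x l
      using D(4)[OF that, of l] by (simp add: act_translate)
    have invE: "(\<theta>, x + of_int l) \<in> E" if tE: "(\<theta>, x) \<in> E" for \<theta> x l
    proof -
      have "(\<theta>, x + of_int l) \<notin> D" using invD[of \<theta> "x + of_int l" "- l"] tE by (auto simp: E_def)
      then show ?thesis using tE by (simp add: E_def)
    qed
    have "closed (tproj ` D)"
      by (rule closed_tproj_image[OF D(2) invD, where a = "fst z - 1" and b = "fst z + 1"])
        (use D(6) d' in \<open>force simp: abs_less_iff\<close>)+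
    moreover have "closed (tproj ` E)"
      by (rule closed_tproj_image[OF clE invE, where a = "fst z - 1" and b = "fst z + 1"])
        (force simp: E_def)+
    moreover have "tproj ` D \<inter> tproj ` E = {}"
    proof (rule ccontr)
      assume "tproj ` D \<inter> tproj ` E \<noteq> {}"
      then obtain u v where uv: "u \<in> D" "v \<in> E" "tproj u = tproj v" by blast
      then obtain k l where v: "v = act 0 k l u" unfolding tproj_eq_act by blast
      have "\<bar>fst u - fst z\<bar> < 1 / 4" using D(6)[OF uv(1)] d' by simp
      moreover have "fst z - 1 / 2 \<le> fst u + of_int k" "fst u + of_int k \<le> fst z + 1 / 2"
        using uv(2) v by (auto simp: E_def)
      ultimately have "\<bar>real_of_int k\<bar> < 1" by linarith
      then have "k = 0" by simp
      then have "v \<in> D" using v D(4)[OF uv(1)] by simp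
      then show False using uv(2) by (simp add: E_def)
    qed
    moreover have "C \<subseteq> tproj ` D \<union> tproj ` E"
    proof
      fix c assume "c \<in> C"
      then obtain v where v: "v \<in> M" "c = tproj v" using C(2) tproj_M by blast
      define k where "k = \<lfloor>fst z + 1 / 2 - fst v\<rfloor>"
      define u where "u = act 0 k 0 v"
      have "u \<in> M" using v(1) unfolding u_def by (rule act_in_M)
      moreover have "fst u \<in> {fst z - 1 / 2..fst z + 1 / 2}" unfolding u_def k_def by simp linarith
      moreover have "tproj u = c" unfolding u_def v(2) using tproj_eq_act by metis
      ultimately show "c \<in> tproj ` D \<union> tproj ` E" by (cases "u \<in> D") (auto simp: E_def)
    qed
    moreover have "tproj ` D \<inter> C \<noteq> {}" using D(5) C(3) z(2) by auto
    ultimately have "tproj ` E \<inter> C = {}"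
      using C(1) unfolding connected_closed by blast
    then obtain u where u: "u \<in> D" "w0 = tproj u" using C(4) \<open>C \<subseteq> tproj ` D \<union> tproj ` E\<close> by blast
    have "dist (fst u) (fst z) < d" using D(6)[OF u(1)] d' by (simp add: dist_real_def)
    then have "dist (circ (fst u)) (circ (fst z)) < e" by (rule d(2))
    then show ?thesis using u(2) z(2) by (simp add: tproj_def case_prod_unfold)
  qed
  then show ?thesis by (metis dist_pos_lt less_irrefl)
qed

end

section \<open>From the universal cover to the torus\<close>

context torus_minimal
begin

lemma tubeD:
  assumes "tube P V"
  shows "open V" "connected V" "\<exists>x. (\<theta>, x) \<in> V" "is_interval {x. (\<theta>, x) \<in> V}" "V \<inter> M = {}"
    "act i k l ` V = V \<or> act i k l ` V \<inter> V = {}"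
  using assms unfolding tube_def by simp_all

lemma tube_periods:
  assumes "tube P V"
  obtains a b where "P > 0" "act P 0 a ` V = V" "act 0 P b ` V = V"
  using assms unfolding tube_def by (elim conjE exE) (rule that)

lemma tproj_act_meet:
  assumes tb: "tube P V" and meet: "tproj ` act i 0 0 ` V \<inter> tproj ` act j 0 0 ` V \<noteq> {}"
  obtains k l where "act (j - i) k l ` V = V"
proof -
  obtain y where "y \<in> (\<lambda>z. tproj (act i 0 0 z)) ` V" and y: "y \<in> (\<lambda>z. tproj (act j 0 0 z)) ` V"
    using meet unfolding image_image by blast
  then obtain u where u: "u \<in> V" "y = tproj (act i 0 0 u)" by (elim imageE)
  obtain v where v: "v \<in> V" "y = tproj (act j 0 0 v)" using y by (elim imageE)
  have uv: "u \<in> V" "v \<in> V" "tproj (act i 0 0 u) = tproj (act j 0 0 v)" using u v by simp_all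
  obtain k l where kl: "act j 0 0 v = act 0 k l (act i 0 0 u)" using uv(3) unfolding tproj_eq_act by blast
  have "act (- i) (- k) (- l) (act j 0 0 v) = u" unfolding kl by simp
  then have "act (j - i) (- k) (- l) v = u" by simp
  then have "act (j - i) (- k) (- l) ` V \<inter> V \<noteq> {}" using uv(1,2) by blast
  then have "act (j - i) (- k) (- l) ` V = V" using tubeD(6)[OF tb] by blast
  then show thesis by (rule that)
qed

lemma tproj_act_eq:
  assumes "act i k l ` V = V"
  shows "tproj ` act i 0 0 ` V = tproj ` V"
proof -
  have "tproj ` act i 0 0 ` V = tproj ` act i k l ` V" by (simp add: image_image tproj_act)
  then show ?thesis using assms by simp
qed

text \<open>The points outside all translates of \<open>V\<close> form a closed periodic set, whose
  image is closed and is the complement of the image of \<open>V\<close> in the torus.\<close>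

lemma openin_tproj_tube:
  assumes "open V"
  shows "openin (top_of_set torus) (tproj ` V)"
proof -
  define A where "A = (\<Inter>k. \<Inter>l. - act 0 k l ` V)"
  have A: "z \<in> A \<longleftrightarrow> (\<forall>k l. z \<notin> act 0 k l ` V)" for z by (auto simp: A_def)
  have meets: "tproj z \<in> tproj ` V \<longleftrightarrow> z \<notin> A" for z
  proof
    assume "tproj z \<in> tproj ` V"
    then obtain v where "v \<in> V" "tproj v = tproj z" by force
    then obtain k l where "z = act 0 k l v" unfolding tproj_eq_act by blast
    then show "z \<notin> A" using \<open>v \<in> V\<close> unfolding A by blast
  next
    assume "z \<notin> A"
    then obtain k l v where "v \<in> V" "z = act 0 k l v" unfolding A by blast
    then have "tproj z = tproj v" unfolding \<open>z = _\<close> tproj_act by simp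
    then show "tproj z \<in> tproj ` V" using \<open>v \<in> V\<close> by simp
  qed
  have "closed A" unfolding A_def by (intro closed_INT ballI closed_Compl open_act assms)
  moreover have "(\<theta> + of_int k, x + of_int l) \<in> A" if "(\<theta>, x) \<in> A" for \<theta> x k l
  proof -
    have "tproj (\<theta> + of_int k, x + of_int l) = tproj (\<theta>, x)"
      by (rule sym) (auto simp: tproj_eq_iff)
    then show ?thesis using meets[of "(\<theta>, x)"] meets[of "(\<theta> + of_int k, x + of_int l)"] that by simp
  qed
  ultimately have "closed (tproj ` A)" by (rule closed_tproj_invariant_image)
  moreover have "tproj ` V = torus \<inter> - tproj ` A"
  proof (intro equalityI subsetI)
    fix y assume y: "y \<in> tproj ` V"
    have "y \<notin> tproj ` A"
    proof
      assume "y \<in> tproj ` A"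
      then obtain z where "z \<in> A" "y = tproj z" by blast
      then show False using meets[of z] y by simp
    qed
    then show "y \<in> torus \<inter> - tproj ` A" using y by auto
  next
    fix y assume y: "y \<in> torus \<inter> - tproj ` A"
    then obtain z where "y = tproj z" using torus_tproj by blast
    then show "y \<in> tproj ` V" using meets[of z] y by blast
  qed
  ultimately show ?thesis by (auto simp: openin_open)
qed

text \<open>The base point of angle \<open>t\<close> has the lifts t + k; each contributes one arc,
  and different \<open>k\<close> may give the same arc.\<close>

definition arc :: "(real \<times> real) set \<Rightarrow> real \<Rightarrow> int \<Rightarrow> complex set" where
  "arc V t k = circ ` {x. (t + of_int k, x) \<in> V}"

abbreviation tfibre :: "(real \<times> real) set \<Rightarrow> real \<Rightarrow> complex set" where
  "tfibre V t \<equiv> fibre (tproj ` V) (circ t)"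

lemma fibre_eq_arcs: "tfibre V t = \<Union> (range (arc V t))"
proof (intro equalityI subsetI)
  fix y assume "y \<in> tfibre V t"
  then obtain v where v: "v \<in> V" "circ t = circ (fst v)" "y = circ (snd v)"
    by (auto simp: fibre_def tproj_def)
  then obtain k :: int where "fst v = t + of_int k" unfolding cis_eq_iff_int by blast
  then have "(t + of_int k, snd v) = v" by (simp add: prod_eq_iff)
  then have "y \<in> arc V t k" unfolding arc_def using v by (intro image_eqI[of _ _ "snd v"]) simp_all
  then show "y \<in> \<Union> (range (arc V t))" by blast
next
  fix y assume "y \<in> \<Union> (range (arc V t))"
  then obtain k x where x: "(t + of_int k, x) \<in> V" "y = circ x" by (auto simp: arc_def)
  have "circ t = circ ((t + of_int k))" unfolding cis_eq_iff_int by blast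
  then have "(circ t, y) = tproj (t + of_int k, x)" using x by (simp add: tproj_def)
  then show "y \<in> tfibre V t" unfolding fibre_def using x(1) by auto
qed

lemma arc_meet:
  assumes tb: "tube P V" and meet: "arc V t k \<inter> arc V t k' \<noteq> {}"
  shows "\<exists>l. act 0 (k' - k) l ` V = V"
proof -
  obtain x y where xy: "(t + of_int k, x) \<in> V" "(t + of_int k', y) \<in> V" "circ x = circ y"
    using meet by (auto simp: arc_def)
  then obtain l :: int where l: "y = x + of_int l" unfolding cis_eq_iff_int by blast
  have "act 0 (k' - k) l (t + of_int k, x) = (t + of_int k', y)" by (simp add: act_translate l)
  then have "(t + of_int k', y) \<in> act 0 (k' - k) l ` V" using imageI[OF xy(1), of "act 0 (k' - k) l"] by simp
  then have "act 0 (k' - k) l ` V \<inter> V \<noteq> {}" using xy(2) by blast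
  then show ?thesis using tubeD(6)[OF tb, of 0 "k' - k" l] by blast
qed

lemma arc_eq:
  assumes "act 0 (k' - k) l ` V = V"
  shows "arc V t k = arc V t k'"
proof -
  have iff: "(t + of_int k, x) \<in> V \<longleftrightarrow> (t + of_int k', x + of_int l) \<in> V" for x
    using stabiliser_mem_iff[OF assms, of "(t + of_int k, x)"] by (simp add: act_translate)
  have c: "circ ((x + of_int l)) = circ x" for x
    by (rule sym) (auto simp: cis_eq_iff_int)
  show ?thesis
  proof (intro equalityI subsetI)
    fix y assume "y \<in> arc V t k"
    then obtain x where x: "(t + of_int k, x) \<in> V" "y = circ x" by (auto simp: arc_def)
    then show "y \<in> arc V t k'" unfolding arc_def using iff c by (intro image_eqI[of _ _ "x + of_int l"]) auto
  next
    fix y assume "y \<in> arc V t k'"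
    then obtain x where x: "(t + of_int k', x) \<in> V" "y = circ x" by (auto simp: arc_def)
    then show "y \<in> arc V t k" unfolding arc_def using iff[of "x - of_int l"] c[of "x - of_int l"]
      by (intro image_eqI[of _ _ "x - of_int l"]) auto
  qed
qed

lemma arc_nonempty:
  assumes "tube P V"
  shows "arc V t k \<noteq> {}"
  using tubeD(3)[OF assms] by (simp add: arc_def)

lemma arc_cases:
  assumes "tube P V"
  shows "arc V t k = arc V t k' \<or> arc V t k \<inter> arc V t k' = {}"
  using arc_meet[OF assms] arc_eq by blast

text \<open>The right-hand side does not involve \<open>t\<close>, so the coincidences between arcs
  are the same in all fibres.\<close>

lemma arc_eq_iff:
  assumes "tube P V"
  shows "arc V t k = arc V t k' \<longleftrightarrow> (\<exists>l. act 0 (k' - k) l ` V = V)"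
  using arc_meet[OF assms, of t k k'] arc_eq arc_nonempty[OF assms] by (metis inf.idem)

lemma connected_arc:
  assumes "tube P V"
  shows "connected (arc V t k)"
proof -
  have "connected {x. (t + of_int k, x) \<in> V}"
    by (rule is_interval_connected[OF tubeD(4)[OF assms]])
  then show ?thesis unfolding arc_def cis_conv_exp
    by (intro connected_continuous_image continuous_intros)
qed

lemma openin_arc:
  assumes tb: "tube P V"
  obtains T where "open T" "arc V t k = circle \<inter> T"
proof -
  define S where "S = {x. (t + of_int k, x) \<in> V}"
  have "S = Pair (t + of_int k) -` V" by (auto simp: S_def)
  moreover have "open (Pair (t + of_int k) -` V)"
    by (intro open_vimage tubeD(1)[OF tb] continuous_intros)
  ultimately have "open S" by simp
  define K where "K = {0..1} \<inter> - (\<Union>l::int. (\<lambda>x. x + of_int l) -` S)"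
  have "open ((\<lambda>x. x + real_of_int l) -` S)" for l
    by (intro open_vimage \<open>open S\<close> continuous_intros)
  then have "closed (- (\<Union>l::int. (\<lambda>x. x + of_int l) -` S))" by auto
  then have "compact K" unfolding K_def using compact_Int_closed by blast
  then have "compact (circ ` K)"
    unfolding cis_conv_exp by (intro compact_continuous_image continuous_intros)
  then have cl: "closed (circ ` K)" by (rule compact_imp_closed)
  have "arc V t k = circle \<inter> - circ ` K"
  proof (intro equalityI subsetI)
    fix y assume "y \<in> arc V t k"
    then obtain x where x: "x \<in> S" "y = circ x" by (auto simp: arc_def S_def)
    have "y \<notin> circ ` K"
    proof
      assume "y \<in> circ ` K"
      then obtain x' where x': "x' \<in> K" "circ x' = circ x" using x by force
      then obtain l :: int where "x = x' + of_int l" unfolding cis_eq_iff_int by blast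
      then show False using x' x(1) by (auto simp: K_def)
    qed
    then show "y \<in> circle \<inter> - circ ` K" using x circle_cis by blast
  next
    fix y assume y: "y \<in> circle \<inter> - circ ` K"
    then obtain x where x: "y = circ x" using circle_cis by blast
    define x' where "x' = x + of_int (- \<lfloor>x\<rfloor>)"
    have c: "y = circ x'" unfolding x x'_def cis_eq_iff_int by blast
    have "x' \<in> {0..1}" unfolding x'_def by simp linarith
    moreover have "x' \<notin> K" using y c by blast
    ultimately obtain l :: int where "x' + of_int l \<in> S" by (auto simp: K_def)
    moreover have "y = circ ((x' + of_int l))" unfolding c cis_eq_iff_int by blast
    ultimately show "y \<in> arc V t k" unfolding arc_def S_def by blast
  qed
  then show thesis by (rule that[OF open_Compl[OF cl]])
qed

lemma components_fibre_tube:
  assumes tb: "tube P V"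
  shows "components (tfibre V t) = range (arc V t)"
proof (rule components_eq_disjoint_openin)
  show "\<Union> (range (arc V t)) = tfibre V t" by (rule fibre_eq_arcs[symmetric])
  show "A = B \<or> A \<inter> B = {}" if "A \<in> range (arc V t)" "B \<in> range (arc V t)" for A B
    using that arc_cases[OF tb] by blast
  show "openin (top_of_set (tfibre V t)) A" if A: "A \<in> range (arc V t)" for A
  proof -
    obtain k where k: "A = arc V t k" using A by blast
    obtain T where T: "open T" "arc V t k = circle \<inter> T" using openin_arc[OF tb] by blast
    have "\<Union> (range (arc V t)) \<subseteq> circle" using circle_cis by (auto simp: arc_def)
    then have "A = \<Union> (range (arc V t)) \<inter> T" using T(2) k by blast
    then show ?thesis unfolding fibre_eq_arcs openin_open using T(1) by blast
  qed
  show "connected A" if "A \<in> range (arc V t)" for A using that connected_arc[OF tb] by blast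
  show "{} \<notin> range (arc V t)" using arc_nonempty[OF tb] by (metis imageE)
qed

text \<open>\<open>p\<close> is the first positive time at which the projection of \<open>V\<close>
  returns to itself; the images before it are disjoint because group images of \<open>V\<close> are
  equal or disjoint. \<open>q\<close> counts the distinct arcs over one base point, finitely many by
  the period \<open>P\<close>, and the points of \<open>M\<close> keep the fibres from being the
  whole circle.\<close>

lemma tube_has_pq_tube:
  assumes tb: "tube P V"
  shows "has_pq_tube (skew_map \<omega> f)"
proof -
  let ?S = "skew_map \<omega> f"
  define U where "U = tproj ` V"
  define R where "R p \<longleftrightarrow> p \<ge> 1 \<and> (\<exists>k l. act (int p) k l ` V = V)" for p :: nat
  obtain a b where ab: "P > 0" "act P 0 a ` V = V" "act 0 P b ` V = V" by (rule tube_periods[OF tb])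
  have "R (nat P)" unfolding R_def using ab by auto
  define p where "p = (LEAST p. R p)"
  have p: "R p" unfolding p_def by (rule LeastI[of R, OF \<open>R (nat P)\<close>])
  have least: "p \<le> j" if "R j" for j unfolding p_def using that by (rule Least_le)
  have Sp: "(?S ^^ n) ` U = tproj ` act (int n) 0 0 ` V" for n
    unfolding U_def by (rule skew_map_funpow_image)
  have disj: "(?S ^^ i) ` U \<inter> (?S ^^ j) ` U = {}" if ij: "i < j" "j < p" for i j
  proof (rule ccontr)
    assume "(?S ^^ i) ` U \<inter> (?S ^^ j) ` U \<noteq> {}"
    then obtain k l where "act (int j - int i) k l ` V = V" using tproj_act_meet[OF tb] unfolding Sp by metis
    then have "R (j - i)" unfolding R_def using ij by (auto simp: of_nat_diff)
    then show False using least ij by force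
  qed
  define q where "q = card (range (arc V 0))"
  have card_q: "card (range (arc V t)) = q" for t
    unfolding q_def by (rule card_range_eq) (simp add: arc_eq_iff[OF tb])
  have fin: "finite (range (arc V t))" for t
  proof (rule finite_subset)
    show "range (arc V t) \<subseteq> arc V t ` {0..<P}"
    proof
      fix A assume "A \<in> range (arc V t)"
      then obtain k where k: "A = arc V t k" by blast
      have "act 0 (k div P * P) (k div P * b) ` V = V" using stabiliser_mult[OF ab(3), of "k div P"] by simp
      moreover have "k div P * P = k - k mod P" by (simp add: minus_mod_eq_div_mult)
      ultimately have "arc V t (k mod P) = arc V t k" by (intro arc_eq) simp
      then show "A \<in> arc V t ` {0..<P}" using k ab(1) by (intro image_eqI[of _ _ "k mod P"]) auto
    qed
  qed simp
  have "open_tube_1 (?S ^^ p) q U"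
    unfolding open_tube_1_def
  proof (intro conjI ballI)
    show "openin (top_of_set torus) U" unfolding U_def by (rule openin_tproj_tube[OF tubeD(1)[OF tb]])
    obtain k l where kl: "act (int p) k l ` V = V" using p unfolding R_def by blast
    show "(?S ^^ p) ` U = U" by (simp only: Sp tproj_act_eq[OF kl] U_def[symmetric])
    show "connected U" unfolding U_def
      by (intro connected_continuous_image continuous_on_tproj tubeD(2)[OF tb])
    fix \<theta> assume "\<theta> \<in> circle"
    then obtain t where t: "\<theta> = circ t" using circle_cis by blast
    show "finite (components (fibre U \<theta>))" "card (components (fibre U \<theta>)) = q"
      unfolding U_def t components_fibre_tube[OF tb] by (rule fin card_q)+
    obtain x where x: "(t, x) \<in> M" using M_fibre_nonempty by blast
    have "circ x \<notin> fibre U \<theta>"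
    proof
      assume "circ x \<in> fibre U \<theta>"
      then have "tproj (t, x) \<in> tproj ` V" by (simp add: fibre_def U_def t tproj_def)
      then obtain v where v: "v \<in> V" "tproj v = tproj (t, x)" by force
      then have "v \<in> M" using x by (simp add: M_def)
      then show False using v(1) tubeD(5)[OF tb] by blast
    qed
    then show "fibre U \<theta> \<noteq> circle" using circle_cis by blast
  qed
  moreover have "q \<ge> 1" unfolding q_def using fin[of 0] by (simp add: card_gt_0_iff Suc_leI)
  moreover have "p \<ge> 1" using p by (simp add: R_def)
  moreover have "(?S ^^ i) ` U \<inter> (?S ^^ j) ` U = {}" if "i < p" "j < p" "i \<noteq> j" for i j
    using disj[of i j] disj[of j i] that by (metis inf_commute linorder_neqE_nat)
  ultimately show ?thesis unfolding has_pq_tube_def by blast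
qed

end

theorem mainTheorem10:
  fixes \<omega> :: real and f :: "real \<times> real \<Rightarrow> real" and M :: "(complex \<times> complex) set"
  assumes "0 \<le> \<omega>" and "\<omega> < 1" and "\<omega> \<notin> \<rat>"
    and "in_T_BV f"
    and "\<not> has_pq_tube (skew_map \<omega> f)"
    and "\<not> minimal_set (skew_map \<omega> f) torus"
    and "minimal_set (skew_map \<omega> f) M"
  shows "\<forall>z\<in>M. connected_component_set M z \<subseteq> {w. fst w = fst z}"
proof -
  obtain Df :: "real \<times> real \<Rightarrow> real" where Df: "continuous_on UNIV f"
    "\<forall>\<theta> x. f (\<theta> + 1, x) = f (\<theta>, x)" "\<forall>\<theta> x. f (\<theta>, x + 1) = f (\<theta>, x) + 1"
    "\<forall>\<theta> x. ((\<lambda>y. f (\<theta>, y)) has_real_derivative Df (\<theta>, x)) (at x)"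
    "\<forall>\<theta> x. Df (\<theta>, x) > 0" "continuous_on UNIV Df"
    "set_nn_integral lborel {0..1} (\<lambda>\<theta>. total_variation (\<lambda>x. ln (Df (\<theta>, x))) 0 1) < \<infinity>"
    using \<open>in_T_BV f\<close> unfolding in_T_BV_def by blast
  \<comment> \<open>The periodicity of the derivative is inherited from that of the lift by
    uniqueness of derivatives.\<close>
  have base: "Df (\<theta> + 1, x) = Df (\<theta>, x)" for \<theta> x
  proof -
    have "((\<lambda>y. f (\<theta>, y)) has_real_derivative Df (\<theta> + 1, x)) (at x)"
      using Df(4)[rule_format, of "\<theta> + 1" x] Df(2) by simp
    then show ?thesis using Df(4) DERIV_unique by blast
  qed
  have fib: "Df (\<theta>, x + 1) = Df (\<theta>, x)" for \<theta> x
  proof -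
    have "((\<lambda>y. f (\<theta>, y + 1)) has_real_derivative Df (\<theta>, x + 1)) (at x)"
      using Df(4)[rule_format, of \<theta> "x + 1"]
      by (simp add: DERIV_shift[of "\<lambda>y. f (\<theta>, y)"])
    then have "((\<lambda>y. f (\<theta>, y) + 1) has_real_derivative Df (\<theta>, x + 1)) (at x)" using Df(3) by simp
    moreover have "((\<lambda>y. f (\<theta>, y) + 1) has_real_derivative Df (\<theta>, x) + 0) (at x)"
      by (intro DERIV_add DERIV_const) (use Df(4) in simp)
    ultimately show ?thesis using DERIV_unique by fastforce
  qed
  interpret torus_minimal \<omega> f Df M
  proof unfold_locales
    show "M \<noteq> torus" using assms(6,7) by blast
  qed (use assms(3,7) Df base fib in auto)
  have "\<nexists>P V. tube P V" using tube_has_pq_tube assms(5) by blast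
  then obtain W l where W: "W \<in> components (- torus_minimal.M M)" "l \<noteq> 0" "act 0 0 l ` W = W"
    using component_dichotomy by blast
  show ?thesis using connected_component_fst[OF W] by blast
qed

end
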